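(* Let $M$ be a smooth manifold, $k\in\mathbb{N}$, $r\in\mathbb{N}\cup\{\infty\}$, and let $X$ be a $\mathcal{C}^r$ Gaussian random field $M\to\mathbb{R}^k$ with covariance function $K_X$. For $p\in M$ and $j\in\{1,\dots,k\}$ let $h_p^j\in\mathcal{C}^r(M,\mathbb{R}^k)$ be the function $$h_p^j(q)=\begin{pmatrix}K_X(q,p)^{1j}\\ \vdots\\ K_X(q,p)^{kj}\end{pmatrix}.$$ Then $$\mathrm{supp}(X)=\overline{\mathrm{span}\{h_p^j: p\in M,\ j=1,\dots,k\}},$$ where the closure is taken in $\mathcal{C}^r(M,\mathbb{R}^k)$.
   Context: Manifolds are Hausdorff and second countable, possibly with boundary. $\mathcal{C}^r(M,\mathbb{R}^k)$ has the weak Whitney topology. A $\mathcal{C}^r$ Gaussian random field $X:M\to\mathbb{R}^k$ is a random element of $\mathcal{C}^r(M,\mathbb{R}^k)$ (up to almost sure equality) such that for all finite sets $p_1,\dots,p_j\in M$ the vector $(X(p_1),\dots,X(p_j))$ is a centered (possibly degenerate) Gaussian vector. $K_X(p,q)=\mathbb{E}\{X(p)X(q)^T\}\in\mathbb{R}^{k\times k}$. The topological support is $\mathrm{supp}(X)=\{f\in\mathcal{C}^r(M,\mathbb{R}^k):\mathbb{P}(X\in U)>0\text{ for every neighborhood }U\text{ of }f\}$. *)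

theory Defs
  imports "HOL-Probability.Probability" "HOL-Library.Function_Algebras"
begin

section \<open>Functions of class \<open>C\<^sup>r\<close> in coordinates\<close>

(* Coordinates live in the library's R^n, "Euclidean_space n": sequences vanishing from index n on.
   In particular n = 0 is allowed. *)
definition half_space :: "nat \<Rightarrow> (nat \<Rightarrow> real) topology" where
  "half_space n = subtopology (Euclidean_space n) {x. 0 \<le> x 0}"

definition coordinate_domain :: "nat \<Rightarrow> (nat \<Rightarrow> real) set \<Rightarrow> bool" where
  "coordinate_domain n S \<longleftrightarrow> openin (Euclidean_space n) S \<or> openin (half_space n) S"

(* The partial derivative in direction i is taken within S. It is one-sided only at boundary points
   of the half-space, for i = 0; for a coordinate domain S, x in S and i < n the limit is taken
   over a set accumulating at x i, so vector_derivative is unambiguous. *)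
definition slice :: "(nat \<Rightarrow> real) set \<Rightarrow> nat \<Rightarrow> (nat \<Rightarrow> real) \<Rightarrow> real set" where
  "slice S i x = {t. x(i := t) \<in> S}"

definition partial_deriv ::
  "(nat \<Rightarrow> real) set \<Rightarrow> nat \<Rightarrow> ((nat \<Rightarrow> real) \<Rightarrow> 'b::real_normed_vector) \<Rightarrow> (nat \<Rightarrow> real) \<Rightarrow> 'b" where
  "partial_deriv S i g x = vector_derivative (\<lambda>t. g (x(i := t))) (at (x i) within slice S i x)"

primrec iterated_partial ::
  "(nat \<Rightarrow> real) set \<Rightarrow> nat list \<Rightarrow> ((nat \<Rightarrow> real) \<Rightarrow> 'b::real_normed_vector) \<Rightarrow> (nat \<Rightarrow> real) \<Rightarrow> 'b" where
  "iterated_partial S [] g = g"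
| "iterated_partial S (i # is) g = partial_deriv S i (iterated_partial S is g)"

(* All iterated partial derivatives of order at most r exist on S and are continuous there,
   up to the boundary. *)
definition Cr_on ::
  "nat \<Rightarrow> enat \<Rightarrow> (nat \<Rightarrow> real) set \<Rightarrow> ((nat \<Rightarrow> real) \<Rightarrow> 'b::real_normed_vector) \<Rightarrow> bool" where
  "Cr_on n r S g \<longleftrightarrow>
     (\<forall>is. set is \<subseteq> {..<n} \<and> enat (length is) \<le> r \<longrightarrow>
        continuous_on S (iterated_partial S is g) \<and>
        (enat (length is) < r \<longrightarrow>
          (\<forall>i<n. \<forall>x\<in>S. (\<lambda>t. iterated_partial S is g (x(i := t)))
                          differentiable (at (x i) within slice S i x))))"


section \<open>Smooth manifolds with boundary\<close>

type_synonym 'm chart = "'m set \<times> ('m \<Rightarrow> nat \<Rightarrow> real)"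

definition chart_on :: "nat \<Rightarrow> 'm topology \<Rightarrow> 'm chart \<Rightarrow> bool" where
  "chart_on n M = (\<lambda>(U, \<phi>).
     openin M U \<and> coordinate_domain n (\<phi> ` U) \<and>
     homeomorphic_map (subtopology M U) (subtopology (Euclidean_space n) (\<phi> ` U)) \<phi>)"

(* Compatibility is stated for all ordered pairs of charts, so each transition map and its inverse
   are smooth. The atlas need not be maximal. *)
definition smooth_manifold :: "nat \<Rightarrow> 'm topology \<Rightarrow> 'm chart set \<Rightarrow> bool" where
  "smooth_manifold n M \<A> \<longleftrightarrow>
     Hausdorff_space M \<and> second_countable M \<and>
     (\<forall>c\<in>\<A>. chart_on n M c) \<and>
     topspace M = (\<Union>(U, \<phi>)\<in>\<A>. U) \<and>
     (\<forall>(U, \<phi>)\<in>\<A>. \<forall>(V, \<psi>)\<in>\<A>. \<forall>i<n.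
        Cr_on n \<infinity> (\<phi> ` (U \<inter> V)) (\<lambda>x. \<psi> (inv_into U \<phi> x) i))"


section \<open>The space of \<open>C\<^sup>r\<close> functions with the weak Whitney topology\<close>

definition local_rep :: "'m chart \<Rightarrow> ('m \<Rightarrow> 'b) \<Rightarrow> (nat \<Rightarrow> real) \<Rightarrow> 'b" where
  "local_rep c f = f \<circ> inv_into (fst c) (snd c)"

definition chart_image :: "'m chart \<Rightarrow> (nat \<Rightarrow> real) set" where
  "chart_image c = snd c ` fst c"

(* A function on M is represented by its extension by zero to the whole type, so that distinct
   representatives are distinct functions on M and pointwise operations are those of the
   function type. *)
definition Cr_functions ::
  "nat \<Rightarrow> 'm topology \<Rightarrow> 'm chart set \<Rightarrow> enat \<Rightarrow> ('m \<Rightarrow> 'b::real_normed_vector) set" where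
  "Cr_functions n M \<A> r =
     {f. (\<forall>p. p \<notin> topspace M \<longrightarrow> f p = 0) \<and>
         (\<forall>c\<in>\<A>. Cr_on n r (chart_image c) (local_rep c f))}"

definition whitney_nbhd ::
  "nat \<Rightarrow> 'm topology \<Rightarrow> 'm chart set \<Rightarrow> enat \<Rightarrow> ('m \<Rightarrow> 'b::real_normed_vector) \<Rightarrow>
   'm chart \<Rightarrow> 'm set \<Rightarrow> nat \<Rightarrow> real \<Rightarrow> ('m \<Rightarrow> 'b) set" where
  "whitney_nbhd n M \<A> r f c K s \<epsilon> =
     {g \<in> Cr_functions n M \<A> r.
        \<forall>is. set is \<subseteq> {..<n} \<and> length is \<le> s \<longrightarrow>
          (\<forall>x\<in>snd c ` K.
             norm (iterated_partial (chart_image c) is (local_rep c g) x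
                   - iterated_partial (chart_image c) is (local_rep c f) x) < \<epsilon>)}"

(* Finite orders s \<le> r only: for r = \<infinity> this is the topology generated by those of all finite orders.
   The target is a normed space, used with its identity chart. The whole space is listed
   because an empty manifold may have an empty atlas. *)
definition weak_whitney ::
  "nat \<Rightarrow> 'm topology \<Rightarrow> 'm chart set \<Rightarrow> enat \<Rightarrow> ('m \<Rightarrow> 'b::real_normed_vector) topology" where
  "weak_whitney n M \<A> r = topology_generated_by
     (insert (Cr_functions n M \<A> r)
       {whitney_nbhd n M \<A> r f c K s \<epsilon> | f c K s \<epsilon>.
          f \<in> Cr_functions n M \<A> r \<and> c \<in> \<A> \<and> compactin M K \<and> K \<subseteq> fst c \<and> enat s \<le> r \<and> 0 < \<epsilon>})"

lemma topspace_weak_whitney: "topspace (weak_whitney n M \<A> r) = Cr_functions n M \<A> r"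
  by (auto simp: weak_whitney_def whitney_nbhd_def)

definition borel_of_topology :: "'a topology \<Rightarrow> 'a measure" where
  "borel_of_topology T = sigma (topspace T) {U. openin T U}"


section \<open>Gaussian random fields\<close>

definition centered_gaussian :: "'w measure \<Rightarrow> ('w \<Rightarrow> real) \<Rightarrow> bool" where
  "centered_gaussian P Y \<longleftrightarrow>
     Y \<in> borel_measurable P \<and>
     ((\<exists>\<sigma>>0. distributed P lborel Y (normal_density 0 \<sigma>)) \<or> (AE \<omega> in P. Y \<omega> = 0))"

(* The family (Y p), p in F, is regarded as one vector; it is Gaussian if every linear functional
   of it is. *)
definition centered_gaussian_vector ::
  "'w measure \<Rightarrow> 'i set \<Rightarrow> ('i \<Rightarrow> 'w \<Rightarrow> 'v::euclidean_space) \<Rightarrow> bool" where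
  "centered_gaussian_vector P F Y \<longleftrightarrow>
     (\<forall>a. centered_gaussian P (\<lambda>\<omega>. \<Sum>p\<in>F. a p \<bullet> Y p \<omega>))"

definition gaussian_random_field ::
  "'w measure \<Rightarrow> nat \<Rightarrow> 'm topology \<Rightarrow> 'm chart set \<Rightarrow> enat \<Rightarrow> ('w \<Rightarrow> 'm \<Rightarrow> real^'k) \<Rightarrow> bool" where
  "gaussian_random_field P n M \<A> r X \<longleftrightarrow>
     prob_space P \<and>
     X \<in> measurable P (borel_of_topology (weak_whitney n M \<A> r)) \<and>
     (\<forall>F. finite F \<and> F \<subseteq> topspace M \<longrightarrow> centered_gaussian_vector P F (\<lambda>p \<omega>. X \<omega> p))"

definition covariance :: "'w measure \<Rightarrow> ('w \<Rightarrow> 'm \<Rightarrow> real^'k) \<Rightarrow> 'm \<Rightarrow> 'm \<Rightarrow> real^'k^'k" where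
  "covariance P X p q = (\<chi> i j. \<integral>\<omega>. X \<omega> p $ i * X \<omega> q $ j \<partial>P)"

definition cov_fun :: "'w measure \<Rightarrow> ('w \<Rightarrow> 'm \<Rightarrow> real^'k) \<Rightarrow> 'm \<Rightarrow> 'k \<Rightarrow> 'm \<Rightarrow> real^'k" where
  "cov_fun P X p j = (\<lambda>q. \<chi> i. covariance P X q p $ i $ j)"

(* Open neighbourhoods suffice, and for them the event is measurable. *)
definition topological_support :: "'w measure \<Rightarrow> 'a topology \<Rightarrow> ('w \<Rightarrow> 'a) \<Rightarrow> 'a set" where
  "topological_support P T X =
     {f \<in> topspace T. \<forall>U. openin T U \<and> f \<in> U \<longrightarrow> 0 < measure P {\<omega> \<in> space P. X \<omega> \<in> U}}"

(* The function type carries pointwise addition but no scaleR, hence the explicit scalar action. *)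
definition fun_span :: "('m \<Rightarrow> 'b::real_vector) set \<Rightarrow> ('m \<Rightarrow> 'b) set" where
  "fun_span = module.span (\<lambda>(c::real) f q. c *\<^sub>R f q)"

lemma module_fun: "module (\<lambda>(c::real) (f::'m \<Rightarrow> 'b::real_vector) q. c *\<^sub>R f q)"
  by unfold_locales (auto simp: fun_eq_iff scaleR_add_right scaleR_add_left)

end

theory Submission
  imports Defs
begin

text \<open>Let \<open>G\<close> be the linear space spanned by the components of the values \<open>X p\<close>; the span of the
  \<open>h\<^sub>p\<^sup>j\<close> is the set of the functions \<open>h\<^sub>Y q = E (X q Y)\<close> with \<open>Y\<close> in \<open>G\<close>. For Gaussian variables
  pointwise convergence implies convergence in \<open>L\<^sup>2\<close>, so partial derivatives of \<open>X\<close> stay in the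
  \<open>L\<^sup>2\<close> closure of \<open>G\<close>, commute with the expectation, and \<open>h\<^sub>Y\<close> is of class \<open>C\<^sup>r\<close>.

  If \<open>f\<close> is in the support, then the event \<open>A\<close> that \<open>X\<close> is close to \<open>f\<close> has positive probability,
  and \<open>E (X 1\<^sub>A) / P A\<close> is close to \<open>f\<close>. This function only depends on the orthogonal projection of
  \<open>1\<^sub>A / P A\<close> to the closure of \<open>G\<close>, hence is approximated by some \<open>h\<^sub>Y\<close>. No duality for \<open>C\<^sup>r\<close>
  is needed.

  Conversely, \<open>X\<close> has the law of \<open>(X - X') / sqrt 2\<close> for an independent copy \<open>X'\<close>, so separability
  gives \<open>X\<close> positive mass near \<open>0\<close>. For \<open>h\<^sub>Y\<close> one replaces the component of \<open>X\<close> along \<open>Y\<close> by an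
  independent copy, which has positive mass near \<open>E Y\<^sup>2\<close>. Only countably many coordinates matter,
  so it suffices to compare finite-dimensional laws.\<close>

section \<open>Centered Gaussian variables\<close>

text \<open>A centered Gaussian variable, degenerate or not, has characteristic function exp(- u^2 s
  / 2), where s is its second moment. Dominated convergence yields convergence of characteristic
  functions from pointwise convergence alone, and taking logarithms turns this into convergence of
  second moments; no estimate of suprema of the field enters. Derivatives of X are limits of
  difference quotients and leave the span of the values. The structure of a Gaussian space is
  therefore established a second time for the L2 closure, and both halves of the proof work there.
  The approximation by functions h_Y has to be uniform on compact sets: the error of an almost
  projection is at most delta times the L2 norm of the controlled derivative, and this norm is
  bounded on compact sets by continuity. In the converse half neither X - X' nor the modified field
  is treated as a random element of the function space. Only real variables at countably many points
  are compared, through one-dimensional Levy uniqueness with nonnegative weights, so the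
  sigma-algebra on C^r enters only through the events that X lies in an open set.\<close>

lemma centered_gaussian_moments:
  assumes P: "prob_space P" and G: "centered_gaussian P Y"
  shows centered_gaussian_integrable_square: "integrable P (\<lambda>\<omega>. (Y \<omega>)\<^sup>2)"
    and centered_gaussian_char:
      "(CLINT \<omega>|P. iexp (u * Y \<omega>)) = of_real (exp (- (u\<^sup>2 * (\<integral>\<omega>. (Y \<omega>)\<^sup>2 \<partial>P)) / 2))"
proof -
  interpret prob_space P by fact
  have Y[measurable]: "Y \<in> borel_measurable P" using G by (simp add: centered_gaussian_def)
  have "integrable P (\<lambda>\<omega>. (Y \<omega>)\<^sup>2) \<and>
      (CLINT \<omega>|P. iexp (u * Y \<omega>)) = of_real (exp (- (u\<^sup>2 * (\<integral>\<omega>. (Y \<omega>)\<^sup>2 \<partial>P)) / 2))"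
  proof (cases "AE \<omega> in P. Y \<omega> = 0")
    case True
    have "(\<integral>\<omega>. (Y \<omega>)\<^sup>2 \<partial>P) = (\<integral>\<omega>. 0 \<partial>P)"
      by (rule integral_cong_AE) (use True in auto)
    moreover have "integrable P (\<lambda>\<omega>. (Y \<omega>)\<^sup>2) \<longleftrightarrow> integrable P (\<lambda>\<omega>. 0::real)"
      by (rule integrable_cong_AE) (use True in auto)
    moreover have "(CLINT \<omega>|P. iexp (u * Y \<omega>)) = (CLINT \<omega>|P. 1)"
      by (rule integral_cong_AE) (use True in auto)
    ultimately show ?thesis by (simp add: prob_space)
  next
    case False
    then obtain \<sigma> where \<sigma>: "\<sigma> > 0" "distributed P lborel Y (normal_density 0 \<sigma>)"
      using G by (auto simp: centered_gaussian_def)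
    \<comment> \<open>Rescaling reduces to the standard normal law, whose moments and characteristic
      function are known. The resulting formula is the one of the degenerate case with
      \<open>\<sigma>\<^sup>2\<close> in place of 0.\<close>
    define Z where "Z = (\<lambda>\<omega>. Y \<omega> / \<sigma>)"
    have [measurable]: "Z \<in> borel_measurable P" by (simp add: Z_def)
    have "distributed P lborel Z std_normal_density"
      using normal_standard_normal_convert[OF \<sigma>(1), of Y 0] \<sigma>(2) by (simp add: Z_def)
    then have d: "distr P borel Z = std_normal_distribution"
      unfolding distributed_def by (metis distr_cong sets_lborel)
    have YZ: "Y \<omega> = \<sigma> * Z \<omega>" for \<omega> using \<sigma> by (simp add: Z_def)
    have i: "integrable P (\<lambda>\<omega>. (Z \<omega>)\<^sup>2)"
      using integrable_std_normal_distribution_moment[of 2]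
      unfolding d[symmetric] by (subst (asm) integrable_distr_eq) auto
    have "(\<integral>\<omega>. (Z \<omega>)\<^sup>2 \<partial>P) = (\<integral>z. z\<^sup>2 \<partial>distr P borel Z)"
      by (subst integral_distr) auto
    also have "\<dots> = 1"
      unfolding d using std_normal_distribution_even_moments(1)[of 1] by (simp add: fact_numeral)
    finally have v: "(\<integral>\<omega>. (Z \<omega>)\<^sup>2 \<partial>P) = 1" .
    have "(CLINT \<omega>|P. iexp (u * Y \<omega>)) = char (distr P borel Z) (u * \<sigma>)"
      unfolding char_def by (subst integral_distr) (auto simp: YZ mult_ac)
    also have "\<dots> = of_real (exp (- ((u * \<sigma>)\<^sup>2) / 2))"
      unfolding d char_std_normal_distribution ..
    finally have c: "(CLINT \<omega>|P. iexp (u * Y \<omega>)) = of_real (exp (- ((u * \<sigma>)\<^sup>2) / 2))" .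
    have "(\<integral>\<omega>. (Y \<omega>)\<^sup>2 \<partial>P) = \<sigma>\<^sup>2"
      using v by (simp add: YZ power_mult_distrib)
    moreover have "integrable P (\<lambda>\<omega>. (Y \<omega>)\<^sup>2)"
      using i by (simp add: YZ power_mult_distrib)
    ultimately show ?thesis using c by (simp add: power_mult_distrib)
  qed
  then show "integrable P (\<lambda>\<omega>. (Y \<omega>)\<^sup>2)"
    "(CLINT \<omega>|P. iexp (u * Y \<omega>)) = of_real (exp (- (u\<^sup>2 * (\<integral>\<omega>. (Y \<omega>)\<^sup>2 \<partial>P)) / 2))"
    by auto
qed

text \<open>Levy uniqueness identifies the law of \<open>Y\<close> with the point mass at 0 or with
  the normal law of variance \<open>s\<close>. Together with \<open>centered_gaussian_char\<close>
  this reduces Gaussianity to characteristic functions, which pass to limits.\<close>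

lemma centered_gaussianI_char:
  assumes P: "prob_space P" and Y[measurable]: "Y \<in> borel_measurable P" and s: "s \<ge> 0"
    and char: "\<And>u. (CLINT \<omega>|P. iexp (u * Y \<omega>)) = of_real (exp (- (u\<^sup>2 * s) / 2))"
  shows "centered_gaussian P Y"
proof -
  interpret prob_space P by fact
  have cY: "char (distr P borel Y) = (\<lambda>u. of_real (exp (- (u\<^sup>2 * s) / 2)))"
    unfolding char_def by (rule ext, subst integral_distr) (auto simp: char simp del: of_real_mult)
  have rY: "real_distribution (distr P borel Y)" by (rule real_distribution_distr) simp
  show ?thesis
  proof (cases "s = 0")
    case True
    have r0: "real_distribution (distr P borel (\<lambda>_. 0::real))" by (rule real_distribution_distr) simp
    have "char (distr P borel (\<lambda>_. 0::real)) = char (distr P borel Y)"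
      unfolding cY True unfolding char_def
      by (rule ext, subst integral_distr) (auto simp: prob_space)
    then have eq: "distr P borel Y = distr P borel (\<lambda>_. 0::real)"
      using Levy_uniqueness[OF rY r0] by simp
    have "AE y in distr P borel (\<lambda>_. 0::real). y = 0"
      by (subst AE_distr_iff) auto
    then have "AE \<omega> in P. Y \<omega> = 0"
      unfolding eq[symmetric] by (subst (asm) AE_distr_iff) auto
    then show ?thesis by (simp add: centered_gaussian_def)
  next
    case False
    define \<sigma> where "\<sigma> = sqrt s"
    have \<sigma>: "\<sigma> > 0" "\<sigma>\<^sup>2 = s" using False s by (auto simp: \<sigma>_def)
    define N where "N = density lborel (normal_density 0 \<sigma>)"
    have N: "prob_space N" unfolding N_def using \<sigma>(1) by (simp add: prob_space_normal_density)
    interpret N: prob_space N by fact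
    have [measurable_cong]: "sets N = sets borel" by (simp add: N_def)
    have rN: "real_distribution N"
      using N by (auto simp: real_distribution_def real_distribution_axioms_def) (simp add: N_def)
    have "distributed N lborel (\<lambda>x. x) (normal_density 0 \<sigma>)"
      unfolding distributed_def by (auto simp: N_def intro!: distr_id2)
    then have "distributed N lborel (\<lambda>x. x / \<sigma>) std_normal_density"
      using N.normal_standard_normal_convert[OF \<sigma>(1), of "\<lambda>x. x" 0] by simp
    then have d: "distr N borel (\<lambda>x. x / \<sigma>) = std_normal_distribution"
      unfolding distributed_def by (metis distr_cong sets_lborel)
    have "char N u = of_real (exp (- (u\<^sup>2 * s) / 2))" for u
    proof -
      have "char N u = char (distr N borel (\<lambda>x. x / \<sigma>)) (u * \<sigma>)"
        unfolding char_def using \<sigma> by (subst integral_distr) auto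
      then show ?thesis unfolding d char_std_normal_distribution
        using \<sigma> by (simp add: power_mult_distrib)
    qed
    then have "char (distr P borel Y) = char N" unfolding cY by (intro ext) (rule sym)
    then have "distr P borel Y = N" by (rule Levy_uniqueness[OF rY rN])
    then have "distributed P lborel Y (normal_density 0 \<sigma>)"
      unfolding distributed_def N_def by (simp cong: distr_cong)
    then show ?thesis using \<sigma> by (auto simp: centered_gaussian_def)
  qed
qed

lemma centered_gaussian_measurable: "centered_gaussian P Y \<Longrightarrow> Y \<in> borel_measurable P"
  by (simp add: centered_gaussian_def)

text \<open>The variances converge because the limiting characteristic function, being continuous,
  does not vanish near \<open>0\<close>.\<close>

lemma centered_gaussian_of_char_limit:
  assumes P: "prob_space P" and Y[measurable]: "Y \<in> borel_measurable P"
    and lim: "\<And>u. (\<lambda>n. of_real (exp (- (u\<^sup>2 * s n) / 2))) \<longlonglongrightarrow> (CLINT \<omega>|P. iexp (u * Y \<omega>))"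
    and s: "\<And>n. s n \<ge> 0"
  shows "centered_gaussian P Y"
proof -
  interpret prob_space P by fact
  define \<phi> where "\<phi> u = (CLINT \<omega>|P. iexp (u * Y \<omega>))" for u
  have "(\<lambda>m. \<phi> (1 / real (Suc m))) \<longlonglongrightarrow> (CLINT \<omega>|P. 1)"
    unfolding \<phi>_def
  proof (rule integral_dominated_convergence[where w="\<lambda>_. 1"])
    show "AE \<omega> in P. (\<lambda>m. iexp (1 / real (Suc m) * Y \<omega>)) \<longlonglongrightarrow> 1"
    proof (rule AE_I2)
      fix \<omega>
      have "(\<lambda>m. 1 / real (Suc m) * Y \<omega>) \<longlonglongrightarrow> 0 * Y \<omega>"
        using LIMSEQ_inverse_real_of_nat
        by (intro tendsto_mult tendsto_const) (simp add: inverse_eq_divide)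
      then have "(\<lambda>m. iexp (1 / real (Suc m) * Y \<omega>)) \<longlonglongrightarrow> iexp (0 * Y \<omega>)"
        by (rule isCont_tendsto_compose[OF isCont_iexp])
      then show "(\<lambda>m. iexp (1 / real (Suc m) * Y \<omega>)) \<longlonglongrightarrow> 1" by simp
    qed
  qed auto
  then have "(\<lambda>m. \<phi> (1 / real (Suc m))) \<longlonglongrightarrow> 1" by (simp add: prob_space)
  then have "eventually (\<lambda>m. \<phi> (1 / real (Suc m)) \<noteq> 0) sequentially"
    by (rule tendsto_imp_eventually_ne) simp
  then obtain m where "\<phi> (1 / real (Suc m)) \<noteq> 0"
    unfolding eventually_sequentially by blast
  then obtain u0 :: real where u0: "u0 > 0" "\<phi> u0 \<noteq> 0"
    using that[of "1 / real (Suc m)"] by simp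
  have lim': "(\<lambda>n. exp (- (u\<^sup>2 * s n) / 2)) \<longlonglongrightarrow> Re (\<phi> u)" for u
    using tendsto_Re[OF lim[of u]] by (simp add: \<phi>_def)
  have im: "\<phi> u = of_real (Re (\<phi> u))" for u
  proof (rule LIMSEQ_unique)
    show "(\<lambda>n. of_real (exp (- (u\<^sup>2 * s n) / 2))) \<longlonglongrightarrow> \<phi> u" using lim by (simp add: \<phi>_def)
    show "(\<lambda>n. of_real (exp (- (u\<^sup>2 * s n) / 2))) \<longlonglongrightarrow> complex_of_real (Re (\<phi> u))"
      by (rule tendsto_of_real[OF lim'])
  qed
  \<comment> \<open>A nonzero limit is what permits the logarithm; it excludes that
    \<open>s n\<close> is unbounded. Dividing by \<open>u0\<^sup>2\<close> then recovers
    \<open>s n\<close>.\<close>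
  have "Re (\<phi> u0) \<noteq> 0" using u0(2) im[of u0] by (metis of_real_0)
  then have "(\<lambda>n. ln (exp (- (u0\<^sup>2 * s n) / 2))) \<longlonglongrightarrow> ln (Re (\<phi> u0))"
    by (intro tendsto_ln lim')
  then have "(\<lambda>n. - 2 / u0\<^sup>2 * (- (u0\<^sup>2 * s n) / 2)) \<longlonglongrightarrow> - 2 / u0\<^sup>2 * ln (Re (\<phi> u0))"
    by (intro tendsto_mult tendsto_const) simp
  moreover have "- 2 / u0\<^sup>2 * (- (u0\<^sup>2 * s n) / 2) = s n" for n using u0 by simp
  ultimately obtain s' where s': "s \<longlonglongrightarrow> s'" by auto
  have "s' \<ge> 0" using s by (intro LIMSEQ_le_const[OF s']) auto
  moreover have "\<phi> u = of_real (exp (- (u\<^sup>2 * s') / 2))" for u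
  proof (rule LIMSEQ_unique)
    show "(\<lambda>n. of_real (exp (- (u\<^sup>2 * s n) / 2))) \<longlonglongrightarrow> \<phi> u" using lim by (simp add: \<phi>_def)
    show "(\<lambda>n. of_real (exp (- (u\<^sup>2 * s n) / 2))) \<longlonglongrightarrow> complex_of_real (exp (- (u\<^sup>2 * s') / 2))"
      by (intro tendsto_of_real tendsto_exp tendsto_divide tendsto_minus tendsto_mult tendsto_const s') simp
  qed
  ultimately show ?thesis
    using centered_gaussianI_char[OF P Y, of s'] by (simp add: \<phi>_def)
qed

lemma tendsto_char:
  assumes P: "prob_space P" and W: "\<And>n. W n \<in> borel_measurable P" and Y: "Y \<in> borel_measurable P"
    and lim: "\<And>\<omega>. \<omega> \<in> space P \<Longrightarrow> (\<lambda>n. W n \<omega>) \<longlonglongrightarrow> Y \<omega>"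
  shows "(\<lambda>n. CLINT \<omega>|P. iexp (u * W n \<omega>)) \<longlonglongrightarrow> (CLINT \<omega>|P. iexp (u * Y \<omega>))"
proof -
  interpret prob_space P by fact
  note W[measurable] Y[measurable]
  show ?thesis
  proof (rule integral_dominated_convergence[where w="\<lambda>_. 1"])
    show "AE \<omega> in P. (\<lambda>m. iexp (u * W m \<omega>)) \<longlonglongrightarrow> iexp (u * Y \<omega>)"
      by (rule AE_I2, rule isCont_tendsto_compose[OF isCont_iexp]) (intro tendsto_mult tendsto_const lim)
  qed auto
qed

text \<open>The characteristic functions of \<open>W n\<close> are explicit, so pointwise
  convergence suffices. This makes limits of difference quotients Gaussian.\<close>

lemma centered_gaussian_limit:
  assumes P: "prob_space P" and W: "\<And>n. centered_gaussian P (W n)"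
    and lim: "\<And>\<omega>. \<omega> \<in> space P \<Longrightarrow> (\<lambda>n. W n \<omega>) \<longlonglongrightarrow> Y \<omega>"
  shows "centered_gaussian P Y"
proof (rule centered_gaussian_of_char_limit[OF P])
  show Y: "Y \<in> borel_measurable P"
    by (rule borel_measurable_LIMSEQ_real[OF lim]) (use W in \<open>auto simp: centered_gaussian_measurable\<close>)
  show "(\<lambda>n. of_real (exp (- (u\<^sup>2 * (\<integral>\<omega>. (W n \<omega>)\<^sup>2 \<partial>P)) / 2))) \<longlonglongrightarrow> (CLINT \<omega>|P. iexp (u * Y \<omega>))" for u
    unfolding centered_gaussian_char[OF P W, symmetric]
    by (rule tendsto_char[OF P _ Y lim]) (use W in \<open>auto simp: centered_gaussian_measurable\<close>)
qed simp

text \<open>The variance is read off from the characteristic function at 1. Applied to differences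
  from a limit, this turns pointwise convergence into L2 convergence.\<close>

lemma centered_gaussian_tendsto_0_variance:
  assumes P: "prob_space P" and W: "\<And>n. centered_gaussian P (W n)"
    and lim: "\<And>\<omega>. \<omega> \<in> space P \<Longrightarrow> (\<lambda>n. W n \<omega>) \<longlonglongrightarrow> 0"
  shows "(\<lambda>n. \<integral>\<omega>. (W n \<omega>)\<^sup>2 \<partial>P) \<longlonglongrightarrow> 0"
proof -
  interpret prob_space P by fact
  have "(\<lambda>n. CLINT \<omega>|P. iexp (1 * W n \<omega>)) \<longlonglongrightarrow> (CLINT \<omega>|P. iexp (1 * 0))"
    by (rule tendsto_char[OF P _ _ lim]) (use W in \<open>auto simp: centered_gaussian_measurable\<close>)
  then have "(\<lambda>n. complex_of_real (exp (- (1\<^sup>2 * (\<integral>\<omega>. (W n \<omega>)\<^sup>2 \<partial>P)) / 2))) \<longlonglongrightarrow> 1"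
    unfolding centered_gaussian_char[OF P W] by (simp add: prob_space)
  from tendsto_Re[OF this] have "(\<lambda>n. exp (- (\<integral>\<omega>. (W n \<omega>)\<^sup>2 \<partial>P) / 2)) \<longlonglongrightarrow> 1" by simp
  then have "(\<lambda>n. ln (exp (- (\<integral>\<omega>. (W n \<omega>)\<^sup>2 \<partial>P) / 2))) \<longlonglongrightarrow> ln 1"
    by (intro tendsto_ln) auto
  then have "(\<lambda>n. - 2 * (- (\<integral>\<omega>. (W n \<omega>)\<^sup>2 \<partial>P) / 2)) \<longlonglongrightarrow> - 2 * 0"
    by (intro tendsto_mult tendsto_const) simp
  then show ?thesis by simp
qed

section \<open>Gaussian spaces\<close>

lemma integrable_mult_of_squares:
  fixes f g :: "'a \<Rightarrow> real"
  assumes [measurable]: "f \<in> borel_measurable M" "g \<in> borel_measurable M"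
    and f: "integrable M (\<lambda>x. (f x)\<^sup>2)" and g: "integrable M (\<lambda>x. (g x)\<^sup>2)"
  shows "integrable M (\<lambda>x. f x * g x)"
proof (rule Bochner_Integration.integrable_bound[OF Bochner_Integration.integrable_add[OF f g]])
  show "AE x in M. norm (f x * g x) \<le> norm ((f x)\<^sup>2 + (g x)\<^sup>2)"
  proof (rule AE_I2)
    fix x
    have "2 * \<bar>f x\<bar> * \<bar>g x\<bar> \<le> \<bar>f x\<bar>\<^sup>2 + \<bar>g x\<bar>\<^sup>2" by (rule sum_squares_bound)
    moreover have "0 \<le> \<bar>f x\<bar> * \<bar>g x\<bar>" by simp
    ultimately show "norm (f x * g x) \<le> norm ((f x)\<^sup>2 + (g x)\<^sup>2)"
      unfolding real_norm_def abs_mult by (simp only: power2_abs)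
  qed
qed simp

lemma integral_cauchy_schwarz:
  fixes f g :: "'a \<Rightarrow> real"
  assumes m[measurable]: "f \<in> borel_measurable M" "g \<in> borel_measurable M"
    and f: "integrable M (\<lambda>x. (f x)\<^sup>2)" and g: "integrable M (\<lambda>x. (g x)\<^sup>2)"
  shows "\<bar>\<integral>x. f x * g x \<partial>M\<bar> \<le> sqrt (\<integral>x. (f x)\<^sup>2 \<partial>M) * sqrt (\<integral>x. (g x)\<^sup>2 \<partial>M)"
proof -
  define a b c where "a = (\<integral>x. (f x)\<^sup>2 \<partial>M)" and "b = (\<integral>x. (g x)\<^sup>2 \<partial>M)" and "c = (\<integral>x. f x * g x \<partial>M)"
  note fg = integrable_mult_of_squares[OF m f g]
  have q: "0 \<le> a - 2 * s * c + s\<^sup>2 * b" for s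
  proof -
    have "0 \<le> (\<integral>x. (f x - s * g x)\<^sup>2 \<partial>M)" by simp
    also have "\<dots> = (\<integral>x. (f x)\<^sup>2 - 2 * s * (f x * g x) + s\<^sup>2 * (g x)\<^sup>2 \<partial>M)"
      by (simp add: power2_diff power_mult_distrib algebra_simps)
    also have "\<dots> = a - 2 * s * c + s\<^sup>2 * b"
      using f g fg by (simp add: a_def b_def c_def)
    finally show ?thesis .
  qed
  have b0: "0 \<le> b" by (simp add: b_def)
  have "c\<^sup>2 \<le> a * b"
  proof (cases "b = 0")
    case True
    have "c = 0"
    proof (rule ccontr)
      assume "c \<noteq> 0"
      \<comment> \<open>For \<open>b = 0\<close> the quadratic is affine in \<open>s\<close>, and
        this \<open>s\<close> gives it the value -1.\<close>
      then show False using q[of "(a + 1) / (2 * c)"] True by simp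
    qed
    with True show ?thesis by simp
  next
    case False
    then have "0 \<le> a - 2 * (c / b) * c + (c / b)\<^sup>2 * b" using q by blast
    also have "\<dots> = a - c\<^sup>2 / b" using False by (simp add: power2_eq_square)
    finally show ?thesis using False b0 by (simp add: field_simps)
  qed
  then have "\<bar>c\<bar> \<le> sqrt (a * b)" using real_le_rsqrt by auto
  then show ?thesis by (simp add: a_def b_def c_def real_sqrt_mult)
qed

lemma square_integrable_add:
  fixes f g :: "'a \<Rightarrow> real"
  assumes m[measurable]: "f \<in> borel_measurable M" "g \<in> borel_measurable M"
    and f: "integrable M (\<lambda>x. (f x)\<^sup>2)" and g: "integrable M (\<lambda>x. (g x)\<^sup>2)"
  shows "integrable M (\<lambda>x. (f x + g x)\<^sup>2)"
    and "(\<integral>x. (f x + g x)\<^sup>2 \<partial>M) \<le> 2 * (\<integral>x. (f x)\<^sup>2 \<partial>M) + 2 * (\<integral>x. (g x)\<^sup>2 \<partial>M)"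
proof -
  show i: "integrable M (\<lambda>x. (f x + g x)\<^sup>2)"
    using f g integrable_mult_of_squares[OF m f g] by (simp add: power2_sum mult.assoc)
  have "(\<integral>x. (f x + g x)\<^sup>2 \<partial>M) \<le> (\<integral>x. 2 * (f x)\<^sup>2 + 2 * (g x)\<^sup>2 \<partial>M)"
  proof (rule integral_mono[OF i])
    show "(f x + g x)\<^sup>2 \<le> 2 * (f x)\<^sup>2 + 2 * (g x)\<^sup>2" for x
      using sum_squares_bound[of "f x" "g x"] by (simp add: power2_sum)
  qed (use f g in simp)
  also have "\<dots> = 2 * (\<integral>x. (f x)\<^sup>2 \<partial>M) + 2 * (\<integral>x. (g x)\<^sup>2 \<partial>M)" using f g by simp
  finally show "(\<integral>x. (f x + g x)\<^sup>2 \<partial>M) \<le> 2 * (\<integral>x. (f x)\<^sup>2 \<partial>M) + 2 * (\<integral>x. (g x)\<^sup>2 \<partial>M)" .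
qed

lemma cmod_iexp_diff_le: "cmod (iexp a - iexp b) \<le> \<bar>a - b\<bar>"
proof -
  have "iexp a - iexp b = iexp b * (iexp (a - b) - 1)"
    by (simp add: algebra_simps flip: exp_add)
  then have "cmod (iexp a - iexp b) = cmod (iexp (a - b) - 1)" by (simp add: norm_mult)
  also have "\<dots> \<le> \<bar>a - b\<bar>" using iexp_approx1[of "a - b" 0] by simp
  finally show ?thesis .
qed

text \<open>Joint Gaussianity is encoded by linearity of \<open>V\<close> and Gaussianity of each
  single element. Elements are genuine functions, not classes modulo null sets, so pointwise limits
  make sense. The locale is used for a space and again for its L2 closure.\<close>

locale gaussian_space = prob_space P for P :: "'w measure" +
  fixes V :: "('w \<Rightarrow> real) set"
  assumes gaussian: "W \<in> V \<Longrightarrow> centered_gaussian P W"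
    and zero: "(\<lambda>_. 0) \<in> V"
    and add: "W \<in> V \<Longrightarrow> W' \<in> V \<Longrightarrow> (\<lambda>\<omega>. W \<omega> + W' \<omega>) \<in> V"
    and scale: "W \<in> V \<Longrightarrow> (\<lambda>\<omega>. c * W \<omega>) \<in> V"
begin

lemma measurable: "W \<in> V \<Longrightarrow> W \<in> borel_measurable P"
  using gaussian by (rule centered_gaussian_measurable)

lemma integrable_square: "W \<in> V \<Longrightarrow> integrable P (\<lambda>\<omega>. (W \<omega>)\<^sup>2)"
  using centered_gaussian_integrable_square[OF prob_space_axioms gaussian] .

lemma char_eq: "W \<in> V \<Longrightarrow> (CLINT \<omega>|P. iexp (u * W \<omega>)) = of_real (exp (- (u\<^sup>2 * expectation (\<lambda>\<omega>. (W \<omega>)\<^sup>2)) / 2))"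
  using centered_gaussian_char[OF prob_space_axioms gaussian] .

lemma diff:
  assumes "W \<in> V" "W' \<in> V" shows "(\<lambda>\<omega>. W \<omega> - W' \<omega>) \<in> V"
  using add[OF assms(1) scale[OF assms(2), of "-1"]] by simp

text \<open>Integrability is demanded explicitly because the integral of a non-integrable function
  is 0 by convention, which would make the smallness condition vacuous.\<close>

definition l2_closure :: "('w \<Rightarrow> real) set" where
  "l2_closure = {W \<in> borel_measurable P.
     \<forall>\<epsilon>>0. \<exists>v\<in>V. integrable P (\<lambda>\<omega>. (W \<omega> - v \<omega>)\<^sup>2) \<and> expectation (\<lambda>\<omega>. (W \<omega> - v \<omega>)\<^sup>2) < \<epsilon>}"

lemma subset_l2_closure: "V \<subseteq> l2_closure"
proof
  fix W assume W: "W \<in> V"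
  then show "W \<in> l2_closure"
    using measurable[OF W] by (auto simp: l2_closure_def intro!: bexI[of _ W])
qed

lemma l2_closureE:
  assumes "W \<in> l2_closure" "\<epsilon> > 0"
  obtains v where "v \<in> V" "integrable P (\<lambda>\<omega>. (W \<omega> - v \<omega>)\<^sup>2)" "expectation (\<lambda>\<omega>. (W \<omega> - v \<omega>)\<^sup>2) < \<epsilon>"
  using assms by (auto simp: l2_closure_def)

lemma l2_closure_sequence:
  assumes "W \<in> l2_closure"
  obtains v where "\<forall>n. v n \<in> V \<and> integrable P (\<lambda>\<omega>. (W \<omega> - v n \<omega>)\<^sup>2) \<and>
    expectation (\<lambda>\<omega>. (W \<omega> - v n \<omega>)\<^sup>2) < inverse (real (Suc n))"
proof -
  let ?Q = "\<lambda>n v. v \<in> V \<and> integrable P (\<lambda>\<omega>. (W \<omega> - v \<omega>)\<^sup>2) \<and>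
      expectation (\<lambda>\<omega>. (W \<omega> - v \<omega>)\<^sup>2) < inverse (real (Suc n))"
  have "\<exists>v. ?Q n v" for n
  proof -
    have "0 < inverse (real (Suc n))" by simp
    from l2_closureE[OF assms this] show ?thesis by blast
  qed
  then have "\<exists>v. \<forall>n. ?Q n (v n)" by (intro choice allI)
  with that show ?thesis by blast
qed

text \<open>L2 approximation need not converge pointwise, so characteristic functions are compared
  directly: they differ by at most \<open>\<bar>u\<bar>\<close> times the L1 distance, hence times
  the L2 distance.\<close>

lemma centered_gaussian_l2_closure:
  assumes "W \<in> l2_closure" shows "centered_gaussian P W"
proof -
  have W[measurable]: "W \<in> borel_measurable P" using assms by (simp add: l2_closure_def)
  from l2_closure_sequence[OF assms] obtain v where
    "\<forall>n. v n \<in> V \<and> integrable P (\<lambda>\<omega>. (W \<omega> - v n \<omega>)\<^sup>2) \<and>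
      expectation (\<lambda>\<omega>. (W \<omega> - v n \<omega>)\<^sup>2) < inverse (real (Suc n))" .
  then have v: "v n \<in> V" "integrable P (\<lambda>\<omega>. (W \<omega> - v n \<omega>)\<^sup>2)"
    "expectation (\<lambda>\<omega>. (W \<omega> - v n \<omega>)\<^sup>2) < inverse (real (Suc n))" for n
    by blast+
  have [measurable]: "v n \<in> borel_measurable P" for n using measurable[OF v(1)] .
  have l2: "(\<lambda>n. expectation (\<lambda>\<omega>. (W \<omega> - v n \<omega>)\<^sup>2)) \<longlonglongrightarrow> 0"
    by (rule tendsto_sandwich[OF _ _ tendsto_const LIMSEQ_inverse_real_of_nat])
       (use v(3) in \<open>auto intro!: always_eventually less_imp_le\<close>)
  show ?thesis
  proof (rule centered_gaussian_of_char_limit[OF prob_space_axioms W])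
    fix u
    define d where "d n = (CLINT \<omega>|P. iexp (u * v n \<omega>)) - (CLINT \<omega>|P. iexp (u * W \<omega>))" for n
    have le: "cmod (d n) \<le> \<bar>u\<bar> * sqrt (expectation (\<lambda>\<omega>. (W \<omega> - v n \<omega>)\<^sup>2))" for n
    proof -
      have ii: "integrable P (\<lambda>\<omega>. \<bar>W \<omega> - v n \<omega>\<bar>)"
        using integrable_mult_of_squares[of "\<lambda>\<omega>. W \<omega> - v n \<omega>" P "\<lambda>_. 1"] v(2) by simp
      have "d n = (CLINT \<omega>|P. iexp (u * v n \<omega>) - iexp (u * W \<omega>))"
        unfolding d_def
        by (rule Bochner_Integration.integral_diff[symmetric]) (auto intro!: integrable_const_bound[where B=1])
      also have "cmod \<dots> \<le> expectation (\<lambda>\<omega>. \<bar>u\<bar> * \<bar>W \<omega> - v n \<omega>\<bar>)"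
      proof (rule order_trans[OF integral_norm_bound], rule integral_mono)
        show "integrable P (\<lambda>\<omega>. cmod (iexp (u * v n \<omega>) - iexp (u * W \<omega>)))"
          by (intro integrable_norm Bochner_Integration.integrable_diff) (auto intro!: integrable_const_bound[where B=1])
        show "cmod (iexp (u * v n \<omega>) - iexp (u * W \<omega>)) \<le> \<bar>u\<bar> * \<bar>W \<omega> - v n \<omega>\<bar>" for \<omega>
          using cmod_iexp_diff_le[of "u * v n \<omega>" "u * W \<omega>"]
          by (metis abs_minus_commute abs_mult right_diff_distrib)
      qed (use ii in simp)
      also have "\<dots> = \<bar>u\<bar> * \<bar>expectation (\<lambda>\<omega>. \<bar>W \<omega> - v n \<omega>\<bar> * 1)\<bar>" by simp
      also have "\<dots> \<le> \<bar>u\<bar> * (sqrt (expectation (\<lambda>\<omega>. \<bar>W \<omega> - v n \<omega>\<bar>\<^sup>2)) * sqrt (expectation (\<lambda>\<omega>. 1\<^sup>2)))"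
        by (intro mult_left_mono integral_cauchy_schwarz) (use v(2) in auto)
      finally show ?thesis by (simp add: prob_space)
    qed
    have "d \<longlonglongrightarrow> 0"
    proof (rule Lim_null_comparison)
      show "eventually (\<lambda>n. cmod (d n) \<le> \<bar>u\<bar> * sqrt (expectation (\<lambda>\<omega>. (W \<omega> - v n \<omega>)\<^sup>2))) sequentially"
        using le by simp
      have "(\<lambda>n. \<bar>u\<bar> * sqrt (expectation (\<lambda>\<omega>. (W \<omega> - v n \<omega>)\<^sup>2))) \<longlonglongrightarrow> \<bar>u\<bar> * sqrt 0"
        by (intro tendsto_intros l2)
      then show "(\<lambda>n. \<bar>u\<bar> * sqrt (expectation (\<lambda>\<omega>. (W \<omega> - v n \<omega>)\<^sup>2))) \<longlonglongrightarrow> 0" by simp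
    qed
    then show "(\<lambda>n. of_real (exp (- (u\<^sup>2 * expectation (\<lambda>\<omega>. (v n \<omega>)\<^sup>2)) / 2))) \<longlonglongrightarrow> (CLINT \<omega>|P. iexp (u * W \<omega>))"
      unfolding char_eq[OF v(1), symmetric] d_def by (simp only: LIM_zero_iff)
  qed simp
qed

lemma l2_closure_add:
  assumes W: "W \<in> l2_closure" "W' \<in> l2_closure"
  shows "(\<lambda>\<omega>. W \<omega> + W' \<omega>) \<in> l2_closure"
proof -
  have [measurable]: "W \<in> borel_measurable P" "W' \<in> borel_measurable P"
    using W by (auto simp: l2_closure_def)
  show ?thesis unfolding l2_closure_def
  proof (intro CollectI conjI allI impI)
    fix \<epsilon> :: real assume "\<epsilon> > 0"
    \<comment> \<open>The quarter absorbs the factor 2 in front of each of the two terms in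
      \<open>square_integrable_add\<close>.\<close>
    then have e: "\<epsilon> / 4 > 0" by simp
    from l2_closureE[OF W(1) e] obtain v where v: "v \<in> V"
      "integrable P (\<lambda>\<omega>. (W \<omega> - v \<omega>)\<^sup>2)" "expectation (\<lambda>\<omega>. (W \<omega> - v \<omega>)\<^sup>2) < \<epsilon> / 4" .
    from l2_closureE[OF W(2) e] obtain v' where v': "v' \<in> V"
      "integrable P (\<lambda>\<omega>. (W' \<omega> - v' \<omega>)\<^sup>2)" "expectation (\<lambda>\<omega>. (W' \<omega> - v' \<omega>)\<^sup>2) < \<epsilon> / 4" .
    have [measurable]: "v \<in> borel_measurable P" "v' \<in> borel_measurable P"
      using v(1) v'(1) by (auto intro: measurable)
    have eq: "W \<omega> + W' \<omega> - (v \<omega> + v' \<omega>) = (W \<omega> - v \<omega>) + (W' \<omega> - v' \<omega>)" for \<omega> by simp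
    show "\<exists>u\<in>V. integrable P (\<lambda>\<omega>. (W \<omega> + W' \<omega> - u \<omega>)\<^sup>2) \<and> expectation (\<lambda>\<omega>. (W \<omega> + W' \<omega> - u \<omega>)\<^sup>2) < \<epsilon>"
    proof (rule bexI[OF _ add[OF v(1) v'(1)]], unfold eq, intro conjI)
      show "integrable P (\<lambda>\<omega>. (W \<omega> - v \<omega> + (W' \<omega> - v' \<omega>))\<^sup>2)"
        by (rule square_integrable_add) (use v v' in auto)
      have "expectation (\<lambda>\<omega>. (W \<omega> - v \<omega> + (W' \<omega> - v' \<omega>))\<^sup>2)
        \<le> 2 * expectation (\<lambda>\<omega>. (W \<omega> - v \<omega>)\<^sup>2) + 2 * expectation (\<lambda>\<omega>. (W' \<omega> - v' \<omega>)\<^sup>2)"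
        by (rule square_integrable_add) (use v v' in auto)
      then show "expectation (\<lambda>\<omega>. (W \<omega> - v \<omega> + (W' \<omega> - v' \<omega>))\<^sup>2) < \<epsilon>" using v(3) v'(3) by simp
    qed
  qed simp
qed

lemma l2_closure_scale:
  assumes W: "W \<in> l2_closure"
  shows "(\<lambda>\<omega>. c * W \<omega>) \<in> l2_closure"
proof -
  have [measurable]: "W \<in> borel_measurable P" using W by (auto simp: l2_closure_def)
  show ?thesis unfolding l2_closure_def
  proof (intro CollectI conjI allI impI)
    fix \<epsilon> :: real assume \<epsilon>: "\<epsilon> > 0"
    \<comment> \<open>The summand 1 keeps the divisor positive when \<open>c = 0\<close>.\<close>
    have c: "0 < c\<^sup>2 + 1" by (simp add: add_nonneg_pos)
    from l2_closureE[OF W divide_pos_pos[OF \<epsilon> c]] obtain v where v: "v \<in> V"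
      "integrable P (\<lambda>\<omega>. (W \<omega> - v \<omega>)\<^sup>2)" "expectation (\<lambda>\<omega>. (W \<omega> - v \<omega>)\<^sup>2) < \<epsilon> / (c\<^sup>2 + 1)" .
    have eq: "(c * W \<omega> - c * v \<omega>)\<^sup>2 = c\<^sup>2 * (W \<omega> - v \<omega>)\<^sup>2" for \<omega>
      by (simp flip: right_diff_distrib add: power_mult_distrib)
    have "c\<^sup>2 * expectation (\<lambda>\<omega>. (W \<omega> - v \<omega>)\<^sup>2) \<le> (c\<^sup>2 + 1) * expectation (\<lambda>\<omega>. (W \<omega> - v \<omega>)\<^sup>2)"
      by (intro mult_right_mono) auto
    also have "\<dots> < \<epsilon>" using v(3) c by (simp add: field_simps)
    finally show "\<exists>u\<in>V. integrable P (\<lambda>\<omega>. (c * W \<omega> - u \<omega>)\<^sup>2) \<and> expectation (\<lambda>\<omega>. (c * W \<omega> - u \<omega>)\<^sup>2) < \<epsilon>"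
      by (intro bexI[OF _ scale[OF v(1), of c]]) (use v(2) in \<open>simp add: eq\<close>)
  qed simp
qed

text \<open>Through this interpretation everything shown for \<open>V\<close> becomes available for
  the closure, where the derivatives of the field live.\<close>

lemma gaussian_space_l2_closure: "gaussian_space P l2_closure"
  using prob_space_axioms subset_l2_closure zero
  by (auto simp: gaussian_space_def gaussian_space_axioms_def
      intro: centered_gaussian_l2_closure l2_closure_add l2_closure_scale)

text \<open>For fixed \<open>n\<close>, \<open>W n - Y\<close> is the pointwise limit of
  \<open>W n - W m\<close> as m grows, so it is itself Gaussian. Its pointwise convergence to 0 then
  forces its variance to 0.\<close>

lemma
  assumes W: "\<And>n. W n \<in> l2_closure"
    and lim: "\<And>\<omega>. \<omega> \<in> space P \<Longrightarrow> (\<lambda>n. W n \<omega>) \<longlonglongrightarrow> Y \<omega>"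
  shows l2_closure_limit: "Y \<in> l2_closure"
    and l2_closure_limit_variance: "(\<lambda>n. expectation (\<lambda>\<omega>. (W n \<omega> - Y \<omega>)\<^sup>2)) \<longlonglongrightarrow> 0"
proof -
  interpret L: gaussian_space P l2_closure by (rule gaussian_space_l2_closure)
  have [measurable]: "W n \<in> borel_measurable P" for n by (rule L.measurable[OF W])
  have Y: "centered_gaussian P Y"
    by (rule centered_gaussian_limit[OF prob_space_axioms _ lim]) (rule L.gaussian[OF W])
  note [measurable] = centered_gaussian_measurable[OF Y]
  have g: "centered_gaussian P (\<lambda>\<omega>. W n \<omega> - Y \<omega>)" for n
    by (rule centered_gaussian_limit[OF prob_space_axioms, where W="\<lambda>m \<omega>. W n \<omega> - W m \<omega>"])
       (auto intro!: L.gaussian L.diff W tendsto_intros lim)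
  show l: "(\<lambda>n. expectation (\<lambda>\<omega>. (W n \<omega> - Y \<omega>)\<^sup>2)) \<longlonglongrightarrow> 0"
  proof (rule centered_gaussian_tendsto_0_variance[OF prob_space_axioms g])
    show "(\<lambda>n. W n \<omega> - Y \<omega>) \<longlonglongrightarrow> 0" if "\<omega> \<in> space P" for \<omega>
      using lim[OF that] by (simp add: LIM_zero)
  qed
  show "Y \<in> l2_closure" unfolding l2_closure_def
  proof (intro CollectI conjI allI impI)
    fix \<epsilon> :: real assume "\<epsilon> > 0"
    then have e: "\<epsilon> / 4 > 0" by simp
    from order_tendstoD(2)[OF l e] obtain n where n: "expectation (\<lambda>\<omega>. (W n \<omega> - Y \<omega>)\<^sup>2) < \<epsilon> / 4"
      by (auto simp: eventually_sequentially)
    from l2_closureE[OF W[of n] e] obtain v where v: "v \<in> V"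
      "integrable P (\<lambda>\<omega>. (W n \<omega> - v \<omega>)\<^sup>2)" "expectation (\<lambda>\<omega>. (W n \<omega> - v \<omega>)\<^sup>2) < \<epsilon> / 4" .
    have [measurable]: "v \<in> borel_measurable P" using v(1) by (rule measurable)
    have i: "integrable P (\<lambda>\<omega>. (- (W n \<omega> - Y \<omega>))\<^sup>2)"
      unfolding power2_minus by (rule centered_gaussian_integrable_square[OF prob_space_axioms g])
    have eq: "Y \<omega> - v \<omega> = - (W n \<omega> - Y \<omega>) + (W n \<omega> - v \<omega>)" for \<omega> by simp
    show "\<exists>u\<in>V. integrable P (\<lambda>\<omega>. (Y \<omega> - u \<omega>)\<^sup>2) \<and> expectation (\<lambda>\<omega>. (Y \<omega> - u \<omega>)\<^sup>2) < \<epsilon>"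
    proof (rule bexI[OF _ v(1)], unfold eq, intro conjI)
      show "integrable P (\<lambda>\<omega>. (- (W n \<omega> - Y \<omega>) + (W n \<omega> - v \<omega>))\<^sup>2)"
        by (rule square_integrable_add) (use v i in auto)
      have "expectation (\<lambda>\<omega>. (- (W n \<omega> - Y \<omega>) + (W n \<omega> - v \<omega>))\<^sup>2)
        \<le> 2 * expectation (\<lambda>\<omega>. (- (W n \<omega> - Y \<omega>))\<^sup>2) + 2 * expectation (\<lambda>\<omega>. (W n \<omega> - v \<omega>)\<^sup>2)"
        by (rule square_integrable_add) (use v i in auto)
      then show "expectation (\<lambda>\<omega>. (- (W n \<omega> - Y \<omega>) + (W n \<omega> - v \<omega>))\<^sup>2) < \<epsilon>"
        using v(3) n unfolding power2_minus by simp
    qed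
  qed simp
qed

text \<open>Cauchy-Schwarz turns the L2 convergence into convergence of the pairing with
  \<open>G\<close>. This exchanges the expectation with the limits that define derivatives and
  continuity.\<close>

lemma l2_closure_limit_integral:
  assumes W: "\<And>n. W n \<in> l2_closure"
    and lim: "\<And>\<omega>. \<omega> \<in> space P \<Longrightarrow> (\<lambda>n. W n \<omega>) \<longlonglongrightarrow> Y \<omega>"
    and G[measurable]: "G \<in> borel_measurable P" and G2: "integrable P (\<lambda>\<omega>. (G \<omega>)\<^sup>2)"
  shows "(\<lambda>n. expectation (\<lambda>\<omega>. W n \<omega> * G \<omega>)) \<longlonglongrightarrow> expectation (\<lambda>\<omega>. Y \<omega> * G \<omega>)"
proof -
  interpret L: gaussian_space P l2_closure by (rule gaussian_space_l2_closure)
  have Y: "Y \<in> l2_closure" using l2_closure_limit[OF W lim] .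
  have [measurable]: "W n \<in> borel_measurable P" "Y \<in> borel_measurable P" for n
    by (rule L.measurable[OF W], rule L.measurable[OF Y])
  have d: "expectation (\<lambda>\<omega>. W n \<omega> * G \<omega>) - expectation (\<lambda>\<omega>. Y \<omega> * G \<omega>)
    = expectation (\<lambda>\<omega>. (W n \<omega> - Y \<omega>) * G \<omega>)" for n
    unfolding left_diff_distrib
    by (rule Bochner_Integration.integral_diff[symmetric])
       (auto intro!: integrable_mult_of_squares G2 L.integrable_square W Y)
  let ?b = "\<lambda>n. sqrt (expectation (\<lambda>\<omega>. (W n \<omega> - Y \<omega>)\<^sup>2)) * sqrt (expectation (\<lambda>\<omega>. (G \<omega>)\<^sup>2))"
  have "?b \<longlonglongrightarrow> sqrt 0 * sqrt (expectation (\<lambda>\<omega>. (G \<omega>)\<^sup>2))"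
    by (intro tendsto_mult tendsto_real_sqrt tendsto_const l2_closure_limit_variance[OF W lim])
  then have b: "?b \<longlonglongrightarrow> 0" by simp
  have "\<bar>expectation (\<lambda>\<omega>. (W n \<omega> - Y \<omega>) * G \<omega>)\<bar> \<le> ?b n" for n
    by (intro integral_cauchy_schwarz G2 L.integrable_square[OF L.diff[OF W Y]]) simp_all
  then have "(\<lambda>n. expectation (\<lambda>\<omega>. W n \<omega> * G \<omega>) - expectation (\<lambda>\<omega>. Y \<omega> * G \<omega>)) \<longlonglongrightarrow> 0"
    unfolding d by (intro Lim_null_comparison[OF _ b] always_eventually) simp
  then show ?thesis by (simp add: LIM_zero_iff)
qed

text \<open>An almost minimizer \<open>Y\<close> of the distance from \<open>G\<close> to \<open>V\<close> is almost the orthogonal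
  projection of \<open>G\<close>.\<close>

lemma approximate_projection:
  assumes G[measurable]: "G \<in> borel_measurable P" and G2: "integrable P (\<lambda>\<omega>. (G \<omega>)\<^sup>2)"
    and \<delta>: "\<delta> > 0"
  obtains Y where "Y \<in> V"
    "\<And>Z. Z \<in> l2_closure \<Longrightarrow>
      \<bar>expectation (\<lambda>\<omega>. Z \<omega> * G \<omega>) - expectation (\<lambda>\<omega>. Z \<omega> * Y \<omega>)\<bar> \<le> \<delta> * sqrt (expectation (\<lambda>\<omega>. (Z \<omega>)\<^sup>2))"
proof -
  interpret L: gaussian_space P l2_closure by (rule gaussian_space_l2_closure)
  define D where "D v = expectation (\<lambda>\<omega>. (G \<omega> - v \<omega>)\<^sup>2)" for v
  define m where "m = Inf (D ` V)"
  have bdd: "bdd_below (D ` V)" by (rule bdd_belowI[of _ 0]) (auto simp: D_def)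
  have "\<exists>x\<in>D ` V. x < m + \<delta>\<^sup>2"
    unfolding m_def by (rule cInf_lessD) (use zero \<delta> in auto)
  then obtain Y where Y: "Y \<in> V" "D Y < m + \<delta>\<^sup>2" by blast
  note [measurable] = measurable[OF Y(1)]
  have GY: "integrable P (\<lambda>\<omega>. (G \<omega> - Y \<omega>)\<^sup>2)"
    using square_integrable_add(1)[of G P "\<lambda>\<omega>. - Y \<omega>"] G2 integrable_square[OF Y(1)] by simp
  have V: "\<bar>expectation (\<lambda>\<omega>. (G \<omega> - Y \<omega>) * Z \<omega>)\<bar> \<le> \<delta> * sqrt (expectation (\<lambda>\<omega>. (Z \<omega>)\<^sup>2))" if Z: "Z \<in> V" for Z
  proof -
    note [measurable] = measurable[OF Z]
    define b c where "b = expectation (\<lambda>\<omega>. (Z \<omega>)\<^sup>2)" and "c = expectation (\<lambda>\<omega>. (G \<omega> - Y \<omega>) * Z \<omega>)"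
    have i: "integrable P (\<lambda>\<omega>. (G \<omega> - Y \<omega>) * Z \<omega>)"
      by (rule integrable_mult_of_squares) (use GY integrable_square[OF Z] in auto)
    \<comment> \<open>Passing from \<open>Y\<close> to \<open>Y + s Z\<close> can lower the squared
      distance by less than \<open>\<delta>\<^sup>2\<close> only, as \<open>Y\<close> is that close
      to the infimum. The sharpest choice is \<open>s = c / b\<close>.\<close>
    have q: "2 * s * c - s\<^sup>2 * b < \<delta>\<^sup>2" for s
    proof -
      have "m \<le> D (\<lambda>\<omega>. Y \<omega> + s * Z \<omega>)"
        unfolding m_def by (rule cInf_lower[OF _ bdd]) (intro imageI add Y scale Z)
      also have "\<dots> = expectation (\<lambda>\<omega>. (G \<omega> - Y \<omega>)\<^sup>2 - 2 * s * ((G \<omega> - Y \<omega>) * Z \<omega>) + s\<^sup>2 * (Z \<omega>)\<^sup>2)"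
        unfolding D_def by (intro Bochner_Integration.integral_cong refl) (simp add: power2_eq_square algebra_simps)
      also have "\<dots> = D Y - 2 * s * c + s\<^sup>2 * b"
        using GY i integrable_square[OF Z] by (simp add: D_def c_def b_def)
      finally show ?thesis using Y(2) by simp
    qed
    have b0: "0 \<le> b" by (simp add: b_def)
    have "c\<^sup>2 \<le> \<delta>\<^sup>2 * b"
    proof (cases "b = 0")
      case True
      have "c = 0"
      proof (rule ccontr)
        assume "c \<noteq> 0"
        \<comment> \<open>For \<open>b = 0\<close> this choice turns the bound into
          \<open>\<delta>\<^sup>2 < \<delta>\<^sup>2\<close>.\<close>
        then show False using q[of "\<delta>\<^sup>2 / (2 * c)"] True by simp
      qed
      with True show ?thesis by simp
    next
      case False
      have "2 * (c / b) * c - (c / b)\<^sup>2 * b = c\<^sup>2 / b" using False by (simp add: power2_eq_square)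
      then have "c\<^sup>2 / b < \<delta>\<^sup>2" using q[of "c / b"] by linarith
      then show ?thesis using False b0 by (simp add: pos_divide_less_eq less_imp_le)
    qed
    then have "\<bar>c\<bar> \<le> sqrt (\<delta>\<^sup>2 * b)" using real_le_rsqrt by auto
    then show ?thesis using \<delta> by (simp add: c_def b_def real_sqrt_mult)
  qed
  show ?thesis
  proof (rule that[OF Y(1)])
    fix Z assume Z: "Z \<in> l2_closure"
    note [measurable] = L.measurable[OF Z]
    from l2_closure_sequence[OF Z] obtain v where
      "\<forall>n. v n \<in> V \<and> integrable P (\<lambda>\<omega>. (Z \<omega> - v n \<omega>)\<^sup>2) \<and>
        expectation (\<lambda>\<omega>. (Z \<omega> - v n \<omega>)\<^sup>2) < inverse (real (Suc n))" .
    then have v: "v n \<in> V" "integrable P (\<lambda>\<omega>. (Z \<omega> - v n \<omega>)\<^sup>2)"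
      "expectation (\<lambda>\<omega>. (Z \<omega> - v n \<omega>)\<^sup>2) < inverse (real (Suc n))" for n
      by blast+
    define B where "B = sqrt (expectation (\<lambda>\<omega>. (G \<omega> - Y \<omega>)\<^sup>2))"
    define \<eta> where "\<eta> n = sqrt (inverse (real (Suc n)))" for n
    have [measurable]: "v n \<in> borel_measurable P" for n using measurable[OF v(1)] .
    have "\<eta> \<longlonglongrightarrow> sqrt 0" unfolding \<eta>_def by (intro tendsto_real_sqrt LIMSEQ_inverse_real_of_nat)
    then have \<eta>: "\<eta> \<longlonglongrightarrow> 0" by simp
    \<comment> \<open>Minkowski's inequality for \<open>v n = Z - (Z - v n)\<close>. The estimate on
      \<open>V\<close> is linear in the norm, so it extends to the closure once
      \<open>\<eta> n\<close> tends to 0.\<close>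
    have sv: "sqrt (expectation (\<lambda>\<omega>. (v n \<omega>)\<^sup>2)) \<le> sqrt (expectation (\<lambda>\<omega>. (Z \<omega>)\<^sup>2)) + \<eta> n" for n
    proof -
      define a b where "a = expectation (\<lambda>\<omega>. (Z \<omega>)\<^sup>2)" and "b = expectation (\<lambda>\<omega>. (Z \<omega> - v n \<omega>)\<^sup>2)"
      define c where "c = expectation (\<lambda>\<omega>. Z \<omega> * (Z \<omega> - v n \<omega>))"
      have c: "\<bar>c\<bar> \<le> sqrt a * sqrt b" unfolding a_def b_def c_def
        by (rule integral_cauchy_schwarz) (use v(2) L.integrable_square[OF Z] in auto)
      have i: "integrable P (\<lambda>\<omega>. Z \<omega> * (Z \<omega> - v n \<omega>))"
        by (rule integrable_mult_of_squares) (use v(2) L.integrable_square[OF Z] in auto)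
      have "expectation (\<lambda>\<omega>. (v n \<omega>)\<^sup>2) = expectation (\<lambda>\<omega>. (Z \<omega>)\<^sup>2 - 2 * (Z \<omega> * (Z \<omega> - v n \<omega>)) + (Z \<omega> - v n \<omega>)\<^sup>2)"
        by (intro Bochner_Integration.integral_cong refl) (simp add: power2_eq_square algebra_simps)
      also have "\<dots> = a - 2 * c + b"
        using i v(2) L.integrable_square[OF Z] by (simp add: a_def b_def c_def)
      also have "\<dots> \<le> (sqrt a + sqrt b)\<^sup>2"
        using c by (simp add: power2_sum a_def b_def)
      finally have "sqrt (expectation (\<lambda>\<omega>. (v n \<omega>)\<^sup>2)) \<le> sqrt a + sqrt b"
        by (rule real_le_lsqrt[rotated]) (simp add: a_def b_def)
      moreover have "sqrt b \<le> \<eta> n" using v(3)[of n] by (simp add: b_def \<eta>_def)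
      ultimately show ?thesis by (simp add: a_def)
    qed
    have "\<bar>expectation (\<lambda>\<omega>. (G \<omega> - Y \<omega>) * Z \<omega>)\<bar> \<le> B * \<eta> n + \<delta> * (sqrt (expectation (\<lambda>\<omega>. (Z \<omega>)\<^sup>2)) + \<eta> n)" for n
    proof -
      have "expectation (\<lambda>\<omega>. (G \<omega> - Y \<omega>) * Z \<omega>) =
          expectation (\<lambda>\<omega>. (G \<omega> - Y \<omega>) * (Z \<omega> - v n \<omega>) + (G \<omega> - Y \<omega>) * v n \<omega>)"
        by (simp add: algebra_simps)
      also have "\<dots> = expectation (\<lambda>\<omega>. (G \<omega> - Y \<omega>) * (Z \<omega> - v n \<omega>)) + expectation (\<lambda>\<omega>. (G \<omega> - Y \<omega>) * v n \<omega>)"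
        by (intro Bochner_Integration.integral_add integrable_mult_of_squares)
           (use GY v(2) integrable_square[OF v(1)] in auto)
      also have "\<bar>\<dots>\<bar> \<le> \<bar>expectation (\<lambda>\<omega>. (G \<omega> - Y \<omega>) * (Z \<omega> - v n \<omega>))\<bar> + \<bar>expectation (\<lambda>\<omega>. (G \<omega> - Y \<omega>) * v n \<omega>)\<bar>"
        by (rule abs_triangle_ineq)
      also have "\<dots> \<le> B * sqrt (expectation (\<lambda>\<omega>. (Z \<omega> - v n \<omega>)\<^sup>2)) + \<delta> * sqrt (expectation (\<lambda>\<omega>. (v n \<omega>)\<^sup>2))"
        unfolding B_def by (intro add_mono V v integral_cauchy_schwarz) (use GY v(2) in auto)
      also have "\<dots> \<le> B * \<eta> n + \<delta> * (sqrt (expectation (\<lambda>\<omega>. (Z \<omega>)\<^sup>2)) + \<eta> n)"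
        using v(3)[of n] \<delta> sv[of n] by (intro add_mono mult_left_mono) (auto simp: \<eta>_def B_def)
      finally show ?thesis .
    qed
    moreover have "(\<lambda>n. B * \<eta> n + \<delta> * (sqrt (expectation (\<lambda>\<omega>. (Z \<omega>)\<^sup>2)) + \<eta> n))
        \<longlonglongrightarrow> B * 0 + \<delta> * (sqrt (expectation (\<lambda>\<omega>. (Z \<omega>)\<^sup>2)) + 0)"
      by (intro tendsto_intros \<eta>)
    ultimately have "\<bar>expectation (\<lambda>\<omega>. (G \<omega> - Y \<omega>) * Z \<omega>)\<bar> \<le> B * 0 + \<delta> * (sqrt (expectation (\<lambda>\<omega>. (Z \<omega>)\<^sup>2)) + 0)"
      by (intro LIMSEQ_le_const[rotated]) auto
    moreover have "expectation (\<lambda>\<omega>. (G \<omega> - Y \<omega>) * Z \<omega>)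
        = expectation (\<lambda>\<omega>. Z \<omega> * G \<omega>) - expectation (\<lambda>\<omega>. Z \<omega> * Y \<omega>)"
      unfolding left_diff_distrib
      by (subst Bochner_Integration.integral_diff)
         (use G2 integrable_square[OF Y(1)] L.integrable_square[OF Z] in
           \<open>auto intro!: integrable_mult_of_squares simp: mult.commute\<close>)
    ultimately show "\<bar>expectation (\<lambda>\<omega>. Z \<omega> * G \<omega>) - expectation (\<lambda>\<omega>. Z \<omega> * Y \<omega>)\<bar>
        \<le> \<delta> * sqrt (expectation (\<lambda>\<omega>. (Z \<omega>)\<^sup>2))" by simp
  qed
qed

text \<open>The characteristic function at 1 determines the second moment through a logarithm, so
  the second moments converge along with it.\<close>

lemma l2_closure_limit_second_moment:
  assumes W: "\<And>n. W n \<in> l2_closure"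
    and lim: "\<And>\<omega>. \<omega> \<in> space P \<Longrightarrow> (\<lambda>n. W n \<omega>) \<longlonglongrightarrow> Y \<omega>"
  shows "(\<lambda>n. expectation (\<lambda>\<omega>. (W n \<omega>)\<^sup>2)) \<longlonglongrightarrow> expectation (\<lambda>\<omega>. (Y \<omega>)\<^sup>2)"
proof -
  interpret L: gaussian_space P l2_closure by (rule gaussian_space_l2_closure)
  have Y: "Y \<in> l2_closure" using l2_closure_limit[OF W lim] .
  have "(\<lambda>n. CLINT \<omega>|P. iexp (1 * W n \<omega>)) \<longlonglongrightarrow> (CLINT \<omega>|P. iexp (1 * Y \<omega>))"
    by (rule tendsto_char[OF prob_space_axioms L.measurable[OF W] L.measurable[OF Y] lim])
  from tendsto_Re[OF this]
  have "(\<lambda>n. exp (- expectation (\<lambda>\<omega>. (W n \<omega>)\<^sup>2) / 2)) \<longlonglongrightarrow> exp (- expectation (\<lambda>\<omega>. (Y \<omega>)\<^sup>2) / 2)"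
    unfolding L.char_eq[OF W] L.char_eq[OF Y] by simp
  then have "(\<lambda>n. ln (exp (- expectation (\<lambda>\<omega>. (W n \<omega>)\<^sup>2) / 2))) \<longlonglongrightarrow> ln (exp (- expectation (\<lambda>\<omega>. (Y \<omega>)\<^sup>2) / 2))"
    by (intro tendsto_ln) auto
  then have "(\<lambda>n. - 2 * (- expectation (\<lambda>\<omega>. (W n \<omega>)\<^sup>2) / 2)) \<longlonglongrightarrow> - 2 * (- expectation (\<lambda>\<omega>. (Y \<omega>)\<^sup>2) / 2)"
    by (intro tendsto_mult tendsto_const) simp
  then show ?thesis by simp
qed

text \<open>Path continuity makes the second moment sequentially continuous in \<open>x\<close>, by
  the preceding limit theorem; compactness gives the bound.\<close>

lemma compact_second_moment_bounded:
  fixes Z :: "'s::metric_space \<Rightarrow> 'w \<Rightarrow> real"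
  assumes K: "compact K" and Z: "\<And>x. x \<in> K \<Longrightarrow> Z x \<in> l2_closure"
    and cont: "\<And>\<omega>. \<omega> \<in> space P \<Longrightarrow> continuous_on K (\<lambda>x. Z x \<omega>)"
  shows "\<exists>C. \<forall>x\<in>K. sqrt (expectation (\<lambda>\<omega>. (Z x \<omega>)\<^sup>2)) \<le> C"
proof -
  have "continuous_on K (\<lambda>x. sqrt (expectation (\<lambda>\<omega>. (Z x \<omega>)\<^sup>2)))"
    unfolding continuous_on_sequentially o_def
  proof (intro allI ballI impI tendsto_real_sqrt; elim conjE)
    fix y x assume x: "x \<in> K" "\<forall>m. y m \<in> K" "y \<longlonglongrightarrow> x"
    show "(\<lambda>m. expectation (\<lambda>\<omega>. (Z (y m) \<omega>)\<^sup>2)) \<longlonglongrightarrow> expectation (\<lambda>\<omega>. (Z x \<omega>)\<^sup>2)"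
    proof (rule l2_closure_limit_second_moment)
      show "(\<lambda>m. Z (y m) \<omega>) \<longlonglongrightarrow> Z x \<omega>" if "\<omega> \<in> space P" for \<omega>
        using cont[OF that] x unfolding continuous_on_sequentially o_def by blast
    qed (use Z x in blast)
  qed
  from compact_imp_bounded[OF compact_continuous_image[OF this K]]
  show ?thesis unfolding bounded_iff by (auto intro: order_trans[OF abs_ge_self])
qed

end

section \<open>Uniqueness of finite-dimensional laws\<close>

text \<open>At \<open>u = 0\<close> the hypothesis says that both weights have the same total mass
  \<open>c\<close>. Divided by it they become probability densities, and Levy uniqueness applies to
  the images of the weighted measures. If the mass is 0, both weights vanish almost
  everywhere.\<close>

lemma weighted_char_uniqueness:
  fixes g :: "'a \<Rightarrow> real" and g' :: "'b \<Rightarrow> real"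
  assumes P: "prob_space P" and Q: "prob_space Q"
    and m[measurable]: "g \<in> borel_measurable P" "Z \<in> borel_measurable P"
      "g' \<in> borel_measurable Q" "Z' \<in> borel_measurable Q"
    and g: "\<And>\<omega>. 0 \<le> g \<omega>" "\<And>\<omega>. g \<omega> \<le> C" and g': "\<And>\<omega>. 0 \<le> g' \<omega>" "\<And>\<omega>. g' \<omega> \<le> C"
    and char: "\<And>u. (CLINT \<omega>|P. g \<omega> *\<^sub>R iexp (u * Z \<omega>)) = (CLINT \<omega>|Q. g' \<omega> *\<^sub>R iexp (u * Z' \<omega>))"
    and B[measurable]: "B \<in> sets borel"
  shows "(\<integral>\<omega>. g \<omega> * indicator B (Z \<omega>) \<partial>P) = (\<integral>\<omega>. g' \<omega> * indicator B (Z' \<omega>) \<partial>Q)"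
proof -
  interpret P: prob_space P by fact
  interpret Q: prob_space Q by fact
  have ig: "integrable P g" by (rule P.integrable_const_bound[where B=C]) (use g in auto)
  have ig': "integrable Q g'" by (rule Q.integrable_const_bound[where B=C]) (use g' in auto)
  define c where "c = (\<integral>\<omega>. g \<omega> \<partial>P)"
  have "(CLINT \<omega>|P. complex_of_real (g \<omega>)) = (CLINT \<omega>|Q. complex_of_real (g' \<omega>))"
    using char[of 0] by (simp add: scaleR_conv_of_real)
  then have c': "c = (\<integral>\<omega>. g' \<omega> \<partial>Q)" by (simp add: c_def)
  show ?thesis
  proof (cases "c = 0")
    case True
    have "AE \<omega> in P. g \<omega> = 0"
      using True ig g by (simp add: c_def integral_nonneg_eq_0_iff_AE)
    then have "(\<integral>\<omega>. g \<omega> * indicator B (Z \<omega>) \<partial>P) = (\<integral>\<omega>. 0 \<partial>P)"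
      by (intro integral_cong_AE) auto
    moreover have "AE \<omega> in Q. g' \<omega> = 0"
      using True[unfolded c'] ig' g' by (simp add: integral_nonneg_eq_0_iff_AE)
    then have "(\<integral>\<omega>. g' \<omega> * indicator B (Z' \<omega>) \<partial>Q) = (\<integral>\<omega>. 0 \<partial>Q)"
      by (intro integral_cong_AE) auto
    ultimately show ?thesis by simp
  next
    case False
    have "c \<ge> 0" unfolding c_def using g by (intro integral_nonneg_AE) auto
    with False have c: "c > 0" by simp
    define \<mu> where "\<mu> = distr (density P (\<lambda>\<omega>. g \<omega> / c)) borel Z"
    define \<nu> where "\<nu> = distr (density Q (\<lambda>\<omega>. g' \<omega> / c)) borel Z'"
    have "prob_space (density P (\<lambda>\<omega>. g \<omega> / c))"
    proof
      have "(\<integral>\<^sup>+\<omega>. ennreal (g \<omega> / c) \<partial>P) = ennreal (\<integral>\<omega>. g \<omega> / c \<partial>P)"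
        by (rule nn_integral_eq_integral) (use ig g c in auto)
      then show "emeasure (density P (\<lambda>\<omega>. g \<omega> / c)) (space (density P (\<lambda>\<omega>. g \<omega> / c))) = 1"
        using c by (simp add: emeasure_density c_def[symmetric] cong: nn_integral_cong)
    qed
    then have \<mu>: "real_distribution \<mu>" unfolding \<mu>_def
      by (rule prob_space.real_distribution_distr) simp
    have "prob_space (density Q (\<lambda>\<omega>. g' \<omega> / c))"
    proof
      have "(\<integral>\<^sup>+\<omega>. ennreal (g' \<omega> / c) \<partial>Q) = ennreal (\<integral>\<omega>. g' \<omega> / c \<partial>Q)"
        by (rule nn_integral_eq_integral) (use ig' g' c in auto)
      then show "emeasure (density Q (\<lambda>\<omega>. g' \<omega> / c)) (space (density Q (\<lambda>\<omega>. g' \<omega> / c))) = 1"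
        using c by (simp add: emeasure_density c'[symmetric] cong: nn_integral_cong)
    qed
    then have \<nu>: "real_distribution \<nu>" unfolding \<nu>_def
      by (rule prob_space.real_distribution_distr) simp
    have "char \<mu> = char \<nu>"
    proof
      fix u
      have "char \<mu> u = (CLINT \<omega>|P. (g \<omega> / c) *\<^sub>R iexp (u * Z \<omega>))"
        unfolding char_def \<mu>_def using g c
        by (subst integral_distr) (auto simp: integral_density)
      also have "\<dots> = (CLINT \<omega>|P. (1 / c) *\<^sub>R (g \<omega> *\<^sub>R iexp (u * Z \<omega>)))" by simp
      also have "\<dots> = (1 / c) *\<^sub>R (CLINT \<omega>|P. g \<omega> *\<^sub>R iexp (u * Z \<omega>))" by (rule integral_scaleR_right)
      also have "\<dots> = (CLINT \<omega>|Q. (1 / c) *\<^sub>R (g' \<omega> *\<^sub>R iexp (u * Z' \<omega>)))"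
        unfolding char by (rule integral_scaleR_right[symmetric])
      also have "\<dots> = (CLINT \<omega>|Q. (g' \<omega> / c) *\<^sub>R iexp (u * Z' \<omega>))" by simp
      also have "\<dots> = char \<nu> u"
        unfolding char_def \<nu>_def using g' c
        by (subst integral_distr) (auto simp: integral_density)
      finally show "char \<mu> u = char \<nu> u" .
    qed
    then have eq: "\<mu> = \<nu>" by (rule Levy_uniqueness[OF \<mu> \<nu>])
    have "(\<integral>z. indicator B z \<partial>\<mu>) = (\<integral>\<omega>. g \<omega> / c * indicator B (Z \<omega>) \<partial>P)"
      unfolding \<mu>_def using g c by (subst integral_distr) (auto simp: integral_density)
    also have "\<dots> = (\<integral>\<omega>. g \<omega> * indicator B (Z \<omega>) \<partial>P) / c" by simp
    finally have 1: "(\<integral>z. indicator B z \<partial>\<mu>) = (\<integral>\<omega>. g \<omega> * indicator B (Z \<omega>) \<partial>P) / c" .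
    have "(\<integral>z. indicator B z \<partial>\<nu>) = (\<integral>\<omega>. g' \<omega> / c * indicator B (Z' \<omega>) \<partial>Q)"
      unfolding \<nu>_def using g' c by (subst integral_distr) (auto simp: integral_density)
    also have "\<dots> = (\<integral>\<omega>. g' \<omega> * indicator B (Z' \<omega>) \<partial>Q) / c" by simp
    finally show ?thesis using 1 c by (simp add: eq)
  qed
qed

lemma integrable_scaleR_iexp:
  assumes "finite_measure P" "g \<in> borel_measurable P" "W \<in> borel_measurable P"
    "\<And>\<omega>. 0 \<le> g \<omega>" "\<And>\<omega>. g \<omega> \<le> (C::real)"
  shows "integrable P (\<lambda>\<omega>. g \<omega> *\<^sub>R iexp (W \<omega>))"
proof -
  interpret finite_measure P by fact
  note assms(2,3)[measurable]
  show ?thesis by (rule integrable_const_bound[where B=C]) (use assms in auto)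
qed

lemma integral_add_mult:
  fixes f g h :: "'a \<Rightarrow> complex"
  assumes "integrable M f" "integrable M g" "integrable M h"
  shows "(\<integral>x. f x + a * g x + b * h x \<partial>M) = (\<integral>x. f x \<partial>M) + a * (\<integral>x. g x \<partial>M) + b * (\<integral>x. h x \<partial>M)"
  using assms by simp

lemma integral_Re_Im:
  fixes f g :: "'a \<Rightarrow> real"
  assumes "integrable M f" "integrable M g"
  shows "(CLINT x|M. of_real (f x) + \<i> * of_real (g x)) = of_real (\<integral>x. f x \<partial>M) + \<i> * of_real (\<integral>x. g x \<partial>M)"
  using assms by simp

text \<open>This is the Cramer-Wold device in the form of a linear relation: scaling recovers all
  arguments of the characteristic functions from the argument 1, and sums recover the joint laws. In
  the applications \<open>R\<close> is the graph of a linear map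
  \<open>W \<mapsto> T W\<close>.\<close>

locale equal_char =
  P: prob_space P + Q: prob_space Q
  for P :: "'a measure" and Q :: "'b measure" +
  fixes R :: "(('a \<Rightarrow> real) \<times> ('b \<Rightarrow> real)) set"
  assumes measurable: "(W, W') \<in> R \<Longrightarrow> W \<in> borel_measurable P" "(W, W') \<in> R \<Longrightarrow> W' \<in> borel_measurable Q"
    and zero: "((\<lambda>_. 0), (\<lambda>_. 0)) \<in> R"
    and add: "(W, W') \<in> R \<Longrightarrow> (Z, Z') \<in> R \<Longrightarrow> ((\<lambda>\<omega>. W \<omega> + Z \<omega>), (\<lambda>\<omega>. W' \<omega> + Z' \<omega>)) \<in> R"
    and scale: "(W, W') \<in> R \<Longrightarrow> ((\<lambda>\<omega>. c * W \<omega>), (\<lambda>\<omega>. c * W' \<omega>)) \<in> R"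
    and char_eq: "(W, W') \<in> R \<Longrightarrow> (CLINT \<omega>|P. iexp (W \<omega>)) = (CLINT \<omega>|Q. iexp (W' \<omega>))"
begin

text \<open>One coordinate at a time, one-dimensional uniqueness is applied to the nonnegative weights
  \<open>g (1 + cos (W + \<theta>))\<close>, whose transforms are combinations of those in the hypothesis.\<close>

lemma uniqueness_step:
  assumes WW: "(W, W') \<in> R" and ZZ: "(Z, Z') \<in> R"
    and g[measurable]: "g \<in> borel_measurable P" "g' \<in> borel_measurable Q"
    and g0: "\<And>\<omega>. 0 \<le> g \<omega>" "\<And>\<omega>. g \<omega> \<le> 1" "\<And>\<omega>. 0 \<le> g' \<omega>" "\<And>\<omega>. g' \<omega> \<le> (1::real)"
    and char: "\<And>W W'. (W, W') \<in> R \<Longrightarrow> (CLINT \<omega>|P. g \<omega> *\<^sub>R iexp (W \<omega>)) = (CLINT \<omega>|Q. g' \<omega> *\<^sub>R iexp (W' \<omega>))"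
    and B[measurable]: "B \<in> sets borel"
  shows "(CLINT \<omega>|P. (indicator B (Z \<omega>) * g \<omega>) *\<^sub>R iexp (W \<omega>))
       = (CLINT \<omega>|Q. (indicator B (Z' \<omega>) * g' \<omega>) *\<^sub>R iexp (W' \<omega>))"
proof -
  note [measurable] = measurable[OF WW] measurable[OF ZZ]
  have fin: "finite_measure P" "finite_measure Q" by unfold_locales
  have i1: "integrable P (\<lambda>\<omega>. g \<omega> *\<^sub>R iexp (U \<omega>))" if "U \<in> borel_measurable P" for U
    by (rule integrable_scaleR_iexp[OF fin(1) g(1) that g0(1,2)])
  have i2: "integrable Q (\<lambda>\<omega>. g' \<omega> *\<^sub>R iexp (U \<omega>))" if "U \<in> borel_measurable Q" for U
    by (rule integrable_scaleR_iexp[OF fin(2) g(2) that g0(3,4)])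
  \<comment> \<open>Euler's formula for the cosine. Each of the three exponents is a linear
    combination of \<open>Z\<close> and \<open>W\<close>, hence belongs to a pair in
    \<open>R\<close>.\<close>
  have expand: "(k * (1 + cos (w + \<theta>))) *\<^sub>R iexp (u * z) =
      k *\<^sub>R iexp (u * z) + (iexp \<theta> / 2) * (k *\<^sub>R iexp (u * z + w)) + (iexp (- \<theta>) / 2) * (k *\<^sub>R iexp (u * z + (-1) * w))"
    for k w \<theta> u z :: real
  proof -
    have 1: "iexp (u * z + w) = iexp (u * z) * iexp w" by (simp add: distrib_left exp_add)
    have 2: "iexp (u * z + (-1) * w) = iexp (u * z) * iexp (- w)" by (simp add: exp_add flip: exp_add) (simp add: algebra_simps)
    have 3: "complex_of_real (cos (w + \<theta>)) = (iexp w * iexp \<theta> + iexp (- w) * iexp (- \<theta>)) / 2"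
      by (simp add: cos_of_real[symmetric] cos_exp_eq algebra_simps flip: exp_add)
    show ?thesis
      unfolding scaleR_conv_of_real of_real_mult of_real_add[of 1] 1 2 3
      by (simp add: algebra_simps)
  qed
  have w: "(\<integral>\<omega>. (g \<omega> * (1 + cos (W \<omega> + \<theta>))) * indicator B (Z \<omega>) \<partial>P)
      = (\<integral>\<omega>. (g' \<omega> * (1 + cos (W' \<omega> + \<theta>))) * indicator B (Z' \<omega>) \<partial>Q)" for \<theta>
  proof (rule weighted_char_uniqueness[OF P.prob_space_axioms Q.prob_space_axioms, where C=2])
    fix u
    have R1: "((\<lambda>\<omega>. u * Z \<omega>), (\<lambda>\<omega>. u * Z' \<omega>)) \<in> R" by (intro scale ZZ)
    have R2: "((\<lambda>\<omega>. u * Z \<omega> + W \<omega>), (\<lambda>\<omega>. u * Z' \<omega> + W' \<omega>)) \<in> R" by (intro add R1 WW)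
    have R3: "((\<lambda>\<omega>. u * Z \<omega> + (-1) * W \<omega>), (\<lambda>\<omega>. u * Z' \<omega> + (-1) * W' \<omega>)) \<in> R" by (intro add R1 scale WW)
    have "(CLINT \<omega>|P. (g \<omega> * (1 + cos (W \<omega> + \<theta>))) *\<^sub>R iexp (u * Z \<omega>)) =
       (CLINT \<omega>|P. g \<omega> *\<^sub>R iexp (u * Z \<omega>)) + (iexp \<theta> / 2) * (CLINT \<omega>|P. g \<omega> *\<^sub>R iexp (u * Z \<omega> + W \<omega>))
       + (iexp (- \<theta>) / 2) * (CLINT \<omega>|P. g \<omega> *\<^sub>R iexp (u * Z \<omega> + (-1) * W \<omega>))"
      unfolding expand by (intro integral_add_mult i1 measurable(1)[OF R1] measurable(1)[OF R2] measurable(1)[OF R3])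
    also have "\<dots> = (CLINT \<omega>|Q. g' \<omega> *\<^sub>R iexp (u * Z' \<omega>)) + (iexp \<theta> / 2) * (CLINT \<omega>|Q. g' \<omega> *\<^sub>R iexp (u * Z' \<omega> + W' \<omega>))
       + (iexp (- \<theta>) / 2) * (CLINT \<omega>|Q. g' \<omega> *\<^sub>R iexp (u * Z' \<omega> + (-1) * W' \<omega>))"
      by (simp only: char[OF R1] char[OF R2] char[OF R3])
    also have "\<dots> = (CLINT \<omega>|Q. (g' \<omega> * (1 + cos (W' \<omega> + \<theta>))) *\<^sub>R iexp (u * Z' \<omega>))"
      unfolding expand by (intro integral_add_mult[symmetric] i2 measurable(2)[OF R1] measurable(2)[OF R2] measurable(2)[OF R3])
    finally show "(CLINT \<omega>|P. (g \<omega> * (1 + cos (W \<omega> + \<theta>))) *\<^sub>R iexp (u * Z \<omega>)) =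
       (CLINT \<omega>|Q. (g' \<omega> * (1 + cos (W' \<omega> + \<theta>))) *\<^sub>R iexp (u * Z' \<omega>))" .
  next
    have le: "0 \<le> k * (1 + cos x) \<and> k * (1 + cos x) \<le> 2" if "0 \<le> k" "k \<le> 1" for k x :: real
    proof -
      have c: "0 \<le> 1 + cos x" "1 + cos x \<le> 2"
        using cos_ge_minus_one[of x] cos_le_one[of x] by linarith+
      show ?thesis using mult_mono[OF that(2) c(2)] mult_nonneg_nonneg[OF that(1) c(1)] c(1) by simp
    qed
    show "0 \<le> g \<omega> * (1 + cos (W \<omega> + \<theta>))" "g \<omega> * (1 + cos (W \<omega> + \<theta>)) \<le> 2" for \<omega>
      using le g0 by blast+
    show "0 \<le> g' \<omega> * (1 + cos (W' \<omega> + \<theta>))" "g' \<omega> * (1 + cos (W' \<omega> + \<theta>)) \<le> 2" for \<omega>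
      using le g0 by blast+
  qed auto
  have w0: "(\<integral>\<omega>. g \<omega> * indicator B (Z \<omega>) \<partial>P) = (\<integral>\<omega>. g' \<omega> * indicator B (Z' \<omega>) \<partial>Q)"
    by (rule weighted_char_uniqueness[OF P.prob_space_axioms Q.prob_space_axioms, where C=1])
       (auto intro!: g0 char scale ZZ simp del: of_real_mult)
  define a where "a = (\<lambda>\<omega>. indicator B (Z \<omega>) * g \<omega>)"
  define a' where "a' = (\<lambda>\<omega>. indicator B (Z' \<omega>) * g' \<omega>)"
  have [measurable]: "a \<in> borel_measurable P" "a' \<in> borel_measurable Q" by (simp_all add: a_def a'_def)
  have ia: "integrable P (\<lambda>\<omega>. a \<omega> * h (W \<omega> + \<theta>))"
    if [measurable]: "h \<in> borel_measurable borel" and h: "\<And>x. \<bar>h x\<bar> \<le> (1::real)" for h \<theta>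
    by (rule P.integrable_const_bound[where B=1])
       (use g0 h in \<open>auto simp: a_def abs_mult indicator_def intro!: mult_le_one\<close>)
  have ia': "integrable Q (\<lambda>\<omega>. a' \<omega> * h (W' \<omega> + \<theta>))"
    if [measurable]: "h \<in> borel_measurable borel" and h: "\<And>x. \<bar>h x\<bar> \<le> (1::real)" for h \<theta>
    by (rule Q.integrable_const_bound[where B=1])
       (use g0 h in \<open>auto simp: a'_def abs_mult indicator_def intro!: mult_le_one\<close>)
  \<comment> \<open>Subtracting \<open>w0\<close> from \<open>w\<close> removes the constant 1,
    which was there only to keep the weight nonnegative.\<close>
  have c: "(\<integral>\<omega>. a \<omega> * cos (W \<omega> + \<theta>) \<partial>P) = (\<integral>\<omega>. a' \<omega> * cos (W' \<omega> + \<theta>) \<partial>Q)" for \<theta>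
  proof -
    have e: "(k * (1 + cs)) * i = i * k + (i * k) * cs" "k * i = i * k * 1" for k cs i :: real
      by (simp_all add: algebra_simps)
    show ?thesis
      using w[of \<theta>] w0 ia[of cos \<theta>] ia'[of cos \<theta>] ia[of "\<lambda>_. 1" \<theta>] ia'[of "\<lambda>_. 1" \<theta>]
      unfolding e(1) a_def[symmetric] a'_def[symmetric]
      by (simp add: a_def a'_def mult.commute)
  qed
  \<comment> \<open>The sine is the cosine shifted by \<open>pi / 2\<close>, so the phases 0 and
    \<open>- (pi / 2)\<close> yield the real and imaginary parts.\<close>
  have split: "x *\<^sub>R iexp w = complex_of_real (x * cos (w + 0)) + \<i> * complex_of_real (x * cos (w + (- (pi / 2))))" for x w :: real
    by (simp add: complex_eq_iff Re_exp Im_exp cos_add cos_diff)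
  have "(CLINT \<omega>|P. a \<omega> *\<^sub>R iexp (W \<omega>)) =
      complex_of_real (\<integral>\<omega>. a \<omega> * cos (W \<omega> + 0) \<partial>P) + \<i> * complex_of_real (\<integral>\<omega>. a \<omega> * cos (W \<omega> + (- (pi / 2))) \<partial>P)"
    unfolding split by (intro integral_Re_Im ia) simp_all
  moreover have "(CLINT \<omega>|Q. a' \<omega> *\<^sub>R iexp (W' \<omega>)) =
      complex_of_real (\<integral>\<omega>. a' \<omega> * cos (W' \<omega> + 0) \<partial>Q) + \<i> * complex_of_real (\<integral>\<omega>. a' \<omega> * cos (W' \<omega> + (- (pi / 2))) \<partial>Q)"
    unfolding split by (intro integral_Re_Im ia') simp_all
  ultimately show ?thesis by (simp only: c) (simp add: a_def a'_def)
qed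

text \<open>The exponential factor is carried along to make the induction work: the indicators
  already treated serve as the weight \<open>g\<close> in \<open>uniqueness_step\<close>.\<close>

lemma prod_uniqueness:
  assumes "finite F" "\<And>t. t \<in> F \<Longrightarrow> (Z t, Z' t) \<in> R" "\<And>t. t \<in> F \<Longrightarrow> B t \<in> sets borel"
    and "(W, W') \<in> R"
  shows "(CLINT \<omega>|P. (\<Prod>t\<in>F. indicator (B t) (Z t \<omega>) :: real) *\<^sub>R iexp (W \<omega>))
       = (CLINT \<omega>|Q. (\<Prod>t\<in>F. indicator (B t) (Z' t \<omega>) :: real) *\<^sub>R iexp (W' \<omega>))"
  using assms
proof (induction F arbitrary: W W' rule: finite_induct)
  case empty
  then show ?case by (simp add: char_eq)
next
  case (insert t F)
  have [measurable]: "s \<in> F \<Longrightarrow> Z s \<in> borel_measurable P" "s \<in> F \<Longrightarrow> Z' s \<in> borel_measurable Q"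
    "s \<in> F \<Longrightarrow> B s \<in> sets borel" for s
    using insert.prems measurable by blast+
  have "(CLINT \<omega>|P. (indicator (B t) (Z t \<omega>) * (\<Prod>t\<in>F. indicator (B t) (Z t \<omega>) :: real)) *\<^sub>R iexp (W \<omega>))
       = (CLINT \<omega>|Q. (indicator (B t) (Z' t \<omega>) * (\<Prod>t\<in>F. indicator (B t) (Z' t \<omega>) :: real)) *\<^sub>R iexp (W' \<omega>))"
    using insert.prems
    by (intro uniqueness_step insert.IH) (auto intro!: prod_nonneg prod_le_1)
  then show ?case using insert.hyps by simp
qed

lemma finite_dimensional_uniqueness:
  assumes F: "finite F" and Z: "\<And>t. t \<in> F \<Longrightarrow> (Z t, Z' t) \<in> R" and B: "\<And>t. t \<in> F \<Longrightarrow> B t \<in> sets borel"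
  shows "P.prob {\<omega>\<in>space P. \<forall>t\<in>F. Z t \<omega> \<in> B t} = Q.prob {\<omega>\<in>space Q. \<forall>t\<in>F. Z' t \<omega> \<in> B t}"
proof -
  have [measurable]: "s \<in> F \<Longrightarrow> Z s \<in> borel_measurable P" "s \<in> F \<Longrightarrow> Z' s \<in> borel_measurable Q"
    "s \<in> F \<Longrightarrow> B s \<in> sets borel" for s
    using Z B measurable by blast+
  have ind: "(\<Prod>t\<in>F. indicator (B t) (f t) :: real) = indicator {f. \<forall>t\<in>F. f t \<in> B t} f" for f
    using F by (auto simp: indicator_def prod_eq_1_iff prod_zero_iff split: if_splits)
  have eP: "(\<integral>\<omega>. (\<Prod>t\<in>F. indicator (B t) (Z t \<omega>) :: real) \<partial>P) = P.prob {\<omega>\<in>space P. \<forall>t\<in>F. Z t \<omega> \<in> B t}"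
  proof -
    have "(\<integral>\<omega>. (\<Prod>t\<in>F. indicator (B t) (Z t \<omega>) :: real) \<partial>P) = (\<integral>\<omega>. indicator {\<omega>\<in>space P. \<forall>t\<in>F. Z t \<omega> \<in> B t} \<omega> \<partial>P)"
      by (intro Bochner_Integration.integral_cong refl) (subst ind, auto simp: indicator_def)
    also have "\<dots> = P.prob {\<omega>\<in>space P. \<forall>t\<in>F. Z t \<omega> \<in> B t}"
      by (subst Bochner_Integration.integral_indicator) (auto intro!: arg_cong[where f=P.prob])
    finally show ?thesis .
  qed
  have eQ: "(\<integral>\<omega>. (\<Prod>t\<in>F. indicator (B t) (Z' t \<omega>) :: real) \<partial>Q) = Q.prob {\<omega>\<in>space Q. \<forall>t\<in>F. Z' t \<omega> \<in> B t}"
  proof -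
    have "(\<integral>\<omega>. (\<Prod>t\<in>F. indicator (B t) (Z' t \<omega>) :: real) \<partial>Q) = (\<integral>\<omega>. indicator {\<omega>\<in>space Q. \<forall>t\<in>F. Z' t \<omega> \<in> B t} \<omega> \<partial>Q)"
      by (intro Bochner_Integration.integral_cong refl) (subst ind, auto simp: indicator_def)
    also have "\<dots> = Q.prob {\<omega>\<in>space Q. \<forall>t\<in>F. Z' t \<omega> \<in> B t}"
      by (subst Bochner_Integration.integral_indicator) (auto intro!: arg_cong[where f=Q.prob])
    finally show ?thesis .
  qed
  have "complex_of_real (\<integral>\<omega>. (\<Prod>t\<in>F. indicator (B t) (Z t \<omega>) :: real) \<partial>P)
     = complex_of_real (\<integral>\<omega>. (\<Prod>t\<in>F. indicator (B t) (Z' t \<omega>) :: real) \<partial>Q)"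
    using prod_uniqueness[OF F Z B zero]
    by (simp add: scaleR_conv_of_real del: of_real_prod flip: integral_of_real)
  then show ?thesis by (simp only: eP eQ of_real_eq_iff)
qed

text \<open>Continuity from above along finite sets \<open>F n\<close> increasing to
  \<open>D\<close>. A uniform bound on a continuous function is an event of this kind, with
  \<open>D\<close> indexing a countable dense set.\<close>

lemma countable_uniqueness:
  assumes D: "countable D" and Z: "\<And>t. t \<in> D \<Longrightarrow> (Z t, Z' t) \<in> R" and B: "\<And>t. t \<in> D \<Longrightarrow> B t \<in> sets borel"
  shows "P.prob {\<omega>\<in>space P. \<forall>t\<in>D. Z t \<omega> \<in> B t} = Q.prob {\<omega>\<in>space Q. \<forall>t\<in>D. Z' t \<omega> \<in> B t}"
proof (cases "D = {}")
  case True
  then show ?thesis by (simp add: P.prob_space Q.prob_space)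
next
  case False
  define F where "F n = from_nat_into D ` {..n}" for n
  have FD: "F n \<subseteq> D" for n by (auto simp: F_def intro: from_nat_into[OF False])
  have UF: "D = (\<Union>n. F n)"
    by (simp add: F_def image_UN[symmetric] UN_atMost_UNIV range_from_nat_into[OF False D])
  have [measurable]: "s \<in> D \<Longrightarrow> Z s \<in> borel_measurable P" "s \<in> D \<Longrightarrow> Z' s \<in> borel_measurable Q"
    "s \<in> D \<Longrightarrow> B s \<in> sets borel" for s
    using Z B measurable by blast+
  have fin[simp]: "finite (F n)" for n by (simp add: F_def)
  have mono: "m \<le> n \<Longrightarrow> F m \<subseteq> F n" for m n by (auto simp: F_def)
  have mP: "{\<omega>\<in>space P. Z t \<omega> \<in> B t} \<in> sets P" and mQ: "{\<omega>\<in>space Q. Z' t \<omega> \<in> B t} \<in> sets Q" if "t \<in> D" for t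
    using that by measurable
  have "(\<lambda>n. P.prob {\<omega>\<in>space P. \<forall>t\<in>F n. Z t \<omega> \<in> B t}) \<longlonglongrightarrow> P.prob (\<Inter>n. {\<omega>\<in>space P. \<forall>t\<in>F n. Z t \<omega> \<in> B t})"
  proof (rule P.finite_Lim_measure_decseq)
    show "range (\<lambda>n. {\<omega>\<in>space P. \<forall>t\<in>F n. Z t \<omega> \<in> B t}) \<subseteq> sets P"
      by (intro image_subsetI sets.sets_Collect_finite_All mP fin) (use FD in blast)
    show "decseq (\<lambda>n. {\<omega>\<in>space P. \<forall>t\<in>F n. Z t \<omega> \<in> B t})"
      using mono by (fastforce simp: decseq_def)
  qed
  moreover have "(\<lambda>n. Q.prob {\<omega>\<in>space Q. \<forall>t\<in>F n. Z' t \<omega> \<in> B t}) \<longlonglongrightarrow> Q.prob (\<Inter>n. {\<omega>\<in>space Q. \<forall>t\<in>F n. Z' t \<omega> \<in> B t})"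
  proof (rule Q.finite_Lim_measure_decseq)
    show "range (\<lambda>n. {\<omega>\<in>space Q. \<forall>t\<in>F n. Z' t \<omega> \<in> B t}) \<subseteq> sets Q"
      by (intro image_subsetI sets.sets_Collect_finite_All mQ fin) (use FD in blast)
    show "decseq (\<lambda>n. {\<omega>\<in>space Q. \<forall>t\<in>F n. Z' t \<omega> \<in> B t})"
      using mono by (fastforce simp: decseq_def)
  qed
  moreover have "P.prob {\<omega>\<in>space P. \<forall>t\<in>F n. Z t \<omega> \<in> B t} = Q.prob {\<omega>\<in>space Q. \<forall>t\<in>F n. Z' t \<omega> \<in> B t}" for n
    using FD[of n] by (intro finite_dimensional_uniqueness) (auto intro: Z B)
  ultimately have "P.prob (\<Inter>n. {\<omega>\<in>space P. \<forall>t\<in>F n. Z t \<omega> \<in> B t}) = Q.prob (\<Inter>n. {\<omega>\<in>space Q. \<forall>t\<in>F n. Z' t \<omega> \<in> B t})"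
    by (simp add: LIMSEQ_unique)
  moreover have "(\<Inter>n. {\<omega>\<in>space P. \<forall>t\<in>F n. Z t \<omega> \<in> B t}) = {\<omega>\<in>space P. \<forall>t\<in>D. Z t \<omega> \<in> B t}"
    "(\<Inter>n. {\<omega>\<in>space Q. \<forall>t\<in>F n. Z' t \<omega> \<in> B t}) = {\<omega>\<in>space Q. \<forall>t\<in>D. Z' t \<omega> \<in> B t}"
    unfolding UF by auto
  ultimately show ?thesis by simp
qed

end

section \<open>Small balls\<close>

text \<open>The quantification over all \<open>B\<close> of positive probability makes the property
  stable under finite unions, since an event found for one family can be refined for the next. The
  event \<open>A\<close> serves all members of the family simultaneously.\<close>

definition small_oscillation :: "'w measure \<Rightarrow> ('w \<Rightarrow> real) set \<Rightarrow> bool" where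
  "small_oscillation P \<Z> \<longleftrightarrow>
     (\<forall>\<epsilon>>0. \<forall>B\<in>sets P. 0 < measure P B \<longrightarrow>
       (\<exists>A\<in>sets P. A \<subseteq> B \<and> 0 < measure P A \<and> (\<forall>Z\<in>\<Z>. \<forall>\<omega>\<in>A. \<forall>\<omega>'\<in>A. \<bar>Z \<omega> - Z \<omega>'\<bar> \<le> \<epsilon>)))"

lemma small_oscillationE:
  assumes "small_oscillation P \<Z>" "0 < \<epsilon>" "B \<in> sets P" "0 < measure P B"
  obtains A where "A \<in> sets P" "A \<subseteq> B" "0 < measure P A"
    "\<And>Z \<omega> \<omega>'. Z \<in> \<Z> \<Longrightarrow> \<omega> \<in> A \<Longrightarrow> \<omega>' \<in> A \<Longrightarrow> \<bar>Z \<omega> - Z \<omega>'\<bar> \<le> \<epsilon>"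
  using assms unfolding small_oscillation_def by meson

lemma small_oscillation_Un:
  assumes 1: "small_oscillation P \<Z>" and 2: "small_oscillation P \<Z>'"
  shows "small_oscillation P (\<Z> \<union> \<Z>')"
  unfolding small_oscillation_def
proof (intro allI ballI impI)
  fix \<epsilon> :: real and B assume e: "0 < \<epsilon>" and B: "B \<in> sets P" "0 < measure P B"
  from small_oscillationE[OF 1 e B] obtain A where A: "A \<in> sets P" "A \<subseteq> B" "0 < measure P A"
    "\<And>Z \<omega> \<omega>'. Z \<in> \<Z> \<Longrightarrow> \<omega> \<in> A \<Longrightarrow> \<omega>' \<in> A \<Longrightarrow> \<bar>Z \<omega> - Z \<omega>'\<bar> \<le> \<epsilon>" by metis
  from small_oscillationE[OF 2 e A(1,3)] obtain A' where A': "A' \<in> sets P" "A' \<subseteq> A" "0 < measure P A'"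
    "\<And>Z \<omega> \<omega>'. Z \<in> \<Z>' \<Longrightarrow> \<omega> \<in> A' \<Longrightarrow> \<omega>' \<in> A' \<Longrightarrow> \<bar>Z \<omega> - Z \<omega>'\<bar> \<le> \<epsilon>" by metis
  show "\<exists>A\<in>sets P. A \<subseteq> B \<and> 0 < measure P A \<and>
      (\<forall>Z\<in>\<Z> \<union> \<Z>'. \<forall>\<omega>\<in>A. \<forall>\<omega>'\<in>A. \<bar>Z \<omega> - Z \<omega>'\<bar> \<le> \<epsilon>)"
    using A A'(1,3,4) subsetD[OF A'(2)] by (intro bexI[of _ A']) auto
qed

lemma small_oscillation_empty: "small_oscillation P {}"
  by (auto simp: small_oscillation_def)

lemma small_oscillation_UN:
  assumes "finite I" "\<And>i. i \<in> I \<Longrightarrow> small_oscillation P (\<Z> i)"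
  shows "small_oscillation P (\<Union>i\<in>I. \<Z> i)"
  using assms by (induction I rule: finite_induct) (auto intro: small_oscillation_Un small_oscillation_empty)

text \<open>If every cell met \<open>B\<close> in a null set, countability would make
  \<open>B\<close> itself null.\<close>

lemma (in prob_space) small_oscillation_of_cover:
  assumes "\<And>\<epsilon>. \<epsilon> > 0 \<Longrightarrow> \<exists>\<A>. countable \<A> \<and> \<A> \<subseteq> sets M \<and> space M \<subseteq> \<Union>\<A> \<and>
    (\<forall>A\<in>\<A>. \<forall>Z\<in>\<Z>. \<forall>\<omega>\<in>A. \<forall>\<omega>'\<in>A. \<bar>Z \<omega> - Z \<omega>'\<bar> \<le> \<epsilon>)"
  shows "small_oscillation M \<Z>"
  unfolding small_oscillation_def
proof (intro allI ballI impI)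
  fix \<epsilon> :: real and B assume e: "0 < \<epsilon>" and B: "B \<in> events" "0 < prob B"
  from assms[OF e] obtain \<A> where \<A>: "countable \<A>" "\<A> \<subseteq> events" "space M \<subseteq> \<Union>\<A>"
    "\<And>A Z \<omega> \<omega>'. A \<in> \<A> \<Longrightarrow> Z \<in> \<Z> \<Longrightarrow> \<omega> \<in> A \<Longrightarrow> \<omega>' \<in> A \<Longrightarrow> \<bar>Z \<omega> - Z \<omega>'\<bar> \<le> \<epsilon>" by metis
  have "\<exists>A\<in>\<A>. 0 < prob (A \<inter> B)"
  proof (rule ccontr)
    assume "\<not> ?thesis"
    then have "A \<inter> B \<in> null_sets M" if "A \<in> \<A>" for A
      using that \<A>(2) B(1) by (auto simp: null_sets_def emeasure_eq_measure not_less measure_le_0_iff)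
    then have "(\<Union>A\<in>\<A>. A \<inter> B) \<in> null_sets M"
      by (intro null_sets_UN' \<A>(1))
    moreover have "(\<Union>A\<in>\<A>. A \<inter> B) = B" using \<A>(3) sets.sets_into_space[OF B(1)] by auto
    ultimately show False using B by (simp add: null_sets_def emeasure_eq_measure)
  qed
  then obtain A where A: "A \<in> \<A>" "0 < prob (A \<inter> B)" by blast
  show "\<exists>A\<in>events. A \<subseteq> B \<and> 0 < prob A \<and> (\<forall>Z\<in>\<Z>. \<forall>\<omega>\<in>A. \<forall>\<omega>'\<in>A. \<bar>Z \<omega> - Z \<omega>'\<bar> \<le> \<epsilon>)"
    using A \<A>(2,4) B(1) by (intro bexI[of _ "A \<inter> B"]) auto
qed

text \<open>Separability of \<open>C(K)\<close> in disguise: the cells of the cover are given by a mesh size and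
  rational approximate values on a finite net of that mesh.\<close>

lemma (in prob_space) small_oscillation_compact:
  fixes Z :: "'s::metric_space \<Rightarrow> 'a \<Rightarrow> real"
  assumes K: "compact K" and D: "countable D" "D \<subseteq> K"
    and Z[measurable]: "\<And>x. x \<in> K \<Longrightarrow> Z x \<in> borel_measurable M"
    and cont: "\<And>\<omega>. \<omega> \<in> space M \<Longrightarrow> continuous_on K (\<lambda>x. Z x \<omega>)"
  shows "small_oscillation M (Z ` D)"
proof (rule small_oscillation_of_cover)
  fix \<epsilon> :: real assume e: "\<epsilon> > 0"
  have "\<exists>F. finite F \<and> F \<subseteq> K \<and> K \<subseteq> (\<Union>y\<in>F. ball y (inverse (real (Suc n))))" for n
    using compact_imp_seq_compact[OF K] seq_compact_imp_totally_bounded[of K]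
    by (simp add: del: of_nat_Suc)
  then obtain F where F: "\<And>n. finite (F n)" "\<And>n. F n \<subseteq> K"
    "\<And>n. K \<subseteq> (\<Union>y\<in>F n. ball y (inverse (real (Suc n))))" by metis
  \<comment> \<open>The points \<open>x\<close> range over the countable set \<open>D\<close> only,
    which makes the cell an event. The half leaves room for comparing two outcomes with the same
    value \<open>q y\<close>.\<close>
  define A where "A n q = {\<omega>\<in>space M. \<forall>x\<in>D. \<forall>y\<in>F n. dist y x < inverse (real (Suc n)) \<longrightarrow> \<bar>Z x \<omega> - q y\<bar> \<le> \<epsilon> / 2}"
    for n and q :: "'s \<Rightarrow> real"
  define \<A> where "\<A> = (\<Union>n. A n ` (F n \<rightarrow>\<^sub>E \<rat>))"
  have "countable \<A>"
    unfolding \<A>_def by (intro countable_UN countable_image countable_PiE F countable_rat) auto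
  moreover have "A n q \<in> events" for n q
    unfolding A_def
  proof (rule sets.sets_Collect_countable_All'[OF _ D(1)], rule sets.sets_Collect_finite_All[OF _ F(1)])
    fix x y assume xy: "x \<in> D"
    with D have [measurable]: "Z x \<in> borel_measurable M" by (intro Z) auto
    show "{\<omega>\<in>space M. dist y x < inverse (real (Suc n)) \<longrightarrow> \<bar>Z x \<omega> - q y\<bar> \<le> \<epsilon> / 2} \<in> events"
      by measurable
  qed
  then have "\<A> \<subseteq> events" by (auto simp: \<A>_def)
  moreover have "space M \<subseteq> \<Union>\<A>"
  proof
    fix \<omega> assume \<omega>: "\<omega> \<in> space M"
    have "uniformly_continuous_on K (\<lambda>x. Z x \<omega>)"
      by (rule compact_uniformly_continuous[OF cont[OF \<omega>] K])
    then obtain d where d: "d > 0" "\<And>x y. x \<in> K \<Longrightarrow> y \<in> K \<Longrightarrow> dist y x < d \<Longrightarrow> \<bar>Z y \<omega> - Z x \<omega>\<bar> < \<epsilon> / 4"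
      using e unfolding uniformly_continuous_on_def dist_real_def
      by (metis zero_less_divide_iff zero_less_numeral)
    \<comment> \<open>The modulus of continuity depends on \<open>\<omega>\<close>, hence so does
      the mesh; this is why cells of all meshes enter the cover.\<close>
    obtain n where n: "inverse (real (Suc n)) < d" using reals_Archimedean[OF d(1)] by auto
    have "\<exists>q\<in>\<rat>. \<bar>Z y \<omega> - q\<bar> < \<epsilon> / 4" for y
    proof -
      obtain q where q: "q \<in> \<rat>" "Z y \<omega> - \<epsilon> / 4 < q" "q < Z y \<omega> + \<epsilon> / 4"
        using Rats_dense_in_real[of "Z y \<omega> - \<epsilon> / 4" "Z y \<omega> + \<epsilon> / 4"] e by auto
      then have "\<bar>Z y \<omega> - q\<bar> < \<epsilon> / 4" by linarith
      with q(1) show ?thesis by blast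
    qed
    then obtain q where q: "\<And>y. q y \<in> \<rat>" "\<And>y. \<bar>Z y \<omega> - q y\<bar> < \<epsilon> / 4" by metis
    have "\<omega> \<in> A n (restrict q (F n))"
      unfolding A_def
    proof (intro CollectI conjI ballI impI \<omega>)
      fix x y assume x: "x \<in> D" and y: "y \<in> F n" and xy: "dist y x < inverse (real (Suc n))"
      then have "x \<in> K" "y \<in> K" using D F by auto
      with xy n d(2)[of x y] have "\<bar>Z y \<omega> - Z x \<omega>\<bar> < \<epsilon> / 4" by linarith
      with q(2)[of y] show "\<bar>Z x \<omega> - restrict q (F n) y\<bar> \<le> \<epsilon> / 2" using y by (simp add: abs_if split: if_splits)
    qed
    moreover have "restrict q (F n) \<in> F n \<rightarrow>\<^sub>E \<rat>" using q by auto
    ultimately show "\<omega> \<in> \<Union>\<A>" unfolding \<A>_def by blast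
  qed
  moreover have "\<forall>A\<in>\<A>. \<forall>Z\<in>Z ` D. \<forall>\<omega>\<in>A. \<forall>\<omega>'\<in>A. \<bar>Z \<omega> - Z \<omega>'\<bar> \<le> \<epsilon>"
  proof (intro ballI)
    fix B Z' \<omega> \<omega>' assume "B \<in> \<A>" and Z': "Z' \<in> Z ` D" and w: "\<omega> \<in> B" "\<omega>' \<in> B"
    from \<open>B \<in> \<A>\<close> obtain n q where B: "B = A n q" by (auto simp: \<A>_def)
    from Z' obtain x where x: "x \<in> D" "Z' = Z x" by blast
    have "x \<in> K" using x(1) D(2) by (rule subsetD[rotated])
    then have "x \<in> (\<Union>y\<in>F n. ball y (inverse (real (Suc n))))" by (rule subsetD[OF F(3)])
    then obtain y where y: "y \<in> F n" "x \<in> ball y (inverse (real (Suc n)))" by (rule UN_E)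
    have "\<bar>Z x \<omega>'' - q y\<bar> \<le> \<epsilon> / 2" if "\<omega>'' \<in> B" for \<omega>''
      using that x(1) y unfolding B A_def mem_ball by simp
    from this[OF w(1)] this[OF w(2)] show "\<bar>Z' \<omega> - Z' \<omega>'\<bar> \<le> \<epsilon>" unfolding x(2) by linarith
  qed
  ultimately show "\<exists>\<A>. countable \<A> \<and> \<A> \<subseteq> sets M \<and> space M \<subseteq> \<Union>\<A> \<and>
    (\<forall>A\<in>\<A>. \<forall>Z\<in>Z ` D. \<forall>\<omega>\<in>A. \<forall>\<omega>'\<in>A. \<bar>Z \<omega> - Z \<omega>'\<bar> \<le> \<epsilon>)"
    by (intro exI[of _ \<A>] conjI)
qed

lemma (in prob_space) small_oscillation_singleton:
  assumes Y: "Y \<in> borel_measurable M" shows "small_oscillation M {Y :: 'a \<Rightarrow> real}"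
  using small_oscillation_compact[of "{0::real}" "{0}" "\<lambda>_. Y"] Y by simp

section \<open>Independent copies on a product space, and positivity of Gaussian intervals\<close>

lemma iexp_integral_pair:
  fixes U :: "'a \<Rightarrow> real" and W :: "'b \<Rightarrow> real"
  assumes P: "prob_space P" and Q: "prob_space Q"
    and [measurable]: "U \<in> borel_measurable P" "W \<in> borel_measurable Q"
  shows "(CLINT p|P \<Otimes>\<^sub>M Q. iexp (U (fst p) + W (snd p))) = (CLINT \<omega>|P. iexp (U \<omega>)) * (CLINT \<omega>|Q. iexp (W \<omega>))"
proof -
  interpret P: prob_space P by fact
  interpret Q: prob_space Q by fact
  interpret PQ: pair_prob_space P Q ..
  have "integrable (P \<Otimes>\<^sub>M Q) (\<lambda>p. iexp (U (fst p) + W (snd p)))"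
    by (rule PQ.integrable_const_bound[where B=1]) auto
  then have "(CLINT p|P \<Otimes>\<^sub>M Q. iexp (U (fst p) + W (snd p))) = (CLINT x|P. CLINT y|Q. iexp (U x + W y))"
    by (subst PQ.integral_fst'[symmetric]) simp_all
  also have "\<dots> = (CLINT x|P. CLINT y|Q. iexp (U x) * iexp (W y))"
    by (simp add: distrib_left exp_add)
  finally show ?thesis by simp
qed

lemma prob_pair_times:
  assumes P: "prob_space P" and Q: "prob_space Q" and A: "A \<in> sets P" and B: "B \<in> sets Q"
  shows "measure (P \<Otimes>\<^sub>M Q) (A \<times> B) = measure P A * measure Q B"
proof -
  interpret P: prob_space P by fact
  interpret Q: prob_space Q by fact
  interpret PQ: pair_prob_space P Q ..
  have "emeasure (P \<Otimes>\<^sub>M Q) (A \<times> B) = emeasure P A * emeasure Q B"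
    using A B by (rule Q.emeasure_pair_measure_Times)
  then show ?thesis
    by (simp add: PQ.emeasure_eq_measure P.emeasure_eq_measure Q.emeasure_eq_measure flip: ennreal_mult)
qed

text \<open>A nonzero second moment rules out the degenerate case, and a normal density vanishes
  nowhere.\<close>

lemma centered_gaussian_interval_positive:
  assumes P: "prob_space P" and G: "centered_gaussian P Y" and nz: "(\<integral>\<omega>. (Y \<omega>)\<^sup>2 \<partial>P) \<noteq> 0" and ab: "a < b"
  shows "0 < measure P {\<omega>\<in>space P. Y \<omega> \<in> {a..b}}"
proof (rule ccontr)
  interpret prob_space P by fact
  assume n: "\<not> ?thesis"
  have [measurable]: "Y \<in> borel_measurable P" using G by (rule centered_gaussian_measurable)
  have "\<not> (AE \<omega> in P. Y \<omega> = 0)"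
  proof
    assume "AE \<omega> in P. Y \<omega> = 0"
    then have "(\<integral>\<omega>. (Y \<omega>)\<^sup>2 \<partial>P) = (\<integral>\<omega>. 0 \<partial>P)" by (intro integral_cong_AE) auto
    with nz show False by simp
  qed
  then obtain \<sigma> where \<sigma>: "\<sigma> > 0" "distributed P lborel Y (normal_density 0 \<sigma>)"
    using G by (auto simp: centered_gaussian_def)
  have "0 = emeasure P {\<omega>\<in>space P. Y \<omega> \<in> {a..b}}"
    using n by (simp add: emeasure_eq_measure not_less measure_le_0_iff)
  also have "\<dots> = emeasure (distr P lborel Y) {a..b}"
    by (subst emeasure_distr) (auto intro!: arg_cong[where f="emeasure P"])
  also have "\<dots> = (\<integral>\<^sup>+x. ennreal (normal_density 0 \<sigma> x) * indicator {a..b} x \<partial>lborel)"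
    using \<sigma>(2) unfolding distributed_def by (simp add: emeasure_density)
  finally have "AE x in lborel. ennreal (normal_density 0 \<sigma> x) * indicator {a..b} x = 0"
    by (subst (asm) eq_commute) (simp add: nn_integral_0_iff_AE)
  then have "AE x in lborel. x \<notin> {a..b}"
    by eventually_elim (use normal_density_pos[OF \<sigma>(1)] in \<open>auto simp: indicator_def not_less ennreal_eq_0_iff split: if_splits simp flip: not_le\<close>)
  then have "emeasure lborel {a..b} = 0"
    by (subst (asm) AE_iff_measurable[where N="{a..b}"]) auto
  with ab show False by simp
qed

section \<open>Positive probability of balls around zero and around covariance functions\<close>

context gaussian_space begin

lemma small_ball_positive:
  assumes \<Z>: "countable \<Z>" "\<Z> \<subseteq> V" and osc: "small_oscillation P \<Z>" and \<epsilon>: "\<epsilon> > 0"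
  shows "0 < prob {\<omega>\<in>space P. \<forall>Z\<in>\<Z>. Z \<omega> \<in> {-\<epsilon>..\<epsilon>}}"
proof -
  interpret PP: pair_prob_space P P ..
  define T where "T W p = W (fst p) / sqrt 2 - W (snd p) / sqrt 2" for W :: "'w \<Rightarrow> real" and p
  have [measurable]: "T W \<in> borel_measurable (P \<Otimes>\<^sub>M P)" if "W \<in> V" for W
    using measurable[OF that] unfolding T_def by measurable
  interpret R: equal_char P "P \<Otimes>\<^sub>M P" "{(W, T W) | W. W \<in> V}"
  proof
    show "((\<lambda>_. 0), (\<lambda>_. 0)) \<in> {(W, T W) | W. W \<in> V}"
      using zero by (auto simp: T_def)
    show "((\<lambda>\<omega>. W \<omega> + Z \<omega>), (\<lambda>\<omega>. W' \<omega> + Z' \<omega>)) \<in> {(W, T W) | W. W \<in> V}"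
      if "(W, W') \<in> {(W, T W) | W. W \<in> V}" "(Z, Z') \<in> {(W, T W) | W. W \<in> V}" for W W' Z Z'
      using that add by (auto simp: T_def add_divide_distrib)
    show "((\<lambda>\<omega>. c * W \<omega>), (\<lambda>\<omega>. c * W' \<omega>)) \<in> {(W, T W) | W. W \<in> V}"
      if "(W, W') \<in> {(W, T W) | W. W \<in> V}" for W W' c
      using that scale by (auto simp: T_def right_diff_distrib)
    show "(CLINT \<omega>|P. iexp (W \<omega>)) = (CLINT \<omega>|P \<Otimes>\<^sub>M P. iexp (W' \<omega>))"
      if "(W, W') \<in> {(W, T W) | W. W \<in> V}" for W W'
    proof -
      from that have W: "W \<in> V" and W': "W' = T W" by auto
      note [measurable] = measurable[OF W]
      define s where "s = expectation (\<lambda>\<omega>. (W \<omega>)\<^sup>2)"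
      have "(CLINT p|P \<Otimes>\<^sub>M P. iexp (W' p)) =
        (CLINT p|P \<Otimes>\<^sub>M P. iexp ((1 / sqrt 2) * W (fst p) + (- 1 / sqrt 2) * W (snd p)))"
        by (simp add: W' T_def)
      \<comment> \<open>Each copy carries half of the variance \<open>s\<close>; the two exponents
        add up to \<open>- s / 2\<close>.\<close>
      also have "\<dots> = of_real (exp (- s / 4)) * of_real (exp (- s / 4))"
        by (subst iexp_integral_pair[OF prob_space_axioms prob_space_axioms])
           (simp_all only: char_eq[OF W], simp_all add: power_divide s_def)
      also have "\<dots> = of_real (exp (- (1\<^sup>2 * s) / 2))"
        by (simp flip: of_real_mult exp_add)
      also have "\<dots> = (CLINT \<omega>|P. iexp (1 * W \<omega>))" unfolding char_eq[OF W] s_def ..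
      finally show ?thesis by simp
    qed
  qed (auto intro: measurable)
  have s2: "1 \<le> sqrt (2::real)" by simp
  \<comment> \<open>On \<open>A \<times> A\<close> the two copies differ by at most
    \<open>\<epsilon>\<close> for all of \<open>\<Z>\<close> at once, and this product has
    probability \<open>prob A\<close> squared.\<close>
  from small_oscillationE[OF osc \<epsilon>, of "space P"] obtain A where A: "A \<in> events" "0 < prob A"
    "\<And>Z \<omega> \<omega>'. Z \<in> \<Z> \<Longrightarrow> \<omega> \<in> A \<Longrightarrow> \<omega>' \<in> A \<Longrightarrow> \<bar>Z \<omega> - Z \<omega>'\<bar> \<le> \<epsilon>"
    by (metis prob_space sets.top zero_less_one)
  have "T Z (\<omega>, \<omega>') \<in> {-\<epsilon>..\<epsilon>}" if "Z \<in> \<Z>" "\<omega> \<in> A" "\<omega>' \<in> A" for Z \<omega> \<omega>'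
  proof -
    have "\<bar>T Z (\<omega>, \<omega>')\<bar> = \<bar>Z \<omega> - Z \<omega>'\<bar> / sqrt 2" by (simp add: T_def flip: diff_divide_distrib)
    also have "\<dots> \<le> \<bar>Z \<omega> - Z \<omega>'\<bar> / 1" by (rule divide_left_mono) auto
    also have "\<dots> \<le> \<epsilon>" using A(3)[OF that] by simp
    finally show ?thesis by auto
  qed
  then have sub: "A \<times> A \<subseteq> {p\<in>space (P \<Otimes>\<^sub>M P). \<forall>Z\<in>\<Z>. T Z p \<in> {-\<epsilon>..\<epsilon>}}"
    using sets.sets_into_space[OF A(1)] by (auto simp: space_pair_measure)
  have "0 < prob A * prob A" using A(2) by simp
  also have "\<dots> = measure (P \<Otimes>\<^sub>M P) (A \<times> A)"
    using prob_pair_times[OF prob_space_axioms prob_space_axioms A(1) A(1)] by simp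
  also have "\<dots> \<le> measure (P \<Otimes>\<^sub>M P) {p\<in>space (P \<Otimes>\<^sub>M P). \<forall>Z\<in>\<Z>. T Z p \<in> {-\<epsilon>..\<epsilon>}}"
  proof (rule PP.finite_measure_mono[OF sub], rule sets.sets_Collect_countable_All'[OF _ \<Z>(1)])
    fix Z assume "Z \<in> \<Z>"
    with \<Z> have [measurable]: "T Z \<in> borel_measurable (P \<Otimes>\<^sub>M P)" by auto
    show "{p\<in>space (P \<Otimes>\<^sub>M P). T Z p \<in> {-\<epsilon>..\<epsilon>}} \<in> sets (P \<Otimes>\<^sub>M P)" by measurable
  qed
  also have "\<dots> = prob {\<omega>\<in>space P. \<forall>Z\<in>\<Z>. Z \<omega> \<in> {-\<epsilon>..\<epsilon>}}"
    by (rule R.countable_uniqueness[OF \<Z>(1), where Z="\<lambda>Z. Z", symmetric]) (use \<Z> in auto)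
  finally show ?thesis .
qed

text \<open>With \<open>c W\<close> the regression coefficient of \<open>W\<close> on \<open>Y\<close>, the residual \<open>W - c W * Y\<close> is
  uncorrelated with \<open>Y\<close>, so replacing \<open>Y\<close> by an independent copy does not change the law of the
  family. The copy is close to \<open>E Y\<^sup>2\<close> with positive probability.\<close>

lemma shifted_ball_positive:
  assumes \<Z>: "countable \<Z>" "\<Z> \<subseteq> V" and osc: "small_oscillation P \<Z>" and \<epsilon>: "\<epsilon> > 0"
    and Y: "Y \<in> V" and C: "\<And>Z. Z \<in> \<Z> \<Longrightarrow> \<bar>expectation (\<lambda>\<omega>. Z \<omega> * Y \<omega>)\<bar> \<le> C"
  shows "0 < prob {\<omega>\<in>space P. \<forall>Z\<in>\<Z>. Z \<omega> \<in> {expectation (\<lambda>\<omega>. Z \<omega> * Y \<omega>) - \<epsilon> .. expectation (\<lambda>\<omega>. Z \<omega> * Y \<omega>) + \<epsilon>}}"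
proof (cases "expectation (\<lambda>\<omega>. (Y \<omega>)\<^sup>2) = 0")
  case True
  \<comment> \<open>Here \<open>Y\<close> vanishes in L2, so there is no shift and no regression
    coefficient to divide for.\<close>
  have "expectation (\<lambda>\<omega>. Z \<omega> * Y \<omega>) = 0" if "Z \<in> \<Z>" for Z
  proof -
    have Z: "Z \<in> V" using that \<Z> by auto
    have "\<bar>expectation (\<lambda>\<omega>. Z \<omega> * Y \<omega>)\<bar> \<le> sqrt (expectation (\<lambda>\<omega>. (Z \<omega>)\<^sup>2)) * sqrt (expectation (\<lambda>\<omega>. (Y \<omega>)\<^sup>2))"
      by (intro integral_cauchy_schwarz measurable integrable_square Z Y)
    with True show ?thesis by simp
  qed
  then have "{\<omega>\<in>space P. \<forall>Z\<in>\<Z>. Z \<omega> \<in> {expectation (\<lambda>\<omega>. Z \<omega> * Y \<omega>) - \<epsilon> .. expectation (\<lambda>\<omega>. Z \<omega> * Y \<omega>) + \<epsilon>}}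
      = {\<omega>\<in>space P. \<forall>Z\<in>\<Z>. Z \<omega> \<in> {-\<epsilon>..\<epsilon>}}" by auto
  then show ?thesis using small_ball_positive[OF \<Z> osc \<epsilon>] by simp
next
  case False
  define s where "s = expectation (\<lambda>\<omega>. (Y \<omega>)\<^sup>2)"
  have "0 \<le> s" by (simp add: s_def)
  with False have s: "s > 0" unfolding s_def by linarith
  define c where "c W = expectation (\<lambda>\<omega>. W \<omega> * Y \<omega>) / s" for W
  interpret PP: pair_prob_space P P ..
  define T where "T W p = (W (fst p) - c W * Y (fst p)) + c W * Y (snd p)" for W and p
  have iWY: "integrable P (\<lambda>\<omega>. W \<omega> * Y \<omega>)" if "W \<in> V" for W
    by (intro integrable_mult_of_squares measurable integrable_square that Y)
  note [measurable] = measurable[OF Y]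
  have [measurable]: "T W \<in> borel_measurable (P \<Otimes>\<^sub>M P)" if "W \<in> V" for W
    using measurable[OF that] unfolding T_def by measurable
  have c_add: "c (\<lambda>\<omega>. W \<omega> + W' \<omega>) = c W + c W'" if "W \<in> V" "W' \<in> V" for W W'
    using iWY[OF that(1)] iWY[OF that(2)] by (simp add: c_def distrib_right add_divide_distrib)
  have c_scale: "c (\<lambda>\<omega>. a * W \<omega>) = a * c W" for a W by (simp add: c_def mult.assoc)
  have res: "(\<lambda>\<omega>. W \<omega> - a * Y \<omega>) \<in> V" if "W \<in> V" for W a by (intro diff scale that Y)
  interpret R: equal_char P "P \<Otimes>\<^sub>M P" "{(W, T W) | W. W \<in> V}"
  proof
    show "((\<lambda>_. 0), (\<lambda>_. 0)) \<in> {(W, T W) | W. W \<in> V}"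
      using zero by (auto simp: T_def c_def)
    show "((\<lambda>\<omega>. W \<omega> + Z \<omega>), (\<lambda>\<omega>. W' \<omega> + Z' \<omega>)) \<in> {(W, T W) | W. W \<in> V}"
      if "(W, W') \<in> {(W, T W) | W. W \<in> V}" "(Z, Z') \<in> {(W, T W) | W. W \<in> V}" for W W' Z Z'
      using that add by (auto simp: T_def c_add algebra_simps)
    show "((\<lambda>\<omega>. c * W \<omega>), (\<lambda>\<omega>. c * W' \<omega>)) \<in> {(W, T W) | W. W \<in> V}"
      if "(W, W') \<in> {(W, T W) | W. W \<in> V}" for W W' c
      using that scale by (auto simp: T_def c_scale algebra_simps)
    show "(CLINT \<omega>|P. iexp (W \<omega>)) = (CLINT \<omega>|P \<Otimes>\<^sub>M P. iexp (W' \<omega>))"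
      if "(W, W') \<in> {(W, T W) | W. W \<in> V}" for W W'
    proof -
      from that have W: "W \<in> V" and W': "W' = T W" by auto
      note [measurable] = measurable[OF W]
      have "(CLINT p|P \<Otimes>\<^sub>M P. iexp (W' p)) =
        (CLINT p|P \<Otimes>\<^sub>M P. iexp ((1 * (W (fst p) - c W * Y (fst p))) + c W * Y (snd p)))"
        by (simp only: W' T_def mult_1)
      also have "\<dots> = of_real (exp (- (1\<^sup>2 * expectation (\<lambda>\<omega>. (W \<omega> - c W * Y \<omega>)\<^sup>2)) / 2)) * of_real (exp (- ((c W)\<^sup>2 * s) / 2))"
        by (subst iexp_integral_pair[OF prob_space_axioms prob_space_axioms])
           (simp_all only: char_eq[OF res[OF W]] char_eq[OF Y] s_def, simp_all)
      also have "\<dots> = of_real (exp (- (1\<^sup>2 * (expectation (\<lambda>\<omega>. (W \<omega> - c W * Y \<omega>)\<^sup>2) + (c W)\<^sup>2 * s)) / 2))"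
        by (simp add: distrib_left add_divide_distrib flip: of_real_mult exp_add)
      \<comment> \<open>Pythagoras: \<open>E (W Y) = c W * s\<close>, so the cross term takes away
        twice what the square of \<open>c W * Y\<close> contributes.\<close>
      also have "expectation (\<lambda>\<omega>. (W \<omega> - c W * Y \<omega>)\<^sup>2) + (c W)\<^sup>2 * s = expectation (\<lambda>\<omega>. (W \<omega>)\<^sup>2)"
      proof -
        have "expectation (\<lambda>\<omega>. (W \<omega> - c W * Y \<omega>)\<^sup>2)
            = expectation (\<lambda>\<omega>. (W \<omega>)\<^sup>2 - 2 * c W * (W \<omega> * Y \<omega>) + (c W)\<^sup>2 * (Y \<omega>)\<^sup>2)"
          by (intro Bochner_Integration.integral_cong refl) (simp add: power2_eq_square algebra_simps)
        also have "\<dots> = expectation (\<lambda>\<omega>. (W \<omega>)\<^sup>2) - 2 * c W * (c W * s) + (c W)\<^sup>2 * s"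
          using integrable_square[OF W] integrable_square[OF Y] iWY[OF W] s by (simp add: s_def[symmetric] c_def)
        finally show ?thesis by (simp add: power2_eq_square)
      qed
      also have "of_real (exp (- (1\<^sup>2 * expectation (\<lambda>\<omega>. (W \<omega>)\<^sup>2)) / 2)) = (CLINT \<omega>|P. iexp (1 * W \<omega>))"
        unfolding char_eq[OF W] ..
      finally show ?thesis by simp
    qed
  qed (auto intro: measurable)
  define \<Z>' where "\<Z>' = (\<lambda>Z \<omega>. Z \<omega> - c Z * Y \<omega>) ` \<Z>"
  have cC: "\<bar>c Z\<bar> \<le> \<bar>C\<bar> / s" if "Z \<in> \<Z>" for Z
    using C[OF that] s by (simp add: c_def divide_right_mono)
  \<comment> \<open>The summand 1 makes \<open>C'\<close> positive even for \<open>C = 0\<close>; it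
    is a divisor below.\<close>
  define C' where "C' = \<bar>C\<bar> / s + 1"
  have C': "C' > 0" "\<And>Z. Z \<in> \<Z> \<Longrightarrow> \<bar>c Z\<bar> \<le> C'"
    using s cC by (force simp: C'_def intro!: add_nonneg_pos)+
  \<comment> \<open>The event found for \<open>\<Z>\<close> is refined to one on which
    \<open>Y\<close> also varies little, with a tolerance scaled by the bound \<open>C'\<close> on
    the coefficients.\<close>
  have "small_oscillation P \<Z>'"
    unfolding small_oscillation_def
  proof (intro allI ballI impI)
    fix e :: real and B assume e: "0 < e" and B: "B \<in> events" "0 < prob B"
    have e2: "e / 2 > 0" and eC: "e / (2 * C') > 0" using e C' by auto
    from small_oscillationE[OF osc e2 B] obtain A where A: "A \<in> events" "A \<subseteq> B" "0 < prob A"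
      "\<And>Z \<omega> \<omega>'. Z \<in> \<Z> \<Longrightarrow> \<omega> \<in> A \<Longrightarrow> \<omega>' \<in> A \<Longrightarrow> \<bar>Z \<omega> - Z \<omega>'\<bar> \<le> e / 2" by metis
    from small_oscillationE[OF small_oscillation_singleton[OF measurable[OF Y]] eC A(1,3)]
    obtain A' where A': "A' \<in> events" "A' \<subseteq> A" "0 < prob A'"
      "\<And>\<omega> \<omega>'. \<omega> \<in> A' \<Longrightarrow> \<omega>' \<in> A' \<Longrightarrow> \<bar>Y \<omega> - Y \<omega>'\<bar> \<le> e / (2 * C')" by (metis singletonI)
    have "\<bar>(Z \<omega> - c Z * Y \<omega>) - (Z \<omega>' - c Z * Y \<omega>')\<bar> \<le> e" if Z: "Z \<in> \<Z>" and w: "\<omega> \<in> A'" "\<omega>' \<in> A'" for Z \<omega> \<omega>'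
    proof -
      have "\<bar>c Z\<bar> * \<bar>Y \<omega> - Y \<omega>'\<bar> \<le> C' * (e / (2 * C'))"
        using C' A'(4)[OF w] Z by (intro mult_mono) auto
      also have "\<dots> = e / 2" using C' by simp
      finally have "\<bar>c Z * (Y \<omega> - Y \<omega>')\<bar> \<le> e / 2" by (simp add: abs_mult)
      moreover have "\<bar>Z \<omega> - Z \<omega>'\<bar> \<le> e / 2" using A(4)[OF Z] A'(2) w by auto
      moreover have "(Z \<omega> - c Z * Y \<omega>) - (Z \<omega>' - c Z * Y \<omega>') = (Z \<omega> - Z \<omega>') - c Z * (Y \<omega> - Y \<omega>')"
        by (simp add: algebra_simps)
      ultimately show ?thesis by linarith
    qed
    then show "\<exists>A\<in>events. A \<subseteq> B \<and> 0 < prob A \<and> (\<forall>Z\<in>\<Z>'. \<forall>\<omega>\<in>A. \<forall>\<omega>'\<in>A. \<bar>Z \<omega> - Z \<omega>'\<bar> \<le> e)"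
      using A A' by (intro bexI[of _ A']) (auto simp: \<Z>'_def)
  qed
  moreover have "countable \<Z>'" "\<Z>' \<subseteq> V" using \<Z> res by (auto simp: \<Z>'_def)
  ultimately have "0 < prob {\<omega>\<in>space P. \<forall>Z\<in>\<Z>'. Z \<omega> \<in> {-(\<epsilon>/2)..\<epsilon>/2}}" (is "0 < prob ?A")
    using \<epsilon> by (intro small_ball_positive) auto
  \<comment> \<open>If the copy of \<open>Y\<close> is within \<open>\<eta>\<close> of
    \<open>s\<close>, then its multiple by \<open>c Z\<close> is within
    \<open>\<epsilon> / 2\<close> of \<open>c Z * s = E (Z Y)\<close>, the centre of the required
    interval. The residual uses up the other half.\<close>
  moreover define \<eta> where "\<eta> = \<epsilon> / (2 * C')"
  have \<eta>: "\<eta> > 0" using \<epsilon> C' by (simp add: \<eta>_def)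
  have "0 < prob {\<omega>\<in>space P. Y \<omega> \<in> {s - \<eta>..s + \<eta>}}" (is "0 < prob ?B")
    by (rule centered_gaussian_interval_positive[OF prob_space_axioms gaussian[OF Y] False]) (use \<eta> in simp)
  ultimately have "0 < prob ?A * prob ?B" by simp
  also have "\<dots> = measure (P \<Otimes>\<^sub>M P) (?A \<times> ?B)"
  proof (rule prob_pair_times[OF prob_space_axioms prob_space_axioms, symmetric])
    show "?A \<in> events"
    proof (rule sets.sets_Collect_countable_All'[OF _ \<open>countable \<Z>'\<close>])
      fix Z assume "Z \<in> \<Z>'"
      with \<open>\<Z>' \<subseteq> V\<close> have [measurable]: "Z \<in> borel_measurable P" by (auto intro: measurable)
      show "{\<omega>\<in>space P. Z \<omega> \<in> {-(\<epsilon>/2)..\<epsilon>/2}} \<in> events" by measurable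
    qed
  qed measurable
  also have "\<dots> \<le> measure (P \<Otimes>\<^sub>M P) {p\<in>space (P \<Otimes>\<^sub>M P). \<forall>Z\<in>\<Z>. T Z p \<in> {c Z * s - \<epsilon> .. c Z * s + \<epsilon>}}"
  proof (rule PP.finite_measure_mono)
    show "?A \<times> ?B \<subseteq> {p\<in>space (P \<Otimes>\<^sub>M P). \<forall>Z\<in>\<Z>. T Z p \<in> {c Z * s - \<epsilon> .. c Z * s + \<epsilon>}}"
    proof (intro subsetI CollectI conjI ballI)
      fix p assume p: "p \<in> ?A \<times> ?B"
      then show "p \<in> space (P \<Otimes>\<^sub>M P)" by (auto simp: space_pair_measure)
      fix Z assume Z: "Z \<in> \<Z>"
      have "\<bar>Z (fst p) - c Z * Y (fst p)\<bar> \<le> \<epsilon> / 2"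
      proof -
        have "Z (fst p) - c Z * Y (fst p) \<in> {-(\<epsilon> / 2)..\<epsilon> / 2}" using p Z by (auto simp: \<Z>'_def)
        then show ?thesis unfolding atLeastAtMost_iff by linarith
      qed
      moreover have "\<bar>c Z\<bar> * \<bar>Y (snd p) - s\<bar> \<le> C' * \<eta>"
        using C' Z p by (intro mult_mono) auto
      then have "\<bar>c Z * (Y (snd p) - s)\<bar> \<le> \<epsilon> / 2" using C' by (simp add: \<eta>_def abs_mult)
      moreover have "T Z p = c Z * s + (Z (fst p) - c Z * Y (fst p)) + c Z * (Y (snd p) - s)"
        by (simp add: T_def algebra_simps)
      ultimately show "T Z p \<in> {c Z * s - \<epsilon> .. c Z * s + \<epsilon>}"
        unfolding atLeastAtMost_iff by linarith
    qed
    show "{p\<in>space (P \<Otimes>\<^sub>M P). \<forall>Z\<in>\<Z>. T Z p \<in> {c Z * s - \<epsilon> .. c Z * s + \<epsilon>}} \<in> sets (P \<Otimes>\<^sub>M P)"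
    proof (rule sets.sets_Collect_countable_All'[OF _ \<Z>(1)])
      fix Z assume "Z \<in> \<Z>"
      with \<Z> have [measurable]: "T Z \<in> borel_measurable (P \<Otimes>\<^sub>M P)" by auto
      show "{p\<in>space (P \<Otimes>\<^sub>M P). T Z p \<in> {c Z * s - \<epsilon> .. c Z * s + \<epsilon>}} \<in> sets (P \<Otimes>\<^sub>M P)" by measurable
    qed
  qed
  also have "\<dots> = prob {\<omega>\<in>space P. \<forall>Z\<in>\<Z>. Z \<omega> \<in> {c Z * s - \<epsilon> .. c Z * s + \<epsilon>}}"
    by (rule R.countable_uniqueness[OF \<Z>(1), where Z="\<lambda>Z. Z", symmetric]) (use \<Z> in auto)
  finally have "0 < prob {\<omega>\<in>space P. \<forall>Z\<in>\<Z>. Z \<omega> \<in> {c Z * s - \<epsilon> .. c Z * s + \<epsilon>}}" .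
  moreover have "c Z * s = expectation (\<lambda>\<omega>. Z \<omega> * Y \<omega>)" for Z using s by (simp add: c_def)
  ultimately show ?thesis by simp
qed

end

section \<open>Differentiation under the expectation\<close>

lemma openin_Euclidean_space_slice:
  assumes "openin (Euclidean_space n) S" "x \<in> S" "i < n"
  obtains e where "e > 0" "\<And>t. \<bar>t - x i\<bar> < e \<Longrightarrow> x(i := t) \<in> S"
proof -
  obtain T where T: "open T" "S = T \<inter> {x. \<forall>i\<ge>n. x i = 0}"
    using assms(1) by (auto simp: Euclidean_space_def openin_subtopology euclidean_product_topology)
  have "continuous_on UNIV (\<lambda>t. x(i := t))"
  proof (rule continuous_on_coordinatewise_then_product)
    show "continuous_on UNIV (\<lambda>t. (x(i := t)) j)" for j
      by (cases "j = i") (auto intro: continuous_intros)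
  qed
  then have "open ((\<lambda>t. x(i := t)) -` T)" using T(1) by (simp add: continuous_on_open_vimage)
  moreover have "x i \<in> (\<lambda>t. x(i := t)) -` T" using assms(2) T(2) by simp
  ultimately obtain e where e: "e > 0" "ball (x i) e \<subseteq> (\<lambda>t. x(i := t)) -` T"
    using open_contains_ball by blast
  show ?thesis
  proof (rule that[OF e(1)])
    fix t assume "\<bar>t - x i\<bar> < e"
    then have "t \<in> ball (x i) e" by (simp add: dist_real_def)
    with e(2) have "x(i := t) \<in> T" by auto
    then show "x(i := t) \<in> S" using assms(2,3) T(2) by auto
  qed
qed

text \<open>Increasing a coordinate never leaves the half-space, so a right-hand interval lies in
  the slice even at a boundary point. Uniqueness of the partial derivative and the choice of
  difference quotients rest on this.\<close>

lemma slice_nontrivial: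
  assumes S: "coordinate_domain n S" and x: "x \<in> S" and i: "i < n"
  shows "at (x i) within slice S i x \<noteq> bot"
proof -
  have "\<exists>e>0. \<forall>t. x i < t \<and> t < x i + e \<longrightarrow> x(i := t) \<in> S"
  proof (cases "openin (Euclidean_space n) S")
    case True
    from openin_Euclidean_space_slice[OF True x i] obtain e
      where "e > 0" "\<And>t. \<bar>t - x i\<bar> < e \<Longrightarrow> x(i := t) \<in> S" by metis
    then show ?thesis by (intro exI[of _ e]) auto
  next
    case False
    with S have "openin (half_space n) S" by (simp add: coordinate_domain_def)
    then obtain T where T: "openin (Euclidean_space n) T" "S = T \<inter> {x. 0 \<le> x 0}"
      by (auto simp: half_space_def openin_subtopology)
    with x have "x \<in> T" "0 \<le> x 0" by auto
    from openin_Euclidean_space_slice[OF T(1) this(1) i] obtain e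
      where "e > 0" "\<And>t. \<bar>t - x i\<bar> < e \<Longrightarrow> x(i := t) \<in> T" by metis
    then show ?thesis using T(2) \<open>0 \<le> x 0\<close> by (intro exI[of _ e]) auto
  qed
  then obtain e where e: "e > 0" "\<And>t. x i < t \<Longrightarrow> t < x i + e \<Longrightarrow> t \<in> slice S i x"
    by (auto simp: slice_def)
  have "x i islimpt {x i<..<x i + e}" using e(1) by (intro islimpt_greaterThanLessThan1) simp
  then have "x i islimpt slice S i x" by (rule islimpt_subset) (use e(2) in auto)
  then show ?thesis by (simp add: trivial_limit_within)
qed

lemma has_vector_derivative_componentwiseI:
  fixes f :: "real \<Rightarrow> 'v::euclidean_space"
  assumes "\<And>b. b \<in> Basis \<Longrightarrow> ((\<lambda>t. f t \<bullet> b) has_real_derivative d \<bullet> b) (at t within S)"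
  shows "(f has_vector_derivative d) (at t within S)"
  unfolding has_vector_derivative_def has_derivative_componentwise_within[of f]
  using assms by (auto simp: has_field_derivative_def mult_commute_abs)

context gaussian_space begin

text \<open>The difference quotients \<open>q t\<close> lie in the closure and converge pointwise
  within the slice. Testing the limit along sequences makes the limit theorems for
  \<open>l2_closure\<close> applicable, both for membership and for the pairing with
  \<open>G\<close>.\<close>

lemma l2_closure_partial_deriv:
  fixes F :: "'w \<Rightarrow> (nat \<Rightarrow> real) \<Rightarrow> 'v::euclidean_space"
  assumes S: "coordinate_domain n S" and x: "x \<in> S" and i: "i < n"
    and F: "\<And>x b. x \<in> S \<Longrightarrow> b \<in> Basis \<Longrightarrow> (\<lambda>\<omega>. F \<omega> x \<bullet> b) \<in> l2_closure"
    and diff: "\<And>\<omega>. \<omega> \<in> space P \<Longrightarrow> (\<lambda>t. F \<omega> (x(i := t))) differentiable (at (x i) within slice S i x)"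
    and b: "b \<in> Basis"
  shows "(\<lambda>\<omega>. partial_deriv S i (F \<omega>) x \<bullet> b) \<in> l2_closure" (is ?l2)
    and "G \<in> borel_measurable P \<Longrightarrow> integrable P (\<lambda>\<omega>. (G \<omega>)\<^sup>2) \<Longrightarrow>
      ((\<lambda>t. expectation (\<lambda>\<omega>. (F \<omega> (x(i := t)) \<bullet> b) * G \<omega>)) has_real_derivative
        expectation (\<lambda>\<omega>. (partial_deriv S i (F \<omega>) x \<bullet> b) * G \<omega>)) (at (x i) within slice S i x)"
proof -
  interpret L: gaussian_space P l2_closure by (rule gaussian_space_l2_closure)
  define q where "q t = (\<lambda>\<omega>. inverse (t - x i) * (F \<omega> (x(i := t)) \<bullet> b - F \<omega> x \<bullet> b))" for t
  have q: "q t \<in> l2_closure" if "t \<in> slice S i x" for t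
    unfolding q_def using that x b by (intro L.scale L.diff F) (auto simp: slice_def)
  have lim: "(\<lambda>m. q (s m) \<omega>) \<longlonglongrightarrow> partial_deriv S i (F \<omega>) x \<bullet> b"
    if \<omega>: "\<omega> \<in> space P" and s: "\<And>m. s m \<in> slice S i x - {x i}" "s \<longlonglongrightarrow> x i" for s \<omega>
  proof -
    have "((\<lambda>t. F \<omega> (x(i := t))) has_vector_derivative partial_deriv S i (F \<omega>) x) (at (x i) within slice S i x)"
      using diff[OF \<omega>] unfolding partial_deriv_def by (rule vector_derivative_works[THEN iffD1])
    from bounded_linear.has_vector_derivative[OF bounded_linear_inner_left[of b] this]
    have "((\<lambda>t. F \<omega> (x(i := t)) \<bullet> b) has_real_derivative partial_deriv S i (F \<omega>) x \<bullet> b) (at (x i) within slice S i x)"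
      by (simp add: has_real_derivative_iff_has_vector_derivative)
    then have "((\<lambda>t. q t \<omega>) \<longlongrightarrow> partial_deriv S i (F \<omega>) x \<bullet> b) (at (x i) within slice S i x)"
      by (simp add: has_field_derivative_iff q_def divide_inverse mult.commute)
    then show ?thesis using s unfolding tendsto_at_iff_sequentially o_def by blast
  qed
  show ?l2
  proof -
    have "\<exists>s. (\<forall>m::nat. s m \<in> slice S i x - {x i}) \<and> s \<longlonglongrightarrow> x i"
      using slice_nontrivial[OF S x i] by (simp add: trivial_limit_within islimpt_sequential)
    then obtain s where s: "\<And>m::nat. s m \<in> slice S i x - {x i}" "s \<longlonglongrightarrow> x i" by blast
    show ?thesis
      by (rule l2_closure_limit[of "\<lambda>m. q (s m)"]) (use s in \<open>auto intro!: q lim\<close>)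
  qed
  assume G[measurable]: "G \<in> borel_measurable P" and G2: "integrable P (\<lambda>\<omega>. (G \<omega>)\<^sup>2)"
  have i: "integrable P (\<lambda>\<omega>. F \<omega> y \<bullet> b * G \<omega>)" if "y \<in> S" for y
    by (intro integrable_mult_of_squares G G2 L.measurable L.integrable_square F that b)
  let ?H = "\<lambda>y. expectation (\<lambda>\<omega>. (F \<omega> y \<bullet> b) * G \<omega>)"
  have eq: "expectation (\<lambda>\<omega>. q t \<omega> * G \<omega>) = (?H (x(i := t)) - ?H (x(i := x i))) / (t - x i)" if "t \<in> slice S i x" for t
  proof -
    have "expectation (\<lambda>\<omega>. q t \<omega> * G \<omega>) =
        expectation (\<lambda>\<omega>. inverse (t - x i) * (F \<omega> (x(i := t)) \<bullet> b * G \<omega> - F \<omega> x \<bullet> b * G \<omega>))"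
      by (simp add: q_def left_diff_distrib mult.assoc)
    also have "\<dots> = inverse (t - x i) * (?H (x(i := t)) - ?H x)"
      using i[OF x] i[of "x(i := t)"] that by (simp add: slice_def)
    finally show ?thesis by (simp add: divide_inverse mult.commute)
  qed
  show "((\<lambda>t. expectation (\<lambda>\<omega>. (F \<omega> (x(i := t)) \<bullet> b) * G \<omega>)) has_real_derivative
        expectation (\<lambda>\<omega>. (partial_deriv S i (F \<omega>) x \<bullet> b) * G \<omega>)) (at (x i) within slice S i x)"
    unfolding has_field_derivative_iff tendsto_at_iff_sequentially o_def
  proof (intro allI impI)
    fix s assume s: "\<forall>m. s m \<in> slice S i x - {x i}" "s \<longlonglongrightarrow> x i"
    have "(\<lambda>m. expectation (\<lambda>\<omega>. q (s m) \<omega> * G \<omega>)) \<longlonglongrightarrow> expectation (\<lambda>\<omega>. (partial_deriv S i (F \<omega>) x \<bullet> b) * G \<omega>)"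
      by (rule l2_closure_limit_integral[OF _ _ G G2]) (use s in \<open>auto intro!: q lim\<close>)
    then show "(\<lambda>m. (?H (x(i := s m)) - ?H (x(i := x i))) / (s m - x i))
        \<longlonglongrightarrow> expectation (\<lambda>\<omega>. (partial_deriv S i (F \<omega>) x \<bullet> b) * G \<omega>)"
      using s eq by simp
  qed
qed

section \<open>Iterated derivatives of paths and of expectations in one coordinate domain\<close>

context
  fixes n r S and F :: "'w \<Rightarrow> (nat \<Rightarrow> real) \<Rightarrow> 'v::euclidean_space"
  assumes S: "coordinate_domain n S"
    and F: "\<And>x b. x \<in> S \<Longrightarrow> b \<in> Basis \<Longrightarrow> (\<lambda>\<omega>. F \<omega> x \<bullet> b) \<in> l2_closure"
    and Cr: "\<And>\<omega>. \<omega> \<in> space P \<Longrightarrow> Cr_on n r S (F \<omega>)"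
begin

lemma l2_closure_iterated_partial:
  assumes "set is \<subseteq> {..<n}" "enat (length is) \<le> r" "x \<in> S" "b \<in> Basis"
  shows "(\<lambda>\<omega>. iterated_partial S is (F \<omega>) x \<bullet> b) \<in> l2_closure"
  using assms
proof (induction "is" arbitrary: x b)
  case Nil
  then show ?case by (simp add: F)
next
  case (Cons i "is")
  have l: "enat (length is) < r"
    using Cons.prems(2) by (simp add: Suc_ile_eq)
  show ?case unfolding iterated_partial.simps
  proof (rule l2_closure_partial_deriv(1)[OF S \<open>x \<in> S\<close> _ _ _ \<open>b \<in> Basis\<close>])
    show "i < n" using Cons.prems by simp
    show "(\<lambda>\<omega>. iterated_partial S is (F \<omega>) y \<bullet> b) \<in> l2_closure" if "y \<in> S" "b \<in> Basis" for y b
      using Cons that l by simp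
    show "(\<lambda>t. iterated_partial S is (F \<omega>) (x(i := t))) differentiable (at (x i) within slice S i x)"
      if "\<omega> \<in> space P" for \<omega>
      using Cr[OF that] Cons.prems l unfolding Cr_on_def by simp
  qed
qed

context
  fixes G and h :: "(nat \<Rightarrow> real) \<Rightarrow> 'v"
  assumes G: "G \<in> borel_measurable P" and G2: "integrable P (\<lambda>\<omega>. (G \<omega>)\<^sup>2)"
    and h: "\<And>x b. x \<in> S \<Longrightarrow> b \<in> Basis \<Longrightarrow> h x \<bullet> b = expectation (\<lambda>\<omega>. (F \<omega> x \<bullet> b) * G \<omega>)"
begin

text \<open>The formula at order \<open>is\<close> is an assumption so that the lemma serves twice:
  as the induction step for that formula, and afterwards for the differentiability part of
  \<open>Cr_on\<close>.\<close>

lemma partial_deriv_expectation: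
  assumes "set is \<subseteq> {..<n}" "enat (length is) < r" "x \<in> S" "i < n"
    and IH: "\<And>x b. x \<in> S \<Longrightarrow> b \<in> Basis \<Longrightarrow>
      iterated_partial S is h x \<bullet> b = expectation (\<lambda>\<omega>. (iterated_partial S is (F \<omega>) x \<bullet> b) * G \<omega>)"
  defines "d \<equiv> (\<Sum>b\<in>Basis. expectation (\<lambda>\<omega>. (iterated_partial S (i # is) (F \<omega>) x \<bullet> b) * G \<omega>) *\<^sub>R b)"
  shows "((\<lambda>t. iterated_partial S is h (x(i := t))) has_vector_derivative d) (at (x i) within slice S i x)"
proof (rule has_vector_derivative_componentwiseI)
  fix b :: 'v assume b: "b \<in> Basis"
  have d: "d \<bullet> b = expectation (\<lambda>\<omega>. (iterated_partial S (i # is) (F \<omega>) x \<bullet> b) * G \<omega>)"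
    unfolding d_def using b by simp
  have "((\<lambda>t. expectation (\<lambda>\<omega>. (iterated_partial S is (F \<omega>) (x(i := t)) \<bullet> b) * G \<omega>)) has_real_derivative
        expectation (\<lambda>\<omega>. (partial_deriv S i (iterated_partial S is (F \<omega>)) x \<bullet> b) * G \<omega>)) (at (x i) within slice S i x)"
    by (rule l2_closure_partial_deriv(2)[OF S \<open>x \<in> S\<close> \<open>i < n\<close> _ _ b G G2])
       (use Cr assms in \<open>auto intro!: l2_closure_iterated_partial simp: Cr_on_def less_imp_le\<close>)
  then have "((\<lambda>t. expectation (\<lambda>\<omega>. (iterated_partial S is (F \<omega>) (x(i := t)) \<bullet> b) * G \<omega>)) has_real_derivative
        d \<bullet> b) (at (x i) within slice S i x)" by (simp add: d)
  then show "((\<lambda>t. iterated_partial S is h (x(i := t)) \<bullet> b) has_real_derivative d \<bullet> b) (at (x i) within slice S i x)"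
  \<comment> \<open>The two functions are known to agree on the slice only, which suffices for a
    derivative within it.\<close>
  proof (rule has_field_derivative_transform_within[where d=1])
    show "x i \<in> slice S i x" using \<open>x \<in> S\<close> by (simp add: slice_def)
    show "expectation (\<lambda>\<omega>. (iterated_partial S is (F \<omega>) (x(i := t)) \<bullet> b) * G \<omega>) = iterated_partial S is h (x(i := t)) \<bullet> b"
      if "t \<in> slice S i x" for t
      using that b by (subst IH) (auto simp: slice_def)
  qed simp
qed

lemma iterated_partial_expectation:
  assumes "set is \<subseteq> {..<n}" "enat (length is) \<le> r" "x \<in> S" "b \<in> Basis"
  shows "iterated_partial S is h x \<bullet> b = expectation (\<lambda>\<omega>. (iterated_partial S is (F \<omega>) x \<bullet> b) * G \<omega>)"
  using assms
proof (induction "is" arbitrary: x b)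
  case Nil
  then show ?case by (simp add: h)
next
  case (Cons i "is")
  have l: "enat (length is) < r"
    using Cons.prems(2) by (simp add: Suc_ile_eq)
  have i: "i < n" using Cons.prems by simp
  have "((\<lambda>t. iterated_partial S is h (x(i := t))) has_vector_derivative
      (\<Sum>b\<in>Basis. expectation (\<lambda>\<omega>. (iterated_partial S (i # is) (F \<omega>) x \<bullet> b) * G \<omega>) *\<^sub>R b)) (at (x i) within slice S i x)"
    using Cons.prems l by (intro partial_deriv_expectation Cons.IH) auto
  then have "partial_deriv S i (iterated_partial S is h) x =
      (\<Sum>b\<in>Basis. expectation (\<lambda>\<omega>. (iterated_partial S (i # is) (F \<omega>) x \<bullet> b) * G \<omega>) *\<^sub>R b)"
    unfolding partial_deriv_def
    by (rule vector_derivative_within[OF slice_nontrivial[OF S \<open>x \<in> S\<close> i]])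
  then show ?case using \<open>b \<in> Basis\<close> by simp
qed

text \<open>Continuity, up to the boundary, passes from the paths to the expectation by testing it
  on sequences in \<open>S\<close>.\<close>

lemma Cr_on_expectation: "Cr_on n r S h"
  unfolding Cr_on_def
proof (intro allI impI conjI ballI; elim conjE)
  fix "is" assume is': "set is \<subseteq> {..<n}" "enat (length is) \<le> r"
  show "continuous_on S (iterated_partial S is h)"
    unfolding continuous_on_componentwise[of S "iterated_partial S is h"]
    unfolding continuous_on_sequentially o_def
  proof (intro ballI allI impI; elim conjE)
    fix b :: 'v and y x assume b: "b \<in> Basis" and x: "x \<in> S" "\<forall>m. y m \<in> S" "y \<longlonglongrightarrow> x"
    have "(\<lambda>m. expectation (\<lambda>\<omega>. (iterated_partial S is (F \<omega>) (y m) \<bullet> b) * G \<omega>))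
        \<longlonglongrightarrow> expectation (\<lambda>\<omega>. (iterated_partial S is (F \<omega>) x \<bullet> b) * G \<omega>)"
    proof (rule l2_closure_limit_integral[OF _ _ G G2])
      show "(\<lambda>\<omega>. iterated_partial S is (F \<omega>) (y m) \<bullet> b) \<in> l2_closure" for m
        using x b is' by (intro l2_closure_iterated_partial) auto
      show "(\<lambda>m. iterated_partial S is (F \<omega>) (y m) \<bullet> b) \<longlonglongrightarrow> iterated_partial S is (F \<omega>) x \<bullet> b"
        if "\<omega> \<in> space P" for \<omega>
      proof -
        have "continuous_on S (iterated_partial S is (F \<omega>))"
          using Cr[OF that] is' unfolding Cr_on_def by simp
        then have "(\<lambda>m. iterated_partial S is (F \<omega>) (y m)) \<longlonglongrightarrow> iterated_partial S is (F \<omega>) x"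
          using x unfolding continuous_on_sequentially o_def by blast
        then show ?thesis by (intro tendsto_intros)
      qed
    qed
    then show "(\<lambda>m. iterated_partial S is h (y m) \<bullet> b) \<longlonglongrightarrow> iterated_partial S is h x \<bullet> b"
      using x b is' by (simp add: iterated_partial_expectation)
  qed
next
  fix "is" i x assume "set is \<subseteq> {..<n}" "enat (length is) \<le> r" "enat (length is) < r" "i < n" "x \<in> S"
  then show "(\<lambda>t. iterated_partial S is h (x(i := t))) differentiable (at (x i) within slice S i x)"
    by (intro differentiableI_vector[OF partial_deriv_expectation] iterated_partial_expectation)
qed

end

end

end

section \<open>Neighbourhoods in the weak Whitney topology\<close>

lemma chart_on_compact_image:
  assumes c: "chart_on n M c" and K: "compactin M K" "K \<subseteq> fst c"
  shows "compact (snd c ` K)" "snd c ` K \<subseteq> chart_image c"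
proof -
  obtain U \<phi> where c_eq: "c = (U, \<phi>)" by (cases c)
  have hom: "homeomorphic_map (subtopology M U) (subtopology (Euclidean_space n) (\<phi> ` U)) \<phi>"
    using c by (simp add: c_eq chart_on_def)
  have "compactin (subtopology M U) K" using K by (simp add: c_eq compactin_subtopology)
  then have "compactin (subtopology (Euclidean_space n) (\<phi> ` U)) (\<phi> ` K)"
    using homeomorphic_imp_continuous_map[OF hom] by (rule image_compactin)
  then show "compact (snd c ` K)"
    by (simp add: c_eq compactin_subtopology Euclidean_space_def euclidean_product_topology)
  show "snd c ` K \<subseteq> chart_image c" using K by (auto simp: chart_image_def)
qed

lemma chart_on_inv_into:
  assumes "chart_on n M c" "x \<in> chart_image c"
  shows "inv_into (fst c) (snd c) x \<in> topspace M"
proof -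
  have "inv_into (fst c) (snd c) x \<in> fst c"
    using assms(2) unfolding chart_image_def by (rule inv_into_into)
  moreover have "fst c \<subseteq> topspace M"
    using assms(1) by (cases c) (simp add: chart_on_def openin_subset)
  ultimately show ?thesis by blast
qed

lemma chart_on_coordinate_domain: "chart_on n M c \<Longrightarrow> coordinate_domain n (chart_image c)"
  by (auto simp: chart_on_def chart_image_def split: prod.splits)

text \<open>In contrast to \<open>whitney_nbhd\<close>, a triple \<open>(c, K, is)\<close> controls a single derivative, so that all
  seminorms of a neighbourhood are indexed by one finite set.\<close>

definition deriv_controls :: "nat \<Rightarrow> 'm topology \<Rightarrow> 'm chart set \<Rightarrow> enat \<Rightarrow> ('m chart \<times> 'm set \<times> nat list) set" where
  "deriv_controls n M \<A> r = {(c, K, is). c \<in> \<A> \<and> compactin M K \<and> K \<subseteq> fst c \<and> set is \<subseteq> {..<n} \<and> enat (length is) \<le> r}"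

abbreviation chart_deriv :: "'m chart \<Rightarrow> nat list \<Rightarrow> ('m \<Rightarrow> 'b::real_normed_vector) \<Rightarrow> (nat \<Rightarrow> real) \<Rightarrow> 'b" where
  "chart_deriv c is f \<equiv> iterated_partial (chart_image c) is (local_rep c f)"

definition deriv_ball ::
  "nat \<Rightarrow> 'm topology \<Rightarrow> 'm chart set \<Rightarrow> enat \<Rightarrow> ('m chart \<times> 'm set \<times> nat list) set \<Rightarrow> real \<Rightarrow>
    ('m \<Rightarrow> 'b::real_normed_vector) \<Rightarrow> ('m \<Rightarrow> 'b) set" where
  "deriv_ball n M \<A> r B \<epsilon> f = {g \<in> Cr_functions n M \<A> r.
     \<forall>(c, K, is)\<in>B. \<forall>x\<in>snd c ` K. norm (chart_deriv c is g x - chart_deriv c is f x) < \<epsilon>}"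

lemma deriv_ball_mono:
  assumes "B \<subseteq> B'" "\<epsilon>' \<le> \<epsilon>" shows "deriv_ball n M \<A> r B' \<epsilon>' f \<subseteq> deriv_ball n M \<A> r B \<epsilon> f"
  using assms by (fastforce simp: deriv_ball_def)

lemma continuous_on_chart_deriv:
  assumes "f \<in> Cr_functions n M \<A> r" "c \<in> \<A>" "set is \<subseteq> {..<n}" "enat (length is) \<le> r"
  shows "continuous_on (chart_image c) (chart_deriv c is f)"
  using assms by (simp add: Cr_functions_def Cr_on_def)

text \<open>The norm attains its maximum on a nonempty compact set, so a strict bound leaves a
  uniform gap.\<close>

lemma compact_norm_less_gap:
  fixes u :: "'s::topological_space \<Rightarrow> 'b::real_normed_vector"
  assumes "compact T" "continuous_on T u" "\<And>x. x \<in> T \<Longrightarrow> norm (u x) < e"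
  shows "\<exists>\<epsilon>>0. \<forall>x\<in>T. norm (u x) \<le> e - \<epsilon>"
proof (cases "T = {}")
  case True
  then show ?thesis by (auto intro: exI[of _ 1])
next
  case False
  obtain z where z: "z \<in> T" "\<And>x. x \<in> T \<Longrightarrow> norm (u x) \<le> norm (u z)"
    using continuous_attains_sup[OF assms(1) False continuous_on_norm[OF assms(2)]] by blast
  then show ?thesis using assms(3)[OF z(1)] by (intro exI[of _ "e - norm (u z)"]) auto
qed

context
  fixes n :: nat and M :: "'m topology" and \<A> :: "'m chart set" and r :: enat
  assumes charts: "\<And>c. c \<in> \<A> \<Longrightarrow> chart_on n M c"
begin

text \<open>This changes the centre from \<open>f0\<close> to \<open>f\<close>: compactness gives a
  gap for each multi-index, and the triangle inequality spends it.\<close>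

lemma deriv_ball_subset_whitney_nbhd:
  fixes f :: "'m \<Rightarrow> 'b::real_normed_vector"
  assumes c: "c \<in> \<A>" and K: "compactin M K" "K \<subseteq> fst c" and s: "enat s \<le> r" and f0: "f0 \<in> Cr_functions n M \<A> r"
    and f: "f \<in> whitney_nbhd n M \<A> r f0 c K s e"
  shows "\<exists>B \<epsilon>. finite B \<and> B \<subseteq> deriv_controls n M \<A> r \<and> 0 < \<epsilon> \<and> deriv_ball n M \<A> r B \<epsilon> f \<subseteq> whitney_nbhd n M \<A> r f0 c K s e"
proof -
  define I where "I = {is. set is \<subseteq> {..<n} \<and> length is \<le> s}"
  have I: "finite I" "I \<noteq> {}" unfolding I_def by (rule finite_lists_length_le) (auto intro: exI[of _ "[]"])
  have fC: "f \<in> Cr_functions n M \<A> r" using f by (simp add: whitney_nbhd_def)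
  have Ir: "set is \<subseteq> {..<n}" "enat (length is) \<le> r" if "is \<in> I" for "is"
    using that s by (auto simp: I_def intro: order_trans[of _ "enat s"])
  have "\<exists>\<epsilon>>0. \<forall>x\<in>snd c ` K. norm (chart_deriv c is f x - chart_deriv c is f0 x) \<le> e - \<epsilon>" if "is \<in> I" for "is"
  proof (rule compact_norm_less_gap)
    note ck = chart_on_compact_image[OF charts[OF c] K]
    show "compact (snd c ` K)" by (rule ck)
    show "continuous_on (snd c ` K) (\<lambda>x. chart_deriv c is f x - chart_deriv c is f0 x)"
      using continuous_on_chart_deriv[OF fC c Ir[OF that]] continuous_on_chart_deriv[OF f0 c Ir[OF that]]
      by (intro continuous_on_diff) (erule continuous_on_subset[OF _ ck(2)])+
    show "norm (chart_deriv c is f x - chart_deriv c is f0 x) < e" if "x \<in> snd c ` K" for x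
      using f that \<open>is \<in> I\<close> by (auto simp: whitney_nbhd_def I_def)
  qed
  then obtain \<delta> where \<delta>: "\<And>is. is \<in> I \<Longrightarrow> \<delta> is > 0"
    "\<And>is x. is \<in> I \<Longrightarrow> x \<in> snd c ` K \<Longrightarrow> norm (chart_deriv c is f x - chart_deriv c is f0 x) \<le> e - \<delta> is" by metis
  \<comment> \<open>There are finitely many multi-indices of length at most \<open>s\<close>, and
    the empty one is always among them, so the minimum exists and is positive.\<close>
  define \<epsilon> where "\<epsilon> = Min (\<delta> ` I)"
  have "\<epsilon> > 0" using I \<delta>(1) by (simp add: \<epsilon>_def)
  moreover have "deriv_ball n M \<A> r ((\<lambda>is. (c, K, is)) ` I) \<epsilon> f \<subseteq> whitney_nbhd n M \<A> r f0 c K s e"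
  proof
    fix g assume g: "g \<in> deriv_ball n M \<A> r ((\<lambda>is. (c, K, is)) ` I) \<epsilon> f"
    have "norm (chart_deriv c is g x - chart_deriv c is f0 x) < e" if "is \<in> I" "x \<in> snd c ` K" for "is" x
    proof -
      have "norm (chart_deriv c is g x - chart_deriv c is f x) < \<epsilon>" using g that by (auto simp: deriv_ball_def)
      also have "\<epsilon> \<le> \<delta> is" unfolding \<epsilon>_def using I that by simp
      finally have "norm (chart_deriv c is g x - chart_deriv c is f x) < \<delta> is" .
      moreover have "norm (chart_deriv c is g x - chart_deriv c is f0 x) \<le>
        norm (chart_deriv c is g x - chart_deriv c is f x) + norm (chart_deriv c is f x - chart_deriv c is f0 x)"
        using norm_triangle_ineq[of "chart_deriv c is g x - chart_deriv c is f x" "chart_deriv c is f x - chart_deriv c is f0 x"] by simp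
      ultimately show ?thesis using \<delta>(2)[OF that] by linarith
    qed
    then show "g \<in> whitney_nbhd n M \<A> r f0 c K s e"
      using g by (auto simp: whitney_nbhd_def deriv_ball_def I_def)
  qed
  moreover have "(\<lambda>is. (c, K, is)) ` I \<subseteq> deriv_controls n M \<A> r"
    using c K Ir by (auto simp: deriv_controls_def)
  ultimately show ?thesis using I(1) by blast
qed

lemma weak_whitney_deriv_ball:
  fixes f :: "'m \<Rightarrow> 'b::real_normed_vector"
  assumes "openin (weak_whitney n M \<A> r) U" "f \<in> U"
  obtains B \<epsilon> where "finite B" "B \<subseteq> deriv_controls n M \<A> r" "0 < \<epsilon>" "deriv_ball n M \<A> r B \<epsilon> f \<subseteq> U"
proof -
  have "\<exists>B \<epsilon>. finite B \<and> B \<subseteq> deriv_controls n M \<A> r \<and> 0 < \<epsilon> \<and> deriv_ball n M \<A> r B \<epsilon> f \<subseteq> U"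
    using assms unfolding weak_whitney_def openin_topology_generated_by_iff
  proof (induction rule: generate_topology_on.induct)
    case Empty
    then show ?case by simp
  next
    case (Int a b)
    then obtain B \<epsilon> B' \<epsilon>' where B: "finite B" "B \<subseteq> deriv_controls n M \<A> r" "0 < \<epsilon>" "deriv_ball n M \<A> r B \<epsilon> f \<subseteq> a"
      "finite B'" "B' \<subseteq> deriv_controls n M \<A> r" "0 < \<epsilon>'" "deriv_ball n M \<A> r B' \<epsilon>' f \<subseteq> b" by auto
    then have "deriv_ball n M \<A> r (B \<union> B') (min \<epsilon> \<epsilon>') f \<subseteq> a \<inter> b"
      using deriv_ball_mono[of B "B \<union> B'" "min \<epsilon> \<epsilon>'" \<epsilon> n M \<A> r f]
        deriv_ball_mono[of B' "B \<union> B'" "min \<epsilon> \<epsilon>'" \<epsilon>' n M \<A> r f] by auto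
    with B show ?case by (intro exI[of _ "B \<union> B'"] exI[of _ "min \<epsilon> \<epsilon>'"]) auto
  next
    case (UN k)
    then obtain a where "a \<in> k" "f \<in> a" by blast
    with UN.IH[OF this] show ?case by (meson Union_upper order_trans)
  next
    case (Basis s)
    then consider "s = Cr_functions n M \<A> r"
      | f0 c K k \<epsilon> where "s = whitney_nbhd n M \<A> r f0 c K k \<epsilon>" "f0 \<in> Cr_functions n M \<A> r" "c \<in> \<A>"
          "compactin M K" "K \<subseteq> fst c" "enat k \<le> r" by blast
    then show ?case
    proof cases
      \<comment> \<open>The whole space as a generator imposes no control at all, so any positive
        radius serves.\<close>
      case 1
      then show ?thesis by (intro exI[of _ "{}"] exI[of _ 1]) (auto simp: deriv_ball_def)
    next
      case 2
      then have "f \<in> whitney_nbhd n M \<A> r f0 c K k \<epsilon>" using Basis.prems by simp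
      from deriv_ball_subset_whitney_nbhd[OF 2(3,4,5,6,2) this] show ?thesis unfolding 2(1) .
    qed
  qed
  then show ?thesis by (elim exE conjE) (rule that)
qed

end

text \<open>For each control a basic neighbourhood of order \<open>length is\<close> is intersected;
  it bounds all derivatives up to that order, in particular the one along \<open>is\<close>.\<close>

lemma deriv_ball_neighbourhood:
  fixes f :: "'m \<Rightarrow> 'b::real_normed_vector"
  assumes B: "finite B" "B \<subseteq> deriv_controls n M \<A> r" and \<epsilon>: "0 < \<epsilon>" and f: "f \<in> Cr_functions n M \<A> r"
  shows "\<exists>U. openin (weak_whitney n M \<A> r) U \<and> f \<in> U \<and> U \<subseteq> deriv_ball n M \<A> r B \<epsilon> f"
  using B
proof (induction B rule: finite_induct)
  case empty
  show ?case
    using f openin_topspace[of "weak_whitney n M \<A> r :: ('m \<Rightarrow> 'b) topology"]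
    by (intro exI[of _ "Cr_functions n M \<A> r"]) (auto simp: topspace_weak_whitney deriv_ball_def)
next
  case (insert t B)
  then obtain U where U: "openin (weak_whitney n M \<A> r) U" "f \<in> U" "U \<subseteq> deriv_ball n M \<A> r B \<epsilon> f" by auto
  obtain c K "is" where t: "t = (c, K, is)" by (cases t)
  let ?N = "whitney_nbhd n M \<A> r f c K (length is) \<epsilon>"
  have tt: "c \<in> \<A>" "compactin M K" "K \<subseteq> fst c" "set is \<subseteq> {..<n}" "enat (length is) \<le> r"
    using insert.prems by (auto simp: t deriv_controls_def)
  have "openin (weak_whitney n M \<A> r) ?N"
    unfolding weak_whitney_def by (rule topology_generated_by_Basis) (use tt f \<epsilon> in blast)
  moreover have "f \<in> ?N" using f \<epsilon> by (simp add: whitney_nbhd_def)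
  moreover have "U \<inter> ?N \<subseteq> deriv_ball n M \<A> r (insert t B) \<epsilon> f"
  proof
    fix g assume g: "g \<in> U \<inter> ?N"
    then have "g \<in> deriv_ball n M \<A> r B \<epsilon> f" using U(3) by blast
    moreover have "\<forall>x\<in>snd c ` K. norm (chart_deriv c is g x - chart_deriv c is f x) < \<epsilon>"
      using g tt(4) by (auto simp: whitney_nbhd_def)
    ultimately show "g \<in> deriv_ball n M \<A> r (insert t B) \<epsilon> f" by (simp add: deriv_ball_def t)
  qed
  ultimately show ?case using U by (intro exI[of _ "U \<inter> ?N"]) (auto intro: openin_Int)
qed

section \<open>The support of a Gaussian field\<close>

text \<open>The factor 2 turns non-strict bounds, which survive integration and passage to the
  closure, into a strict one.\<close>

lemma norm_less_componentwise:
  fixes v :: "'v::euclidean_space"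
  assumes "\<And>b. b \<in> Basis \<Longrightarrow> \<bar>v \<bullet> b\<bar> \<le> \<epsilon> / (2 * real DIM('v))" "\<epsilon> > 0"
  shows "norm v < \<epsilon>"
proof -
  have "norm v \<le> (\<Sum>b\<in>Basis. \<bar>v \<bullet> b\<bar>)" by (rule norm_le_l1)
  also have "\<dots> \<le> (\<Sum>b\<in>(Basis :: 'v set). \<epsilon> / (2 * real DIM('v)))" by (intro sum_mono assms)
  also have "\<dots> = \<epsilon> / 2" by simp
  finally show ?thesis using assms(2) by simp
qed

locale gaussian_field =
  fixes P :: "'w measure" and n :: nat and M :: "'m topology" and \<A> :: "'m chart set"
    and r :: enat and X :: "'w \<Rightarrow> 'm \<Rightarrow> real^'k"
  assumes manifold: "smooth_manifold n M \<A>"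
    and field: "gaussian_random_field P n M \<A> r X"
begin

text \<open>The space called \<open>G\<close> in the overview. In the formal text \<open>G\<close>
  is a square integrable variable paired with the field.\<close>

definition linear_space :: "('w \<Rightarrow> real) set" where
  "linear_space = {(\<lambda>\<omega>. \<Sum>p\<in>F. a p \<bullet> X \<omega> p) | F a. finite F \<and> F \<subseteq> topspace M}"

lemma linear_spaceI: "finite F \<Longrightarrow> F \<subseteq> topspace M \<Longrightarrow> (\<lambda>\<omega>. \<Sum>p\<in>F. a p \<bullet> X \<omega> p) \<in> linear_space"
  unfolding linear_space_def by blast

sublocale gaussian_space P linear_space
proof -
  have P: "prob_space P" using field by (simp add: gaussian_random_field_def)
  show "gaussian_space P linear_space"
    unfolding gaussian_space_def gaussian_space_axioms_def
  proof (intro conjI P allI impI)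
    fix W assume "W \<in> linear_space"
    then obtain F a where F: "finite F" "F \<subseteq> topspace M" "W = (\<lambda>\<omega>. \<Sum>p\<in>F. a p \<bullet> X \<omega> p)"
      by (auto simp: linear_space_def)
    then show "centered_gaussian P W"
      using field by (auto simp: gaussian_random_field_def centered_gaussian_vector_def)
    show "(\<lambda>\<omega>. c * W \<omega>) \<in> linear_space" for c
      using linear_spaceI[OF F(1,2), of "\<lambda>p. c *\<^sub>R a p"] by (simp add: F(3) sum_distrib_left)
    fix W' assume "W' \<in> linear_space"
    then obtain F' a' where F': "finite F'" "F' \<subseteq> topspace M" "W' = (\<lambda>\<omega>. \<Sum>p\<in>F'. a' p \<bullet> X \<omega> p)"
      by (auto simp: linear_space_def)
    \<comment> \<open>Coefficients are extended by 0, so that both sums run over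
      \<open>F \<union> F'\<close>.\<close>
    define u where "u p = (if p \<in> F then a p else 0)" for p
    define u' where "u' p = (if p \<in> F' then a' p else 0)" for p
    have "W = (\<lambda>\<omega>. \<Sum>p\<in>F \<union> F'. u p \<bullet> X \<omega> p)"
      unfolding F(3) by (rule ext, rule sum.mono_neutral_cong_left) (use F(1) F'(1) in \<open>auto simp: u_def\<close>)
    moreover have "W' = (\<lambda>\<omega>. \<Sum>p\<in>F \<union> F'. u' p \<bullet> X \<omega> p)"
      unfolding F'(3) by (rule ext, rule sum.mono_neutral_cong_left) (use F(1) F'(1) in \<open>auto simp: u'_def\<close>)
    ultimately have "(\<lambda>\<omega>. W \<omega> + W' \<omega>) = (\<lambda>\<omega>. \<Sum>p\<in>F \<union> F'. (u p + u' p) \<bullet> X \<omega> p)"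
      by (simp add: inner_add_left sum.distrib)
    then show "(\<lambda>\<omega>. W \<omega> + W' \<omega>) \<in> linear_space"
      using linear_spaceI[of "F \<union> F'" "\<lambda>p. u p + u' p"] F F' by simp
  next
    show "(\<lambda>_. 0) \<in> linear_space" using linear_spaceI[of "{}"] by simp
  qed
qed

lemma charts: "c \<in> \<A> \<Longrightarrow> chart_on n M c"
  using manifold by (simp add: smooth_manifold_def)

lemma X_measurable: "X \<in> measurable P (borel_of_topology (weak_whitney n M \<A> r))"
  using field by (simp add: gaussian_random_field_def)

text \<open>A measurable map sends every outcome into the target space. The paths are therefore
  smooth surely, and later pointwise limits involve no exceptional null sets.\<close>

lemma X_Cr: "\<omega> \<in> space P \<Longrightarrow> X \<omega> \<in> Cr_functions n M \<A> r"
  using measurable_space[OF X_measurable]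
  by (simp add: borel_of_topology_def space_measure_of_conv topspace_weak_whitney)

lemma X_event:
  assumes "openin (weak_whitney n M \<A> r) U" shows "{\<omega>\<in>space P. X \<omega> \<in> U} \<in> events"
proof -
  let ?T = "weak_whitney n M \<A> r :: ('m \<Rightarrow> real^'k) topology"
  have "sets (borel_of_topology ?T) = sigma_sets (topspace ?T) {U. openin ?T U}"
    unfolding borel_of_topology_def by (rule sets_measure_of) (auto dest: openin_subset)
  then have "U \<in> sets (borel_of_topology ?T)" using assms by auto
  from measurable_sets[OF X_measurable this] show ?thesis
    by (simp add: vimage_def Int_def conj_commute)
qed

lemma X_outside: "\<omega> \<in> space P \<Longrightarrow> q \<notin> topspace M \<Longrightarrow> X \<omega> q = 0"
  using X_Cr by (auto simp: Cr_functions_def)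

lemma X_inner: "q \<in> topspace M \<Longrightarrow> (\<lambda>\<omega>. X \<omega> q \<bullet> b) \<in> linear_space"
  using linear_spaceI[of "{q}" "\<lambda>_. b"] by (simp add: inner_commute)

text \<open>The function \<open>h\<^sub>Y\<close> of the overview, written over \<open>Basis\<close>
  because all later estimates are componentwise.\<close>

definition cov_rep :: "('w \<Rightarrow> real) \<Rightarrow> 'm \<Rightarrow> real^'k" where
  "cov_rep Y q = (\<Sum>b\<in>Basis. expectation (\<lambda>\<omega>. (X \<omega> q \<bullet> b) * Y \<omega>) *\<^sub>R b)"

lemma cov_rep_inner: "b \<in> Basis \<Longrightarrow> cov_rep Y q \<bullet> b = expectation (\<lambda>\<omega>. (X \<omega> q \<bullet> b) * Y \<omega>)"
  by (simp add: cov_rep_def)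

lemma cov_fun_eq_cov_rep: "cov_fun P X p j = cov_rep (\<lambda>\<omega>. X \<omega> p $ j)"
proof
  fix q
  have "cov_fun P X p j q $ i = cov_rep (\<lambda>\<omega>. X \<omega> p $ j) q $ i" for i
  proof -
    have "cov_rep (\<lambda>\<omega>. X \<omega> p $ j) q $ i = cov_rep (\<lambda>\<omega>. X \<omega> p $ j) q \<bullet> axis i 1"
      by (simp add: inner_axis)
    also have "\<dots> = expectation (\<lambda>\<omega>. X \<omega> q $ i * X \<omega> p $ j)"
      by (subst cov_rep_inner) (simp_all add: axis_in_Basis_iff inner_axis)
    finally show ?thesis by (simp add: cov_fun_def covariance_def)
  qed
  then show "cov_fun P X p j q = cov_rep (\<lambda>\<omega>. X \<omega> p $ j) q" by (simp add: vec_eq_iff)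
qed

lemma X_component: "p \<in> topspace M \<Longrightarrow> (\<lambda>\<omega>. X \<omega> p $ j) \<in> linear_space"
  using X_inner[of p "axis j 1"] by (simp add: inner_axis)

lemma integrable_X_inner:
  assumes "Y \<in> linear_space" shows "integrable P (\<lambda>\<omega>. (X \<omega> q \<bullet> b) * Y \<omega>)"
proof (cases "q \<in> topspace M")
  case True
  then show ?thesis
    by (intro integrable_mult_of_squares measurable integrable_square X_inner assms)
next
  case False
  then have "integrable P (\<lambda>\<omega>. (X \<omega> q \<bullet> b) * Y \<omega>) \<longleftrightarrow> integrable P (\<lambda>\<omega>. 0 :: real)"
    by (intro Bochner_Integration.integrable_cong refl) (simp add: X_outside)
  then show ?thesis by simp
qed

lemma cov_rep_sum:
  assumes "\<And>i. i \<in> I \<Longrightarrow> Y i \<in> linear_space"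
  shows "cov_rep (\<lambda>\<omega>. \<Sum>i\<in>I. c i * Y i \<omega>) q = (\<Sum>i\<in>I. c i *\<^sub>R cov_rep (Y i) q)"
proof (rule euclidean_eqI)
  fix b :: "real^'k" assume b: "b \<in> Basis"
  have "cov_rep (\<lambda>\<omega>. \<Sum>i\<in>I. c i * Y i \<omega>) q \<bullet> b = expectation (\<lambda>\<omega>. \<Sum>i\<in>I. c i * ((X \<omega> q \<bullet> b) * Y i \<omega>))"
    using b by (simp add: cov_rep_inner sum_distrib_left mult.left_commute)
  also have "\<dots> = (\<Sum>i\<in>I. c i * expectation (\<lambda>\<omega>. (X \<omega> q \<bullet> b) * Y i \<omega>))"
    using integrable_X_inner[OF assms] by (subst Bochner_Integration.integral_sum) auto
  finally show "cov_rep (\<lambda>\<omega>. \<Sum>i\<in>I. c i * Y i \<omega>) q \<bullet> b = (\<Sum>i\<in>I. c i *\<^sub>R cov_rep (Y i) q) \<bullet> b"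
    using b by (simp add: inner_sum_left cov_rep_inner)
qed

text \<open>\<open>cov_rep\<close> is linear in \<open>Y\<close> and sends the component
  \<open>X p $ j\<close> to the corresponding covariance function; these components span
  \<open>linear_space\<close>.\<close>

lemma span_cov_fun: "fun_span {cov_fun P X p j | p j. p \<in> topspace M} = cov_rep ` linear_space"
proof -
  interpret F: module "\<lambda>(c::real) (f::'m \<Rightarrow> real^'k) q. c *\<^sub>R f q" by (rule module_fun)
  let ?S = "{cov_fun P X p j | p j. p \<in> topspace M}"
  have "F.span ?S \<subseteq> cov_rep ` linear_space"
  proof (rule F.span_minimal)
    show "?S \<subseteq> cov_rep ` linear_space" by (auto simp: cov_fun_eq_cov_rep intro: X_component)
    show "F.subspace (cov_rep ` linear_space)"
    proof (rule F.subspaceI)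
      have "cov_rep (\<lambda>_. 0) = 0" by (simp add: cov_rep_def fun_eq_iff)
      then show "0 \<in> cov_rep ` linear_space" using zero by (metis imageI)
    next
      fix x y assume "x \<in> cov_rep ` linear_space" "y \<in> cov_rep ` linear_space"
      then obtain Y Y' where Y: "Y \<in> linear_space" "Y' \<in> linear_space" and xy: "x = cov_rep Y" "y = cov_rep Y'" by auto
      \<comment> \<open>Additivity is \<open>cov_rep_sum\<close> over the two-element index type
        \<open>bool\<close>; homogeneity below uses a one-element index set.\<close>
      have "cov_rep (\<lambda>\<omega>. Y \<omega> + Y' \<omega>) = x + y"
        using cov_rep_sum[of UNIV "\<lambda>b. if b then Y else Y'" "\<lambda>_. 1"] Y
        by (simp add: xy fun_eq_iff UNIV_bool add.commute)
      then show "x + y \<in> cov_rep ` linear_space" using add[OF Y] by (metis imageI)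
    next
      fix c x assume "x \<in> cov_rep ` linear_space"
      then obtain Y where Y: "Y \<in> linear_space" and x: "x = cov_rep Y" by auto
      have "cov_rep (\<lambda>\<omega>. c * Y \<omega>) = (\<lambda>q. c *\<^sub>R x q)"
        using cov_rep_sum[of "{()}" "\<lambda>_. Y" "\<lambda>_. c"] Y by (simp add: x fun_eq_iff)
      then show "(\<lambda>q. c *\<^sub>R x q) \<in> cov_rep ` linear_space" using scale[OF Y] by (metis imageI)
    qed
  qed
  moreover have "cov_rep Y \<in> F.span ?S" if "Y \<in> linear_space" for Y
  proof -
    from that obtain F a where F: "finite F" "F \<subseteq> topspace M" "Y = (\<lambda>\<omega>. \<Sum>p\<in>F. a p \<bullet> X \<omega> p)"
      by (auto simp: linear_space_def)
    have Y: "Y = (\<lambda>\<omega>. \<Sum>(p, j)\<in>F \<times> UNIV. a p $ j * X \<omega> p $ j)"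
      by (simp add: F(3) inner_vec_def sum.cartesian_product)
    have span: "(\<lambda>q. \<Sum>i\<in>I. c i *\<^sub>R f i q) \<in> F.span ?S"
      if "finite I" "\<And>i. i \<in> I \<Longrightarrow> f i \<in> ?S" for I :: "('m \<times> 'k) set" and c f
      using that
    proof (induction I rule: finite_induct)
      case empty
      then show ?case using F.span_zero[of ?S] by (simp add: zero_fun_def)
    next
      case (insert i I)
      have "(\<lambda>q. c i *\<^sub>R f i q) + (\<lambda>q. \<Sum>i\<in>I. c i *\<^sub>R f i q) \<in> F.span ?S"
        using insert.prems by (intro F.span_add insert.IH F.span_scale F.span_base) auto
      then show ?case using insert.hyps by (simp add: plus_fun_def)
    qed
    have "cov_rep Y = (\<lambda>q. \<Sum>i\<in>F \<times> UNIV. (a (fst i) $ snd i) *\<^sub>R cov_fun P X (fst i) (snd i) q)"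
      unfolding Y cov_fun_eq_cov_rep split_beta
      by (rule ext, rule cov_rep_sum) (use F(2) in \<open>auto intro!: X_component\<close>)
    also have "\<dots> \<in> F.span ?S"
    proof (rule span)
      fix i :: "'m \<times> 'k" assume "i \<in> F \<times> UNIV"
      then have "fst i \<in> topspace M" using F(2) by auto
      then show "cov_fun P X (fst i) (snd i) \<in> ?S" by blast
    qed (use F(1) in simp)
    finally show ?thesis .
  qed
  ultimately show ?thesis unfolding fun_span_def by blast
qed

section \<open>The field and its covariance functions read in one chart\<close>

context
  fixes c assumes c: "c \<in> \<A>"
begin

lemma
  assumes "\<omega> \<in> space P"
  shows X_Cr_on: "Cr_on n r (chart_image c) (local_rep c (X \<omega>))"
  using X_Cr[OF assms] c by (simp add: Cr_functions_def)

lemma local_rep_l2_closure: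
  assumes "x \<in> chart_image c" shows "(\<lambda>\<omega>. local_rep c (X \<omega>) x \<bullet> b) \<in> l2_closure"
  using X_inner[OF chart_on_inv_into[OF charts[OF c] assms]] subset_l2_closure
  by (auto simp: local_rep_def)

lemmas chart_deriv_l2_closure =
  l2_closure_iterated_partial[OF chart_on_coordinate_domain[OF charts[OF c]] local_rep_l2_closure X_Cr_on]

context
  fixes Y assumes Y: "Y \<in> linear_space"
begin

lemma local_rep_cov_rep:
  "b \<in> Basis \<Longrightarrow> local_rep c (cov_rep Y) x \<bullet> b = expectation (\<lambda>\<omega>. (local_rep c (X \<omega>) x \<bullet> b) * Y \<omega>)"
  by (simp add: local_rep_def cov_rep_inner)

lemma chart_deriv_cov_rep:
  assumes "set is \<subseteq> {..<n}" "enat (length is) \<le> r" "x \<in> chart_image c" "b \<in> Basis"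
  shows "chart_deriv c is (cov_rep Y) x \<bullet> b = expectation (\<lambda>\<omega>. (chart_deriv c is (X \<omega>) x \<bullet> b) * Y \<omega>)"
  by (rule iterated_partial_expectation[OF chart_on_coordinate_domain[OF charts[OF c]] local_rep_l2_closure X_Cr_on
        measurable[OF Y] integrable_square[OF Y] local_rep_cov_rep]) (use assms in auto)

lemma Cr_on_cov_rep: "Cr_on n r (chart_image c) (local_rep c (cov_rep Y))"
  by (rule Cr_on_expectation[OF chart_on_coordinate_domain[OF charts[OF c]] local_rep_l2_closure X_Cr_on
        measurable[OF Y] integrable_square[OF Y] local_rep_cov_rep]) auto

end

end

lemma cov_rep_Cr: "Y \<in> linear_space \<Longrightarrow> cov_rep Y \<in> Cr_functions n M \<A> r"
  using Cr_on_cov_rep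
  by (auto simp: Cr_functions_def cov_rep_def X_outside cong: Bochner_Integration.integral_cong)

section \<open>The two inclusions\<close>

lemma controls_bounded:
  assumes B: "finite B" "B \<subseteq> deriv_controls n M \<A> r"
  obtains C where "C > 0" "\<And>c K is x b. (c, K, is) \<in> B \<Longrightarrow> x \<in> snd c ` K \<Longrightarrow> b \<in> Basis \<Longrightarrow>
    sqrt (expectation (\<lambda>\<omega>. (chart_deriv c is (X \<omega>) x \<bullet> b)\<^sup>2)) \<le> C"
proof -
  have "\<exists>C. \<forall>x\<in>snd c ` K. sqrt (expectation (\<lambda>\<omega>. (chart_deriv c is (X \<omega>) x \<bullet> b)\<^sup>2)) \<le> C"
    if "(c, K, is) \<in> B" "b \<in> Basis" for c K "is" b
  proof (rule compact_second_moment_bounded)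
    have t: "c \<in> \<A>" "compactin M K" "K \<subseteq> fst c" "set is \<subseteq> {..<n}" "enat (length is) \<le> r"
      using that B(2) by (auto simp: deriv_controls_def)
    note K = chart_on_compact_image[OF charts[OF t(1)] t(2,3)]
    show "compact (snd c ` K)" by (rule K)
    show "(\<lambda>\<omega>. chart_deriv c is (X \<omega>) x \<bullet> b) \<in> l2_closure" if "x \<in> snd c ` K" for x
      using chart_deriv_l2_closure[OF t(1)] t that K \<open>b \<in> Basis\<close> by blast
    show "continuous_on (snd c ` K) (\<lambda>x. chart_deriv c is (X \<omega>) x \<bullet> b)" if "\<omega> \<in> space P" for \<omega>
      using continuous_on_subset[OF continuous_on_chart_deriv[OF X_Cr[OF that] t(1,4,5)] K(2)]
      by (intro continuous_intros)
  qed
  then have "\<forall>t\<in>B \<times> Basis. \<exists>C. \<forall>x\<in>snd (fst (fst t)) ` fst (snd (fst t)).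
      sqrt (expectation (\<lambda>\<omega>. (chart_deriv (fst (fst t)) (snd (snd (fst t))) (X \<omega>) x \<bullet> snd t)\<^sup>2)) \<le> C"
    by auto
  then obtain C where C: "\<And>c K is b x. (c, K, is) \<in> B \<Longrightarrow> b \<in> Basis \<Longrightarrow> x \<in> snd c ` K \<Longrightarrow>
      sqrt (expectation (\<lambda>\<omega>. (chart_deriv c is (X \<omega>) x \<bullet> b)\<^sup>2)) \<le> C ((c, K, is), b)"
    unfolding bchoice_iff by fastforce
  \<comment> \<open>The sum dominates each of the finitely many bounds. The summand 1 gives
    positivity even for empty \<open>B\<close>, as the constant is later a divisor.\<close>
  define C' where "C' = 1 + (\<Sum>t\<in>B \<times> Basis. \<bar>C t\<bar>)"
  have "C t \<le> C'" if "t \<in> B \<times> Basis" for t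
    using member_le_sum[OF that, of "\<lambda>t. \<bar>C t\<bar>"] B(1) by (simp add: C'_def)
  then have C': "C ((c, K, is), b) \<le> C'" if "(c, K, is) \<in> B" "b \<in> Basis" for c K "is" b
    using that by simp
  have "0 < C'" unfolding C'_def by (intro add_pos_nonneg sum_nonneg) auto
  then show ?thesis using that C C' by (meson order_trans)
qed

text \<open>The mean of \<open>X\<close> conditioned on the event \<open>A\<close> that it is close to \<open>f\<close> is close to \<open>f\<close>,
  and it is \<open>cov_rep\<close> of the projection of \<open>1\<^sub>A / P A\<close> to the Gaussian space.\<close>

lemma support_approximation:
  assumes f: "f \<in> topological_support P (weak_whitney n M \<A> r) X"
    and U: "openin (weak_whitney n M \<A> r) U" "f \<in> U"
  shows "\<exists>Y\<in>linear_space. cov_rep Y \<in> U"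
proof -
  interpret L: gaussian_space P l2_closure by (rule gaussian_space_l2_closure)
  have fC: "f \<in> Cr_functions n M \<A> r"
    using f by (simp add: topological_support_def topspace_weak_whitney)
  obtain B \<epsilon> where B: "finite B" "B \<subseteq> deriv_controls n M \<A> r" and \<epsilon>: "0 < \<epsilon>"
    and sub: "deriv_ball n M \<A> r B \<epsilon> f \<subseteq> U"
    using weak_whitney_deriv_ball[OF charts U] by metis
  obtain C where C: "C > 0" "\<And>c K is x b. (c, K, is) \<in> B \<Longrightarrow> x \<in> snd c ` K \<Longrightarrow> b \<in> Basis \<Longrightarrow>
    sqrt (expectation (\<lambda>\<omega>. (chart_deriv c is (X \<omega>) x \<bullet> b)\<^sup>2)) \<le> C"
    using controls_bounded[OF B] by metis
  \<comment> \<open>Two errors of size \<open>\<eta>\<close> occur in each component: one from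
    averaging over \<open>A\<close>, one from the approximate projection.\<close>
  define \<eta> where "\<eta> = \<epsilon> / (4 * real DIM(real^'k))"
  have \<eta>: "\<eta> > 0" "\<eta> + \<eta> = \<epsilon> / (2 * real DIM(real^'k))" using \<epsilon> by (auto simp: \<eta>_def field_simps)
  obtain U' where U': "openin (weak_whitney n M \<A> r) U'" "f \<in> U'" "U' \<subseteq> deriv_ball n M \<A> r B \<eta> f"
    using deriv_ball_neighbourhood[OF B \<eta>(1) fC] by blast
  define A where "A = {\<omega>\<in>space P. X \<omega> \<in> U'}"
  have A[measurable]: "A \<in> events" unfolding A_def by (rule X_event[OF U'(1)])
  have PA: "prob A > 0" using f U' by (simp add: topological_support_def A_def)
  define G where "G \<omega> = indicator A \<omega> / prob A" for \<omega>
  have G[measurable]: "G \<in> borel_measurable P" unfolding G_def by measurable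
  have G2: "integrable P (\<lambda>\<omega>. (G \<omega>)\<^sup>2)"
    by (rule integrable_const_bound[where B="(1 / prob A)\<^sup>2"]) (auto simp: G_def indicator_def)
  \<comment> \<open>The projection error is this constant times an L2 norm bounded by
    \<open>C\<close>, hence at most \<open>\<eta>\<close> for all controlled derivatives.\<close>
  have "\<eta> / C > 0" using \<eta> C by simp
  obtain Y where Y: "Y \<in> linear_space"
    "\<And>Z. Z \<in> l2_closure \<Longrightarrow>
      \<bar>expectation (\<lambda>\<omega>. Z \<omega> * G \<omega>) - expectation (\<lambda>\<omega>. Z \<omega> * Y \<omega>)\<bar> \<le> \<eta> / C * sqrt (expectation (\<lambda>\<omega>. (Z \<omega>)\<^sup>2))"
    using approximate_projection[OF G G2 \<open>\<eta> / C > 0\<close>] by metis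
  have "norm (chart_deriv c is (cov_rep Y) x - chart_deriv c is f x) < \<epsilon>"
    if t: "(c, K, is) \<in> B" and x: "x \<in> snd c ` K" for c K "is" x
  proof (rule norm_less_componentwise[OF _ \<epsilon>])
    fix b :: "real^'k" assume b: "b \<in> Basis"
    have t': "c \<in> \<A>" "compactin M K" "K \<subseteq> fst c" "set is \<subseteq> {..<n}" "enat (length is) \<le> r"
      using t B(2) by (auto simp: deriv_controls_def)
    have xc: "x \<in> chart_image c" using chart_on_compact_image(2)[OF charts[OF t'(1)] t'(2,3)] x by blast
    define Z where "Z \<omega> = chart_deriv c is (X \<omega>) x \<bullet> b" for \<omega>
    have Z: "Z \<in> l2_closure" unfolding Z_def
      by (rule chart_deriv_l2_closure[OF t'(1)]) (use t' xc b in auto)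
    note [measurable] = L.measurable[OF Z]
    let ?f = "chart_deriv c is f x \<bullet> b"
    have iG: "integrable P G" by (rule integrable_const_bound[where B="1 / prob A"]) (auto simp: G_def indicator_def)
    have iZG: "integrable P (\<lambda>\<omega>. Z \<omega> * G \<omega>)"
      by (intro integrable_mult_of_squares L.measurable L.integrable_square Z G G2)
    have EG: "expectation G = 1" using PA A by (simp add: G_def[abs_def] sets.Int_space_eq2)
    \<comment> \<open>Outside \<open>A\<close> both sides vanish. As \<open>G\<close> has
      expectation 1, integration bounds the distance of the conditional mean from \<open>?f\<close>
      by \<open>\<eta>\<close>.\<close>
    have near: "\<bar>(Z \<omega> - ?f) * G \<omega>\<bar> \<le> \<eta> * G \<omega>" if "\<omega> \<in> space P" for \<omega>
    proof (cases "\<omega> \<in> A")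
      case True
      then have "X \<omega> \<in> deriv_ball n M \<A> r B \<eta> f" using U'(3) by (auto simp: A_def)
      then have "norm (chart_deriv c is (X \<omega>) x - chart_deriv c is f x) < \<eta>"
        using t x by (auto simp: deriv_ball_def)
      moreover have "\<bar>(chart_deriv c is (X \<omega>) x - chart_deriv c is f x) \<bullet> b\<bar> \<le>
          norm (chart_deriv c is (X \<omega>) x - chart_deriv c is f x)" by (rule Basis_le_norm[OF b])
      ultimately have "\<bar>Z \<omega> - ?f\<bar> \<le> \<eta>" by (simp add: Z_def inner_diff_left)
      moreover have "0 \<le> G \<omega>" by (simp add: G_def)
      ultimately show ?thesis by (simp add: abs_mult mult_right_mono)
    qed (simp add: G_def)
    have "expectation (\<lambda>\<omega>. Z \<omega> * G \<omega>) - ?f = expectation (\<lambda>\<omega>. (Z \<omega> - ?f) * G \<omega>)"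
      using iZG iG EG by (simp add: left_diff_distrib)
    also have "\<bar>\<dots>\<bar> \<le> expectation (\<lambda>\<omega>. \<bar>(Z \<omega> - ?f) * G \<omega>\<bar>)" by (rule integral_abs_bound)
    also have "\<dots> \<le> expectation (\<lambda>\<omega>. \<eta> * G \<omega>)"
      by (rule integral_mono) (use iZG iG near in \<open>auto simp: left_diff_distrib\<close>)
    also have "\<dots> = \<eta>" using EG by simp
    finally have 1: "\<bar>expectation (\<lambda>\<omega>. Z \<omega> * G \<omega>) - ?f\<bar> \<le> \<eta>" .
    have "\<eta> / C * sqrt (expectation (\<lambda>\<omega>. (Z \<omega>)\<^sup>2)) \<le> \<eta> / C * C"
      using C(2)[OF t x b] \<open>\<eta> / C > 0\<close> by (intro mult_left_mono) (auto simp: Z_def)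
    also have "\<dots> = \<eta>" using C(1) by simp
    finally have 2: "\<bar>expectation (\<lambda>\<omega>. Z \<omega> * G \<omega>) - expectation (\<lambda>\<omega>. Z \<omega> * Y \<omega>)\<bar> \<le> \<eta>"
      using Y(2)[OF Z] by linarith
    have "chart_deriv c is (cov_rep Y) x \<bullet> b = expectation (\<lambda>\<omega>. Z \<omega> * Y \<omega>)"
      unfolding Z_def by (rule chart_deriv_cov_rep[OF t'(1) Y(1)]) (use t' xc b in auto)
    then show "\<bar>(chart_deriv c is (cov_rep Y) x - chart_deriv c is f x) \<bullet> b\<bar> \<le> \<epsilon> / (2 * real DIM(real^'k))"
      using 1 2 \<eta>(2) unfolding inner_diff_left by linarith
  qed
  then have "cov_rep Y \<in> deriv_ball n M \<A> r B \<epsilon> f"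
    using cov_rep_Cr[OF Y(1)] by (auto simp: deriv_ball_def)
  with sub Y(1) show ?thesis by blast
qed

text \<open>The neighbourhood is reduced to bounds on controlled derivatives at countably many
  points. These variables form a family in the L2 closure, so \<open>shifted_ball_positive\<close>
  is applied there rather than in \<open>linear_space\<close>.\<close>

lemma cov_rep_neighbourhood_positive:
  assumes Y: "Y \<in> linear_space" and U: "openin (weak_whitney n M \<A> r) U" "cov_rep Y \<in> U"
  shows "0 < prob {\<omega>\<in>space P. X \<omega> \<in> U}"
proof -
  interpret L: gaussian_space P l2_closure by (rule gaussian_space_l2_closure)
  obtain B \<epsilon> where B: "finite B" "B \<subseteq> deriv_controls n M \<A> r" and \<epsilon>: "0 < \<epsilon>"
    and sub: "deriv_ball n M \<A> r B \<epsilon> (cov_rep Y) \<subseteq> U"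
    using weak_whitney_deriv_ball[OF charts U] by metis
  obtain C where C: "C > 0" "\<And>c K is x b. (c, K, is) \<in> B \<Longrightarrow> x \<in> snd c ` K \<Longrightarrow> b \<in> Basis \<Longrightarrow>
    sqrt (expectation (\<lambda>\<omega>. (chart_deriv c is (X \<omega>) x \<bullet> b)\<^sup>2)) \<le> C"
    using controls_bounded[OF B] by metis
  have t: "c \<in> \<A>" "set is \<subseteq> {..<n}" "enat (length is) \<le> r" "compact (snd c ` K)" "snd c ` K \<subseteq> chart_image c"
    if "(c, K, is) \<in> B" for c K "is"
    using that B(2) chart_on_compact_image[OF charts, of c K] by (auto simp: deriv_controls_def)
  \<comment> \<open>Separability of the coordinate space provides a countable dense subset inside
    each compact image.\<close>
  have "\<exists>D. countable D \<and> D \<subseteq> T \<and> T \<subseteq> closure D" for T :: "(nat \<Rightarrow> real) set"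
    using separable[of T] by metis
  then obtain D where D: "\<And>T. countable (D T)" "\<And>T :: (nat \<Rightarrow> real) set. D T \<subseteq> T" "\<And>T. T \<subseteq> closure (D T)" by metis
  define Z where "Z = (\<lambda>(c, K :: 'm set, is) b x \<omega>. chart_deriv c is (X \<omega>) x \<bullet> b)"
  define T where "T = (\<lambda>(c :: 'm chart, K, is :: nat list). snd c ` K)"
  define \<Z> where "\<Z> = (\<Union>(t, b)\<in>B \<times> Basis. Z t b ` D (T t))"
  have Zl2: "Z t b x \<in> l2_closure" if "t \<in> B" "b \<in> Basis" "x \<in> T t" for t b x
  proof -
    obtain c K "is" where t_eq: "t = (c, K, is)" by (cases t)
    show ?thesis unfolding Z_def t_eq case_prod_conv
      by (rule chart_deriv_l2_closure) (use t[of c K "is"] that in \<open>auto simp: t_eq T_def\<close>)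
  qed
  have cont: "continuous_on (T t) (\<lambda>x. Z t b x \<omega>)" if "t \<in> B" "\<omega> \<in> space P" for t b \<omega>
  proof -
    obtain c K "is" where t_eq: "t = (c, K, is)" by (cases t)
    show ?thesis unfolding Z_def T_def t_eq case_prod_conv
      using continuous_on_subset[OF continuous_on_chart_deriv[OF X_Cr[OF that(2)] t(1-3)] t(5)] that(1)
      by (intro continuous_intros) (auto simp: t_eq)
  qed
  have \<Z>: "countable \<Z>"
    unfolding \<Z>_def split_beta
    by (intro countable_UN countable_image D(1) countable_finite finite_cartesian_product B(1) finite_Basis)
  have \<Z>': "\<Z> \<subseteq> l2_closure"
  proof
    fix W assume "W \<in> \<Z>"
    then obtain s b x where "s \<in> B" "b \<in> Basis" "x \<in> D (T s)" "W = Z s b x"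
      unfolding \<Z>_def by blast
    then show "W \<in> l2_closure" using Zl2 D(2) by blast
  qed
  have "small_oscillation P \<Z>"
    unfolding \<Z>_def
  proof (rule small_oscillation_UN)
    show "finite (B \<times> (Basis :: (real^'k) set))" using B(1) by simp
    fix tb :: "('m chart \<times> 'm set \<times> nat list) \<times> (real^'k)" assume "tb \<in> B \<times> Basis"
    then obtain s b where tb: "tb = (s, b)" "s \<in> B" "b \<in> Basis" by auto
    obtain c K "is" where s: "s = (c, K, is)" by (cases s)
    have "small_oscillation P (Z s b ` D (T s))"
    proof (rule small_oscillation_compact[of "T s"])
      show "compact (T s)" using t(4) tb(2) by (auto simp: T_def s)
    qed (use D tb in \<open>auto intro!: L.measurable Zl2 cont\<close>)
    then show "small_oscillation P (case tb of (t, b) \<Rightarrow> Z t b ` D (T t))" by (simp add: tb)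
  qed
  moreover define \<delta> where "\<delta> = \<epsilon> / (2 * real DIM(real^'k))"
  have \<delta>: "\<delta> > 0" using \<epsilon> by (simp add: \<delta>_def)
  \<comment> \<open>A bound uniform in \<open>W\<close>: it keeps the regression coefficients of the
    whole family bounded.\<close>
  moreover have "\<bar>expectation (\<lambda>\<omega>. W \<omega> * Y \<omega>)\<bar> \<le> C * sqrt (expectation (\<lambda>\<omega>. (Y \<omega>)\<^sup>2))" if W: "W \<in> \<Z>" for W
  proof -
    have "\<bar>expectation (\<lambda>\<omega>. W \<omega> * Y \<omega>)\<bar> \<le> sqrt (expectation (\<lambda>\<omega>. (W \<omega>)\<^sup>2)) * sqrt (expectation (\<lambda>\<omega>. (Y \<omega>)\<^sup>2))"
      by (intro integral_cauchy_schwarz L.measurable L.integrable_square measurable integrable_square Y)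
         (use W \<Z>' in auto)
    moreover have "sqrt (expectation (\<lambda>\<omega>. (W \<omega>)\<^sup>2)) \<le> C"
      using W D(2) C(2) by (force simp: \<Z>_def Z_def T_def)
    ultimately show ?thesis by (rule order_trans[OF _ mult_right_mono]) simp
  qed
  ultimately have "0 < prob {\<omega>\<in>space P. \<forall>W\<in>\<Z>. W \<omega> \<in> {expectation (\<lambda>\<omega>. W \<omega> * Y \<omega>) - \<delta> .. expectation (\<lambda>\<omega>. W \<omega> * Y \<omega>) + \<delta>}}"
    using \<Z> \<Z>' Y subset_l2_closure by (intro L.shifted_ball_positive) auto
  also have "\<dots> \<le> prob {\<omega>\<in>space P. X \<omega> \<in> U}"
  proof (rule finite_measure_mono[OF _ X_event[OF U(1)]], intro subsetI CollectI conjI; elim CollectE conjE)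
    fix \<omega> assume \<omega>: "\<omega> \<in> space P"
      and W: "\<forall>W\<in>\<Z>. W \<omega> \<in> {expectation (\<lambda>\<omega>. W \<omega> * Y \<omega>) - \<delta> .. expectation (\<lambda>\<omega>. W \<omega> * Y \<omega>) + \<delta>}"
    have "norm (chart_deriv c is (X \<omega>) x - chart_deriv c is (cov_rep Y) x) < \<epsilon>"
      if B': "(c, K, is) \<in> B" and x: "x \<in> snd c ` K" for c K "is" x
    proof (rule norm_less_componentwise[OF _ \<epsilon>])
      fix b :: "real^'k" assume b: "b \<in> Basis"
      note t = t[OF B']
      let ?d = "\<lambda>x. \<bar>(chart_deriv c is (X \<omega>) x - chart_deriv c is (cov_rep Y) x) \<bullet> b\<bar>"
      let ?D = "D (snd c ` K)"
      \<comment> \<open>The image is compact, hence closed, so the closure adds no points at which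
        the derivatives are uncontrolled. Continuity carries the non-strict bounds from
        \<open>?D\<close> to all of it.\<close>
      have cl: "closure ?D = snd c ` K"
        using D(2,3)[of "snd c ` K"] closure_minimal[OF D(2) compact_imp_closed[OF t(4)]] by auto
      have "continuous_on (closure ?D) ?d" unfolding cl
        using continuous_on_subset[OF continuous_on_chart_deriv[OF X_Cr[OF \<omega>] t(1-3)] t(5)]
          continuous_on_subset[OF continuous_on_chart_deriv[OF cov_rep_Cr[OF Y] t(1-3)] t(5)]
        by (intro continuous_intros)
      moreover have "x \<in> closure ?D" using x cl by simp
      moreover have "?d y \<le> \<delta>" if y: "y \<in> ?D" for y
      proof -
        have "Z (c, K, is) b y \<in> \<Z>" unfolding \<Z>_def using B' b y by (force simp: T_def)
        with W have "Z (c, K, is) b y \<omega> \<in>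
          {expectation (\<lambda>\<omega>. Z (c, K, is) b y \<omega> * Y \<omega>) - \<delta> .. expectation (\<lambda>\<omega>. Z (c, K, is) b y \<omega> * Y \<omega>) + \<delta>}" by blast
        moreover have "chart_deriv c is (cov_rep Y) y \<bullet> b = expectation (\<lambda>\<omega>. Z (c, K, is) b y \<omega> * Y \<omega>)"
          unfolding Z_def case_prod_conv
          by (rule chart_deriv_cov_rep[OF t(1) Y]) (use t b y D(2)[of "snd c ` K"] in auto)
        ultimately show ?thesis
          by (simp add: Z_def inner_diff_left abs_le_iff)
      qed
      ultimately show "?d x \<le> \<epsilon> / (2 * real DIM(real^'k))"
        unfolding \<delta>_def by (rule continuous_le_on_closure)
    qed
    then have "X \<omega> \<in> deriv_ball n M \<A> r B \<epsilon> (cov_rep Y)"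
      using X_Cr[OF \<omega>] by (auto simp: deriv_ball_def)
    with sub show "X \<omega> \<in> U" by blast
  qed auto
  finally show ?thesis .
qed

end

text \<open>The inclusion in \<open>Cr_functions\<close> is stated separately because
  \<open>closure_of\<close> silently discards whatever lies outside the topspace.\<close>

theorem theorem22:
  fixes P :: "'w measure" and n :: nat and M :: "'m topology" and \<A> :: "'m chart set"
    and r :: enat and X :: "'w \<Rightarrow> 'm \<Rightarrow> real^'k"
  assumes "smooth_manifold n M \<A>"
    and "gaussian_random_field P n M \<A> r X"
  shows "{cov_fun P X p j | p j. p \<in> topspace M} \<subseteq> Cr_functions n M \<A> r \<and>
         topological_support P (weak_whitney n M \<A> r) X =
           weak_whitney n M \<A> r closure_of fun_span {cov_fun P X p j | p j. p \<in> topspace M}"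
proof -
  interpret gaussian_field P n M \<A> r X using assms by (rule gaussian_field.intro)
  have "{cov_fun P X p j | p j. p \<in> topspace M} \<subseteq> Cr_functions n M \<A> r"
    by (auto simp: cov_fun_eq_cov_rep intro!: cov_rep_Cr X_component)
  moreover have "topological_support P (weak_whitney n M \<A> r) X =
      weak_whitney n M \<A> r closure_of (cov_rep ` linear_space)"
  proof (intro equalityI subsetI)
    fix f assume f: "f \<in> topological_support P (weak_whitney n M \<A> r) X"
    then have "f \<in> topspace (weak_whitney n M \<A> r)" by (simp add: topological_support_def)
    with support_approximation[OF f] show "f \<in> weak_whitney n M \<A> r closure_of (cov_rep ` linear_space)"
      by (auto simp: in_closure_of)
  next
    \<comment> \<open>An open neighbourhood of \<open>f\<close> contains some
      \<open>cov_rep Y\<close> and is then also a neighbourhood of that function, hence has positive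
      probability.\<close>
    fix f assume "f \<in> weak_whitney n M \<A> r closure_of (cov_rep ` linear_space)"
    then show "f \<in> topological_support P (weak_whitney n M \<A> r) X"
      unfolding in_closure_of topological_support_def using cov_rep_neighbourhood_positive by blast
  qed
  ultimately show ?thesis unfolding span_cov_fun by (intro conjI)
qed

end
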